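(* Let $G=H+J$ be a finite group of triangular type over a finite field $k$, and let $G'=H'+J'$ be a subgroup of triangular type in $G$. Then for every supercharacter $\phi$ of $G'$, the superinduction $\mathrm{SInd}\,\phi$ is a sum of supercharacters of $G$ with nonnegative rational coefficients.
   Context: **Finite groups of triangular type.** Let $k=\mathbb F_q$ be a finite field, $J$ a finite-dimensional associative nilpotent $k$-algebra, and $H$ a finite abelian group with $\mathrm{char}\,k\nmid |H|$. Assume $H$ acts $k$-linearly on $J$ on the left, $(h,x)\mapsto hx$, and on the right, $(h,x)\mapsto xh$, the two actions commute ($(hx)h'=h(xh')$), and for all $h\in H$, $x,y\in J$: $h(xy)=(hx)y$, $(xy)h=x(yh)$, $x(hy)=(xh)y$. Then $A=kH\oplus J$ is an associative unital algebra with multiplication extending $(h_1+x_1)(h_2+x_2)=h_1h_2+h_1x_2+x_1h_2+x_1x_2$, and $G=H+J=\{h+x: h\in H,\ x\in J\}\subset A$ is a finite group under this multiplication, called a finite group of triangular type. Put $N=1+J$. **Subgroups of triangular type.** If $H'$ is a subgroup of $H$ and $J'$ is a subalgebra of $J$ invariant under left and right multiplication by $H'$, then $G'=H'+J'$ is a subgroup of $G$, called a subgroup of triangular type. It is itself a finite group of triangular type (with data $H',J'$), and its supercharacters are defined by the construction below with $(H',J')$ in place of $(H,J)$ and the same additive character of $k$. **Orbits.** Let $\widetilde G$ be the set of triples $\tau=(t,a,b)$, $t\in H$, $a,b\in N$, with the group operation $(t_1,a_1,b_1)(t_2,a_2,b_2)=(t_1t_2,\ t_2^{-1}a_1t_2a_2,\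 t_2^{-1}b_1t_2b_2)$. It acts on $J$ by $\rho_\tau(x)=taxb^{-1}t^{-1}$, on the dual space $J^*$ by $(\rho^*_\tau\lambda)(x)=\lambda(\rho_{\tau^{-1}}(x))$, and on $G$ by $R_\tau(g)=1+ta(g-1)b^{-1}t^{-1}$ (computed in $A$; the result lies in $G$). For an idempotent $e\in kH$ put $e'=1-e$, $J_e=eJe$, $H_e=eHe$ (a group with identity $e$), $G_e=eGe=H_e+J_e$ (again a finite group of triangular type, with $N_e=e+J_e$), and let $\widetilde G_e$ be the corresponding group of triples acting on $J_e$ and $J_e^*$. The space $J_e^*$ is identified with the subspace of $J^*$ of all linear forms vanishing on $eJe'\oplus e'Je\oplus e'Je'$. A $\widetilde G$-orbit in $J^*$ is singular (with respect to $H$) if it meets $J_e^*$ for some idempotent $e\neq 1$ of $kH$, and regular otherwise; regularity of $\widetilde G_e$-orbits in $J_e^*$ with respect to $H_e$ is defined in the same way, i.e. the orbit does not meet $J_f^*$ for any idempotent $f\ne e$ of $kH_e=kHe$. **Supercharacters.** For an idempotent $e\in kH$ let $H(e)=\{h\in H: he=e\}$. Let $\mathfrak A$ be the set of triples $\alpha=(e,\theta,\omega^* )$, where $e$ is an idempotent of $kH$, $\theta:H(e)\to\mathbb C^*$ is a linear character (one-dimensional representation), and $\omega^*$ is a regular (with respect to $H_e$) $\widetilde G_e$-orbit in $J_e^*$. Fix a nontrivial character $t\mapsto\varepsilon^t$ of the additive group $k=\mathbb F_q$ with values in $\mathbb C^*$. For $\alpha\in\mathfrak A$ choose $\lambda\in\omega^*\subset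 J_e^*\subset J^*$, put $J_{\lambda,\mathrm{right}}=\{x\in J:\lambda(xJ)=0\}$ and $G_\alpha=H(e)+J_{\lambda,\mathrm{right}}$ (a subgroup of $G$), and define the linear character $\xi_{\theta,\lambda}(h+x)=\theta(h)\varepsilon^{\lambda(x)}$ of $G_\alpha$ ($h\in H(e)$, $x\in J_{\lambda,\mathrm{right}}$). The supercharacter of $G$ attached to $\alpha$ is the induced character $\chi_\alpha=\mathrm{Ind}(\xi_{\theta,\lambda},G_\alpha,G)$; it does not depend on the choice of $\lambda\in\omega^*$. **Superinduction.** For a function $\phi$ on $G'$ constant on superclasses of $G'$ (the orbits of the group of triples $\widetilde{G'}$ acting on $G'$ by the formula for $R_\tau$; supercharacters of $G'$ are such functions), let $\dot\phi$ be the function on $G$ equal to $\phi$ on $G'$ and to zero outside $G'$. The superinduction of $\phi$ is the function on $G$ $$\mathrm{SInd}\,\phi(g)=\frac{|H|}{|G|\cdot|G'|}\sum_{\tau\in\widetilde G}\dot\phi(R_\tau(g))=\frac{|H|}{|G|\cdot|G'|}\sum_{a,b\in N,\ t\in H}\dot\phi\bigl(1+ta(g-1)bt^{-1}\bigr).$$ *)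

theory Defs
  imports
    Complex_Main
    "HOL-Library.Cardinality"
    "HOL-Library.FuncSet"
    "HOL-Library.Poly_Mapping"
    "HOL-Library.Product_Plus"
    "HOL-Algebra.Group"
begin

definition nontrivial_additive_character :: "('k::ab_group_add \<Rightarrow> complex) \<Rightarrow> bool" where
  "nontrivial_additive_character \<epsilon> \<longleftrightarrow>
     (\<forall>s. \<epsilon> s \<noteq> 0) \<and> (\<forall>s t. \<epsilon> (s + t) = \<epsilon> s * \<epsilon> t) \<and> (\<exists>s. \<epsilon> s \<noteq> 1)"

definition induced_character ::
    "('a, 'm) monoid_scheme \<Rightarrow> 'a set \<Rightarrow> ('a \<Rightarrow> complex) \<Rightarrow> 'a \<Rightarrow> complex" where
  "induced_character G Q \<xi> =
     (\<lambda>g\<in>carrier G.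
        (\<Sum>y \<in> {y \<in> carrier G. inv\<^bsub>G\<^esub> y \<otimes>\<^bsub>G\<^esub> g \<otimes>\<^bsub>G\<^esub> y \<in> Q}.
           \<xi> (inv\<^bsub>G\<^esub> y \<otimes>\<^bsub>G\<^esub> g \<otimes>\<^bsub>G\<^esub> y)) / of_nat (card Q))"

text \<open>
  The field \<open>k\<close>, the algebra \<open>J\<close> and the group \<open>H\<close> are the types \<open>'k\<close>, \<open>'j\<close> and \<open>'h\<close>.
  The finite abelian group \<open>H\<close> is written additively, so that its group algebra \<open>kH\<close> is the
  convolution algebra \<open>('h, 'k) poly_mapping\<close>; the element \<open>h\<close> of \<open>kH\<close> is
  \<open>Poly_Mapping.single h 1\<close>. The class \<open>ring\<close> does not require a unit.
\<close>

type_synonym ('h, 'k, 'j) alg = "('h, 'k) poly_mapping \<times> 'j"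

locale triangular_type = vector_space scale
  for scale :: "'k::{field,finite} \<Rightarrow> 'j::ring \<Rightarrow> 'j" +
  fixes lact :: "'h::{ab_group_add,finite} \<Rightarrow> 'j \<Rightarrow> 'j"
    and ract :: "'j \<Rightarrow> 'h \<Rightarrow> 'j"
  assumes mult_scale_left: "scale c x * y = scale c (x * y)"
    and mult_scale_right: "x * scale c y = scale c (x * y)"
    and finite_dim: "\<exists>Basis. finite_dimensional_vector_space scale Basis"
    and nilpotent: "\<exists>n. \<forall>x xs. length xs = n \<longrightarrow> foldl (*) x xs = (0::'j)"
    and char_not_dvd: "\<not> CHAR('k) dvd CARD('h)"
    and lact_add: "lact h (x + y) = lact h x + lact h y"
    and lact_scale: "lact h (scale c x) = scale c (lact h x)"
    and lact_one: "lact 0 x = x"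
    and lact_mult: "lact (h + h') x = lact h (lact h' x)"
    and ract_add: "ract (x + y) h = ract x h + ract y h"
    and ract_scale: "ract (scale c x) h = scale c (ract x h)"
    and ract_one: "ract x 0 = x"
    and ract_mult: "ract x (h + h') = ract (ract x h) h'"
    and act_commute: "ract (lact h x) h' = lact h (ract x h')"
    and lact_assoc: "lact h (x * y) = lact h x * y"
    and ract_assoc: "ract (x * y) h = x * ract y h"
    and act_balanced: "x * lact h y = ract x h * y"
begin

subsection \<open>The algebra \<open>A = kH \<oplus> J\<close>\<close>

text \<open>
  An element of \<open>A\<close> is a pair of its components in \<open>kH\<close> and in \<open>J\<close>; addition and subtraction are
  the componentwise ones.
\<close>

definition scaleA :: "'k \<Rightarrow> ('h, 'k, 'j) alg \<Rightarrow> ('h, 'k, 'j) alg" where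
  "scaleA c a = (Poly_Mapping.map ((*) c) (fst a), scale c (snd a))"

definition mulA ::
    "('h, 'k, 'j) alg \<Rightarrow> ('h, 'k, 'j) alg \<Rightarrow> ('h, 'k, 'j) alg"
    (infixl \<open>\<cdot>\<close> 70) where
  "a \<cdot> b =
     (fst a * fst b,
      (\<Sum>h\<in>UNIV. scale (Poly_Mapping.lookup (fst a) h) (lact h (snd b))) +
      (\<Sum>h\<in>UNIV. scale (Poly_Mapping.lookup (fst b) h) (ract (snd a) h)) +
      snd a * snd b)"

definition oneA :: "('h, 'k, 'j) alg" where
  "oneA = (1, 0)"

definition inH :: "'h \<Rightarrow> ('h, 'k, 'j) alg" where
  "inH h = (Poly_Mapping.single h 1, 0)"

definition inJ :: "'j \<Rightarrow> ('h, 'k, 'j) alg" where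
  "inJ x = (0, x)"

text \<open>
  In the following three subsections \<open>(e, S, I)\<close> stands for a finite group \<open>S + I\<close> of triangular
  type inside \<open>A\<close>, where \<open>e\<close> is its identity, \<open>S\<close> its abelian part (a subset of \<open>kH\<close>) and \<open>I\<close> its
  nilpotent part (a subset of \<open>J\<close>). The cases that occur are \<open>(1, H, J)\<close>, \<open>(1, H', J')\<close> and the
  corners \<open>(f, f S f, f I f)\<close> of these.
\<close>

subsection \<open>Orbits\<close>

definition tri_group ::
    "('h, 'k, 'j) alg \<Rightarrow> ('h, 'k, 'j) alg set \<Rightarrow>
     ('h, 'k, 'j) alg set \<Rightarrow> ('h, 'k, 'j) alg monoid" where
  "tri_group e S I = \<lparr>carrier = {h + x | h x. h \<in> S \<and> x \<in> I}, mult = (\<cdot>), one = e\<rparr>"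

definition unip ::
    "('h, 'k, 'j) alg \<Rightarrow> ('h, 'k, 'j) alg set \<Rightarrow>
     ('h, 'k, 'j) alg set" where
  "unip e I = {e + x | x. x \<in> I}"

definition triples ::
    "('h, 'k, 'j) alg \<Rightarrow> ('h, 'k, 'j) alg set \<Rightarrow>
     ('h, 'k, 'j) alg set \<Rightarrow>
     (('h, 'k, 'j) alg \<times> ('h, 'k, 'j) alg \<times> ('h, 'k, 'j) alg) monoid"
  where
  "triples e S I =
     \<lparr>carrier = S \<times> unip e I \<times> unip e I,
      mult = (\<lambda>(t1, a1, b1) (t2, a2, b2).
        (t1 \<cdot> t2,
         inv\<^bsub>tri_group e S I\<^esub> t2 \<cdot> a1 \<cdot> t2 \<cdot> a2,
         inv\<^bsub>tri_group e S I\<^esub> t2 \<cdot> b1 \<cdot> t2 \<cdot> b2)),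
      one = (e, e, e)\<rparr>"

fun rho ::
    "('h, 'k, 'j) alg \<Rightarrow> ('h, 'k, 'j) alg set \<Rightarrow> ('h, 'k, 'j) alg set \<Rightarrow>
     ('h, 'k, 'j) alg \<times> ('h, 'k, 'j) alg \<times> ('h, 'k, 'j) alg \<Rightarrow>
     ('h, 'k, 'j) alg \<Rightarrow> ('h, 'k, 'j) alg" where
  "rho e S I (t, a, b) x =
     t \<cdot> a \<cdot> x \<cdot> inv\<^bsub>tri_group e S I\<^esub> b \<cdot> inv\<^bsub>tri_group e S I\<^esub> t"

text \<open>The action on \<open>G\<close>: \<open>R\<^sub>\<tau>(g) = e + t a (g - e) b\<inverse> t\<inverse>\<close>.\<close>

definition R where
  "R e S I \<tau> g = e + rho e S I \<tau> (g - e)"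

text \<open>Linear forms \<open>\<mu>\<close> on \<open>I\<close>, as functions on \<open>A\<close> that are \<open>undefined\<close> outside \<open>I\<close>.\<close>

definition dual ::
    "('h, 'k, 'j) alg set \<Rightarrow> (('h, 'k, 'j) alg \<Rightarrow> 'k) set" where
  "dual I = {\<mu> \<in> extensional I.
     (\<forall>x\<in>I. \<forall>y\<in>I. \<mu> (x + y) = \<mu> x + \<mu> y) \<and> (\<forall>c. \<forall>x\<in>I. \<mu> (scaleA c x) = c * \<mu> x)}"

definition rho_dual where
  "rho_dual e S I \<tau> \<mu> = (\<lambda>x\<in>I. \<mu> (rho e S I (inv\<^bsub>triples e S I\<^esub> \<tau>) x))"

definition dual_orbits ::
    "('h, 'k, 'j) alg \<Rightarrow> ('h, 'k, 'j) alg set \<Rightarrow>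
     ('h, 'k, 'j) alg set \<Rightarrow> (('h, 'k, 'j) alg \<Rightarrow> 'k) set set" where
  "dual_orbits e S I =
     {{rho_dual e S I \<tau> \<mu> | \<tau>. \<tau> \<in> carrier (triples e S I)} | \<mu>. \<mu> \<in> dual I}"

subsection \<open>Idempotents and regular orbits\<close>

definition idempotents ::
    "('h, 'k, 'j) alg set \<Rightarrow> ('h, 'k, 'j) alg set" where
  "idempotents S = {f \<in> module.span scaleA S. f \<cdot> f = f}"

definition corner ::
    "('h, 'k, 'j) alg \<Rightarrow> ('h, 'k, 'j) alg set \<Rightarrow>
     ('h, 'k, 'j) alg set" where
  "corner f M = {f \<cdot> x \<cdot> f | x. x \<in> M}"

text \<open>
  The dual of \<open>f I f\<close> inside the dual of \<open>I\<close>: the forms that vanish on \<open>f I f'\<close>, \<open>f' I f\<close> and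
  \<open>f' I f'\<close>, where \<open>f' = e - f\<close>. The identification with the forms on \<open>f I f\<close> is
  restriction to \<open>f I f\<close>.
\<close>

definition corner_dual ::
    "('h, 'k, 'j) alg \<Rightarrow> ('h, 'k, 'j) alg set \<Rightarrow>
     ('h, 'k, 'j) alg \<Rightarrow> (('h, 'k, 'j) alg \<Rightarrow> 'k) set" where
  "corner_dual e I f = {\<mu> \<in> dual I. \<forall>x\<in>I.
     \<mu> (f \<cdot> x \<cdot> (e - f)) = 0 \<and> \<mu> ((e - f) \<cdot> x \<cdot> f) = 0 \<and> \<mu> ((e - f) \<cdot> x \<cdot> (e - f)) = 0}"

definition regular_orbits ::
    "('h, 'k, 'j) alg \<Rightarrow> ('h, 'k, 'j) alg set \<Rightarrow>
     ('h, 'k, 'j) alg set \<Rightarrow> (('h, 'k, 'j) alg \<Rightarrow> 'k) set set" where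
  "regular_orbits e S I = {\<omega> \<in> dual_orbits e S I.
     \<forall>f \<in> idempotents S. f \<noteq> e \<longrightarrow> \<omega> \<inter> corner_dual e I f = {}}"

subsection \<open>Supercharacters\<close>

definition fixing ::
    "('h, 'k, 'j) alg set \<Rightarrow> ('h, 'k, 'j) alg \<Rightarrow>
     ('h, 'k, 'j) alg set" where
  "fixing S f = {h \<in> S. h \<cdot> f = f}"

definition linear_characters ::
    "('h, 'k, 'j) alg set \<Rightarrow> (('h, 'k, 'j) alg \<Rightarrow> complex) set" where
  "linear_characters M = {\<theta> \<in> extensional M.
     (\<forall>h\<in>M. \<theta> h \<noteq> 0) \<and> (\<forall>h\<in>M. \<forall>h'\<in>M. \<theta> (h \<cdot> h') = \<theta> h * \<theta> h')}"

text \<open>The set of triples \<open>(f, \<theta>, \<omega>\<^sup>*)\<close> that label the supercharacters.\<close>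

definition labels where
  "labels e S I = {(f, \<theta>, \<omega>). f \<in> idempotents S \<and> \<theta> \<in> linear_characters (fixing S f) \<and>
     \<omega> \<in> regular_orbits f (corner f S) (corner f I)}"

definition J_right ::
    "('h, 'k, 'j) alg set \<Rightarrow> (('h, 'k, 'j) alg \<Rightarrow> 'k) \<Rightarrow>
     ('h, 'k, 'j) alg set" where
  "J_right I \<mu> = {x \<in> I. \<forall>y\<in>I. \<mu> (x \<cdot> y) = 0}"

definition label_group where
  "label_group S I f \<mu> = {h + x | h x. h \<in> fixing S f \<and> x \<in> J_right I \<mu>}"

text \<open>
  \<open>\<xi>(h + x) = \<theta>(h) \<epsilon>(\<mu>(x))\<close>: the summands \<open>h\<close> and \<open>x\<close> of \<open>g = h + x\<close> are the two components of
  the pair \<open>g\<close>.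
\<close>

definition xi ::
    "('k \<Rightarrow> complex) \<Rightarrow> (('h, 'k, 'j) alg \<Rightarrow> complex) \<Rightarrow>
     (('h, 'k, 'j) alg \<Rightarrow> 'k) \<Rightarrow> ('h, 'k, 'j) alg \<Rightarrow> complex" where
  "xi \<epsilon> \<theta> \<mu> g = \<theta> (fst g, 0) * \<epsilon> (\<mu> (0, snd g))"

definition supercharacter where
  "supercharacter \<epsilon> e S I f \<theta> \<mu> =
     induced_character (tri_group e S I) (label_group S I f \<mu>) (xi \<epsilon> \<theta> \<mu>)"

text \<open>All choices of \<open>\<mu>\<close> in \<open>\<omega>\<^sup>*\<close> are admitted; they give the same character.\<close>

definition supercharacters where
  "supercharacters \<epsilon> e S I =
     {supercharacter \<epsilon> e S I f \<theta> \<mu> | f \<theta> \<omega> \<mu>.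
        (f, \<theta>, \<omega>) \<in> labels e S I \<and> \<mu> \<in> corner_dual e I f \<and> restrict \<mu> (corner f I) \<in> \<omega>}"

subsection \<open>Subgroups of triangular type and superinduction\<close>

definition subgroup_data :: "'h set \<Rightarrow> 'j set \<Rightarrow> bool" where
  "subgroup_data H' J' \<longleftrightarrow>
     0 \<in> H' \<and> (\<forall>h\<in>H'. \<forall>h'\<in>H'. h + h' \<in> H') \<and> (\<forall>h\<in>H'. - h \<in> H') \<and>
     subspace J' \<and> (\<forall>x\<in>J'. \<forall>y\<in>J'. x * y \<in> J') \<and>
     (\<forall>h\<in>H'. \<forall>x\<in>J'. lact h x \<in> J' \<and> ract x h \<in> J')"

definition tri_subgroup where
  "tri_subgroup H' J' = tri_group oneA (inH ` H') (inJ ` J')"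

definition supercharacters_of where
  "supercharacters_of \<epsilon> H' J' = supercharacters \<epsilon> oneA (inH ` H') (inJ ` J')"

definition SInd ::
    "'h set \<Rightarrow> 'j set \<Rightarrow> (('h, 'k, 'j) alg \<Rightarrow> complex) \<Rightarrow>
     ('h, 'k, 'j) alg \<Rightarrow> complex" where
  "SInd H' J' \<phi> g =
     of_nat (CARD('h)) /
       (of_nat (card (carrier (tri_subgroup UNIV UNIV))) * of_nat (card (carrier (tri_subgroup H' J')))) *
     (\<Sum>\<tau> \<in> carrier (triples oneA (range inH) (range inJ)).
        let g' = R oneA (range inH) (range inJ) \<tau> g
        in if g' \<in> carrier (tri_subgroup H' J') then \<phi> g' else 0)"

end

end

theory Submission
  imports Defs
begin

text \<open>
  For a function \<open>F\<close> on \<open>G\<close> that is constant on superclasses put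
  \<open>F\<^sub>h(\<mu>) = (\<Sum>x\<in>J. F(h + x) \<epsilon>(-\<mu>(x)))\<close> for \<open>h \<in> H\<close> and \<open>\<mu> \<in> J\<^sup>*\<close>. Moving \<open>\<mu>\<close> within its orbit
  only changes \<open>F\<^sub>h(\<mu>)\<close> by a factor that depends on \<open>h\<close> but not on \<open>F\<close>, so \<open>F\<close> is determined by the
  values at one form \<open>\<eta>\<close> in each orbit. If \<open>\<eta>\<close> is chosen in \<open>J\<^sub>e\<^sup>*\<close> with \<open>e\<close> minimal, then
  \<open>F\<^sub>h(\<eta>) = 0\<close> unless \<open>h e = e\<close>, and \<open>\<eta>\<close> gives a regular orbit in \<open>J\<^sub>e\<^sup>*\<close>. For the supercharacter \<open>\<chi>\<close>
  attached to \<open>e\<close>, \<open>\<theta>\<close> and \<open>\<eta>\<close>, the value \<open>\<chi>\<^sub>h(\<eta>)\<close> is a positive rational multiple of \<open>\<theta>(h)\<close>, and \<open>\<chi>\<^sub>h\<close>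
  vanishes on all other orbits. Expanding \<open>h \<mapsto> F\<^sub>h(\<eta>)\<close> in the characters \<open>\<theta>\<close> of \<open>H(e)\<close> therefore expands
  \<open>F\<close> in supercharacters, with coefficients that are positive rational multiples of
  \<open>(\<Sum>h\<in>H(e). F\<^sub>h(\<eta>) \<theta>(h)\<inverse>)\<close>. For a superinduced supercharacter these are nonnegative and
  rational, because they reduce to sums of linear characters over subgroups of \<open>G\<close>, each of
  which is zero or the order of the subgroup.
\<close>

text \<open>The subgroup \<open>G_\<alpha>\<close> and its character are forced by the right
  translations \<open>g \<mapsto> 1 + (g - 1)(1 + v)\<close>. Averaging over \<open>v\<close> shows
  that only those \<open>x\<close> contribute to \<open>F_h(\<mu>)\<close> for which
  \<open>\<mu>\<close> vanishes on \<open>(h - 1 + x) J\<close>. For \<open>\<eta>\<close> in the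
  dual of \<open>e J e\<close> and \<open>h e = e\<close> the part \<open>h - 1\<close> is invisible
  and the right annihilator of \<open>\<eta>\<close> remains, so the sum of
  \<open>F_h(\<eta>) \<theta>(h)\<inverse>\<close> is the sum of \<open>F \<xi>\<inverse>\<close>
  over \<open>G_\<alpha>\<close>. Conversely, the indicator of the annihilator is an average of
  \<open>\<epsilon>(\<eta>(x v))\<close>, so the transform of \<open>\<xi>\<close> extended by zero
  counts solutions \<open>v\<close>. Inducing could still spoil positivity, since conjugation by
  \<open>y\<close> brings in the phase \<open>\<epsilon>(-\<eta>(y (h - 1) y\<inverse>))\<close>; it
  is 1 for every \<open>y\<close> that contributes. Dividing by these counts is what makes the
  coefficients rational instead of visibly integral. Minimality of \<open>e\<close> is demanded over
  the full orbit; lifting elements of the corner group to \<open>G\<close> turns it into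
  regularity.\<close>

lemma sum_eq_0_by_shift:
  fixes \<psi> :: "'a \<Rightarrow> complex"
  assumes "finite M" and f: "\<And>x. x \<in> M \<Longrightarrow> f x \<in> M" "inj_on f M"
    and c: "c \<noteq> 1" "\<And>x. x \<in> M \<Longrightarrow> \<psi> (f x) = c * \<psi> x"
  shows "sum \<psi> M = 0"
proof -
  have "f ` M = M"
    using assms(1) f by (intro card_subset_eq) (auto simp: card_image)
  then have "sum \<psi> M = (\<Sum>x\<in>M. \<psi> (f x))"
    using sum.reindex[OF f(2), of \<psi>] by simp
  also have "\<dots> = c * sum \<psi> M"
    by (simp add: c(2) sum_distrib_left)
  finally show ?thesis using c(1) by simp
qed

subsection \<open>Characters of finite abelian groups\<close>

text \<open>Fixing the values off the carrier makes equality of characters an equality on the group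
  and keeps the set finite; the shape matches \<open>linear_characters\<close>.\<close>

definition group_characters :: "('a, 'm) monoid_scheme \<Rightarrow> ('a \<Rightarrow> complex) set" where
  "group_characters G = {\<theta> \<in> extensional (carrier G). (\<forall>x\<in>carrier G. \<theta> x \<noteq> 0) \<and>
     (\<forall>x\<in>carrier G. \<forall>y\<in>carrier G. \<theta> (x \<otimes>\<^bsub>G\<^esub> y) = \<theta> x * \<theta> y)}"

lemma complex_nth_root_ex:
  fixes w :: complex
  assumes "n > 0"
  shows "\<exists>z. z ^ n = w"
proof
  show "rcis (root n (cmod w)) (Arg w / n) ^ n = w"
    using assms by (simp add: DeMoivre2 rcis_cmod_Arg)
qed

context comm_group
begin

text \<open>Only the values on \<open>K\<close> are constrained, so a character can be extended to a
  larger subgroup without changing its type.\<close>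

definition partial_character :: "'a set \<Rightarrow> ('a \<Rightarrow> complex) \<Rightarrow> bool" where
  "partial_character K \<chi> \<longleftrightarrow> subgroup K G \<and> (\<forall>x\<in>K. \<chi> x \<noteq> 0) \<and>
     (\<forall>x\<in>K. \<forall>y\<in>K. \<chi> (x \<otimes> y) = \<chi> x * \<chi> y)"

lemma partial_character_one: "partial_character K \<chi> \<Longrightarrow> \<chi> \<one> = 1"
  unfolding partial_character_def
  by (metis mult_cancel_left1 l_one one_closed subgroup.one_closed)

lemma partial_character_pow:
  assumes "partial_character K \<chi>" "x \<in> K"
  shows "x [^] (i::nat) \<in> K \<and> \<chi> (x [^] i) = \<chi> x ^ i"
proof -
  have K: "subgroup K G" using assms by (simp add: partial_character_def)
  show ?thesis
  proof (induction i)
    case 0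
    then show ?case
      using K partial_character_one[OF assms(1)] by (simp add: subgroup.one_closed)
  next
    case (Suc i)
    then show ?case using assms K
      by (simp add: partial_character_def subgroup.m_closed)
  qed
qed

text \<open>The extension sends \<open>k \<otimes> g [^] i\<close> to
  \<open>\<chi> k * z ^ i\<close>. By minimality of \<open>n\<close>, every \<open>d\<close> with
  \<open>g [^] d\<close> in \<open>K\<close> is a multiple of \<open>n\<close>, where
  \<open>z\<close> was chosen compatibly; hence the value is well defined. The choice of the root
  \<open>z\<close> stays free, which \<open>group_characters_separate\<close> exploits.\<close>

lemma extend_partial_character:
  assumes fin: "finite (carrier G)" and K: "partial_character K \<chi>" and g: "g \<in> carrier G"
    and n: "n > 0" "g [^] n \<in> K" "\<And>m::nat. 0 < m \<Longrightarrow> m < n \<Longrightarrow> g [^] m \<notin> K"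
    and z: "z ^ n = \<chi> (g [^] n)"
  obtains L \<chi>' where "partial_character L \<chi>'" "K \<subseteq> L" "g \<in> L" "\<And>x. x \<in> K \<Longrightarrow> \<chi>' x = \<chi> x"
    "\<chi>' g = z"
proof -
  have sK: "subgroup K G" using K by (simp add: partial_character_def)
  have KG: "\<And>x. x \<in> K \<Longrightarrow> x \<in> carrier G" by (rule subgroup.mem_carrier[OF sK])
  have "\<chi> (g [^] n) \<noteq> 0" using K n(2) by (simp add: partial_character_def)
  then have nz: "z \<noteq> 0" using z n(1) by (metis zero_power)
  have pow: "g [^] d \<in> K \<Longrightarrow> z ^ d = \<chi> (g [^] d)" for d :: nat
  proof -
    assume d: "g [^] d \<in> K"
    let ?q = "d div n" and ?r = "d mod n"
    have e: "g [^] d = (g [^] n) [^] ?q \<otimes> g [^] ?r"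
      using g by (simp add: nat_pow_pow nat_pow_mult)
    have p: "(g [^] n) [^] ?q \<in> K" "\<chi> ((g [^] n) [^] ?q) = \<chi> (g [^] n) ^ ?q"
      using partial_character_pow[OF K n(2)] by auto
    have "g [^] ?r = inv ((g [^] n) [^] ?q) \<otimes> g [^] d"
      unfolding e using g p(1) KG by (simp add: m_assoc[symmetric])
    then have "g [^] ?r \<in> K"
      using p(1) d sK by (simp add: subgroup.m_closed subgroup.m_inv_closed)
    then have "?r = 0" using n(3)[of ?r] n(1) by fastforce
    then have "d = n * ?q" by auto
    then have "z ^ d = (z ^ n) ^ ?q" by (metis power_mult)
    with p z e \<open>?r = 0\<close> g show ?thesis by (simp add: nat_pow_pow)
  qed
  have wd1: "\<chi> k * z ^ i = \<chi> k' * z ^ j"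
    if "k \<in> K" "k' \<in> K" "i \<le> j" "k \<otimes> g [^] i = k' \<otimes> g [^] j" for k k' and i j :: nat
  proof -
    define d where "d = j - i"
    have j: "j = d + i" using that d_def by simp
    have "k \<otimes> g [^] i = (k' \<otimes> g [^] d) \<otimes> g [^] i"
      using that(4) KG that(1,2) g by (simp add: j nat_pow_mult[symmetric] m_assoc)
    then have kk: "k = k' \<otimes> g [^] d" using KG that(1,2) g by simp
    then have "g [^] d = inv k' \<otimes> k" using KG that(1,2) g by (simp add: m_assoc[symmetric])
    then have gd: "g [^] d \<in> K" using that sK by (simp add: subgroup.m_closed subgroup.m_inv_closed)
    have "\<chi> k = \<chi> k' * z ^ d"
      using K that(2) gd pow[OF gd] unfolding kk partial_character_def by simp
    then show ?thesis by (simp add: j power_add)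
  qed
  have wd: "\<chi> k * z ^ i = \<chi> k' * z ^ j"
    if "k \<in> K" "k' \<in> K" "k \<otimes> g [^] i = k' \<otimes> g [^] j" for k k' and i j :: nat
    using wd1[of k k' i j] wd1[of k' k j i] that by (metis linorder_le_cases)
  define L where "L = {k \<otimes> g [^] i | k i. k \<in> K \<and> i \<in> (UNIV :: nat set)}"
  \<comment> \<open>By \<open>wd\<close> all representations of \<open>x\<close> give the same
    value, so the description is meaningful on \<open>L\<close>.\<close>
  define \<chi>' where "\<chi>' x = (THE w. \<exists>k i. k \<in> K \<and> x = k \<otimes> g [^] (i::nat) \<and> w = \<chi> k * z ^ i)" for x
  have val: "\<chi>' (k \<otimes> g [^] i) = \<chi> k * z ^ i" if "k \<in> K" for k and i :: nat
    unfolding \<chi>'_def by (rule the_equality) (use that wd in \<open>metis (no_types, lifting)\<close>)+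
  have prod: "(k \<otimes> g [^] i) \<otimes> (k' \<otimes> g [^] j) = (k \<otimes> k') \<otimes> g [^] (i + j)"
    if "k \<in> K" "k' \<in> K" for k k' and i j :: nat
    using that KG g by (simp add: nat_pow_mult[symmetric] m_ac)
  have Lc: "L \<subseteq> carrier G" using KG g by (auto simp: L_def)
  have Lm: "x \<otimes> y \<in> L" if "x \<in> L" "y \<in> L" for x y
    using that prod subgroup.m_closed[OF sK] unfolding L_def by fastforce
  have oneK: "\<one> \<in> K" using sK by (rule subgroup.one_closed)
  have KL: "K \<subseteq> L"
  proof
    fix k assume "k \<in> K"
    then show "k \<in> L" unfolding L_def using KG by (auto intro!: exI[of _ k] exI[of _ "0::nat"])
  qed
  have gL: "g \<in> L" unfolding L_def using g oneK by (auto intro!: exI[of _ \<one>] exI[of _ "1::nat"])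
  \<comment> \<open>Finiteness supplies inverses: multiplication by \<open>x\<close> is an injective
    self-map of \<open>L\<close>, hence reaches \<open>\<one>\<close>.\<close>
  have Linv: "inv x \<in> L" if "x \<in> L" for x
  proof -
    have xc: "x \<in> carrier G" using that Lc by auto
    have inj: "inj_on ((\<otimes>) x) L" using xc Lc by (auto intro!: inj_onI dest!: subsetD[OF Lc])
    have "finite L" using Lc fin finite_subset by blast
    then have "(\<otimes>) x ` L = L" using inj Lm[OF that] by (intro card_subset_eq) (auto simp: card_image)
    moreover have "\<one> \<in> L" using KL oneK by auto
    ultimately obtain y where "y \<in> L" "\<one> = x \<otimes> y" by (metis imageE)
    then show ?thesis using xc Lc by (metis inv_equality m_comm subsetD)
  qed
  have "subgroup L G" using Lc Lm Linv gL by (intro subgroupI) auto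
  then have "partial_character L \<chi>'"
    unfolding partial_character_def L_def using val prod K nz sK
    by (auto simp: partial_character_def subgroup.m_closed power_add)
  moreover have "\<chi>' x = \<chi> x" if "x \<in> K" for x
    using val[OF that, of 0] that KG by simp
  moreover have "\<chi>' g = z" using val[OF oneK, of 1] g partial_character_one[OF K] by simp
  ultimately show ?thesis using that KL gL by blast
qed

lemma least_power_in_subgroup:
  assumes fin: "finite (carrier G)" and "subgroup K G" and g: "g \<in> carrier G"
  obtains n :: nat where "n > 0" "g [^] n \<in> K" "\<And>m. 0 < m \<Longrightarrow> m < n \<Longrightarrow> g [^] m \<notin> K"
proof -
  have "\<not> inj (\<lambda>i::nat. g [^] i)"
    using fin g by (metis (no_types, lifting) finite_imageD finite_subset image_subsetI infinite_UNIV_nat nat_pow_closed)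
  then obtain i j :: nat where ij: "i < j" "g [^] i = g [^] j"
    unfolding inj_def by (metis linorder_neqE_nat)
  define d where "d = j - i"
  have "d + i = j" using ij by (simp add: d_def)
  then have "g [^] d \<otimes> g [^] i = \<one> \<otimes> g [^] i"
    using ij(2) g by (metis l_one nat_pow_closed nat_pow_mult)
  then have "g [^] d = \<one>" using g by (metis right_cancel nat_pow_closed one_closed)
  then have "d > 0 \<and> g [^] d \<in> K" using ij assms(2) by (simp add: d_def subgroup.one_closed)
  then show ?thesis
    using that exists_least_iff[of "\<lambda>d. 0 < d \<and> g [^] d \<in> K"] by metis
qed

text \<open>Adjoin one element at a time, so that fewer elements lie outside \<open>K\<close>; the
  root needed for each extension exists in the complex numbers.\<close>

lemma partial_character_extends:
  assumes fin: "finite (carrier G)" and K: "partial_character K \<chi>"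
  shows "\<exists>\<theta>\<in>group_characters G. \<forall>x\<in>K. \<theta> x = \<chi> x"
  using K
proof (induction "card (carrier G - K)" arbitrary: K \<chi> rule: less_induct)
  case less
  then have sK: "subgroup K G" by (simp add: partial_character_def)
  show ?case
  proof (cases "K = carrier G")
    case True
    then have "restrict \<chi> (carrier G) \<in> group_characters G"
      using less.prems by (simp add: partial_character_def group_characters_def)
    with True show ?thesis by (intro bexI) auto
  next
    case False
    then obtain g where g: "g \<in> carrier G" "g \<notin> K" using subgroup.subset[OF sK] by auto
    obtain n :: nat where n: "n > 0" "g [^] n \<in> K" "\<And>m. 0 < m \<Longrightarrow> m < n \<Longrightarrow> g [^] m \<notin> K"
      using least_power_in_subgroup[OF fin sK g(1)] by metis
    obtain z where z: "z ^ n = \<chi> (g [^] n)" using complex_nth_root_ex[OF n(1)] by metis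
    obtain L \<chi>' where L: "partial_character L \<chi>'" "K \<subseteq> L" "g \<in> L" "\<And>x. x \<in> K \<Longrightarrow> \<chi>' x = \<chi> x"
      using extend_partial_character[OF fin less.prems g(1) n z] by metis
    have "card (carrier G - L) < card (carrier G - K)"
      using L(2,3) g fin by (intro psubset_card_mono) auto
    from less.hyps[OF this L(1)] obtain \<theta> where "\<theta> \<in> group_characters G" "\<forall>x\<in>L. \<theta> x = \<chi>' x"
      by auto
    then show ?thesis using L(2,4) by (metis subsetD)
  qed
qed

text \<open>Start from the trivial subgroup, so that \<open>n\<close> is the order of
  \<open>g\<close>, and choose a root of unity other than 1 as the value at \<open>g\<close>; this
  is possible because \<open>n\<close> is at least 2.\<close>

lemma group_characters_separate:
  assumes fin: "finite (carrier G)" and g: "g \<in> carrier G" "g \<noteq> \<one>"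
  shows "\<exists>\<theta>\<in>group_characters G. \<theta> g \<noteq> 1"
proof -
  have K: "partial_character {\<one>} (\<lambda>_. 1)"
    by (simp add: partial_character_def triv_subgroup)
  obtain n :: nat where n: "n > 0" "g [^] n \<in> {\<one>}" "\<And>m. 0 < m \<Longrightarrow> m < n \<Longrightarrow> g [^] m \<notin> {\<one>}"
    using least_power_in_subgroup[OF fin triv_subgroup g(1)] by metis
  have "n \<noteq> 1" using n(2) g by auto
  then have n2: "n \<ge> 2" using n(1) by auto
  have z: "cis (2 * pi / n) ^ n = 1" using n(1) by (simp add: DeMoivre)
  have "cis (2 * pi / n) \<noteq> 1"
  proof
    assume "cis (2 * pi / n) = 1"
    then have "cos (2 * pi / n) = 1" by (metis cis.sel(1) one_complex.sel(1))
    moreover have "0 < 2 * pi / n" "2 * pi / n \<le> pi" using n2 by (auto simp: field_simps)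
    ultimately show False using cos_monotone_0_pi[of 0 "2 * pi / n"] by simp
  qed
  moreover obtain L \<chi>' where "partial_character L \<chi>'" "g \<in> L" "\<chi>' g = cis (2 * pi / n)"
    using extend_partial_character[OF fin K g(1) n z] by metis
  ultimately show ?thesis using partial_character_extends[OF fin] by metis
qed

lemma group_characters_one:
  "\<theta> \<in> group_characters G \<Longrightarrow> \<theta> \<one> = 1"
  unfolding group_characters_def
  by (metis (mono_tags, lifting) mem_Collect_eq mult_cancel_left1 l_one one_closed)

text \<open>Elements of finite order take roots of unity as values, so the characters lie in a
  finite product of finite sets.\<close>

lemma finite_group_characters:
  assumes fin: "finite (carrier G)"
  shows "finite (group_characters G)"
proof -
  have "\<exists>n::nat. n > 0 \<and> x [^] n = \<one>" if "x \<in> carrier G" for x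
    using least_power_in_subgroup[OF fin triv_subgroup that] by (metis singletonD)
  then obtain n :: "'a \<Rightarrow> nat" where n: "\<And>x. x \<in> carrier G \<Longrightarrow> n x > 0 \<and> x [^] n x = \<one>"
    by metis
  have "\<theta> x ^ n x = 1" if "\<theta> \<in> group_characters G" "x \<in> carrier G" for \<theta> x
  proof -
    have "\<theta> (x [^] i) = \<theta> x ^ i" for i :: nat
      using that group_characters_one[OF that(1)]
      by (induction i) (auto simp: group_characters_def)
    then show ?thesis using n[OF that(2)] group_characters_one[OF that(1)] by metis
  qed
  then have "group_characters G \<subseteq> PiE (carrier G) (\<lambda>x. {z. z ^ n x = 1})"
    by (auto simp: group_characters_def PiE_def)
  moreover have "finite (PiE (carrier G) (\<lambda>x. {z::complex. z ^ n x = 1}))"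
    using n by (intro finite_PiE fin finite_roots_unity) (simp add: Suc_leI)
  ultimately show ?thesis by (rule finite_subset)
qed

text \<open>Multiplication by a character that is not 1 at \<open>g\<close> permutes all characters
  and multiplies the sum by a factor other than 1.\<close>

lemma sum_group_characters:
  assumes fin: "finite (carrier G)" and g: "g \<in> carrier G"
  shows "(\<Sum>\<theta>\<in>group_characters G. \<theta> g) =
    (if g = \<one> then of_nat (card (group_characters G)) else 0)"
proof (cases "g = \<one>")
  case True
  then show ?thesis by (simp add: group_characters_one)
next
  case False
  then obtain \<theta> where \<theta>: "\<theta> \<in> group_characters G" "\<theta> g \<noteq> 1"
    using group_characters_separate[OF fin g] by auto
  let ?f = "\<lambda>\<theta>'. \<lambda>x\<in>carrier G. \<theta> x * \<theta>' x"
  have "inj_on ?f (group_characters G)"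
  proof (rule inj_onI)
    fix a b assume ab: "a \<in> group_characters G" "b \<in> group_characters G" "?f a = ?f b"
    show "a = b"
    proof (rule extensionalityI)
      fix x assume x: "x \<in> carrier G"
      then show "a x = b x"
        using fun_cong[OF ab(3), of x] \<theta>(1) by (simp add: group_characters_def)
    qed (use ab in \<open>auto simp: group_characters_def\<close>)
  qed
  then have "(\<Sum>\<theta>\<in>group_characters G. \<theta> g) = 0"
    using \<theta> g by (intro sum_eq_0_by_shift[where f = ?f and c = "\<theta> g"] finite_group_characters fin)
      (auto simp: group_characters_def)
  then show ?thesis using False by simp
qed

text \<open>Fourier inversion on \<open>G\<close>: exchanging the sums leaves the sum of all
  characters at \<open>inv x \<otimes> g\<close>, which is zero unless \<open>x = g\<close>.\<close>

lemma character_expansion: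
  fixes \<kappa> :: "'a \<Rightarrow> complex"
  assumes fin: "finite (carrier G)" and g: "g \<in> carrier G"
  shows "(\<Sum>\<theta>\<in>group_characters G. (\<Sum>x\<in>carrier G. \<kappa> x * inverse (\<theta> x)) * \<theta> g) =
    of_nat (card (group_characters G)) * \<kappa> g"
proof -
  have q: "inverse (\<theta> x) * \<theta> g = \<theta> (inv x \<otimes> g)"
    if "\<theta> \<in> group_characters G" "x \<in> carrier G" for \<theta> x
  proof -
    have "\<theta> (inv x) * \<theta> x = 1"
      using that group_characters_one[OF that(1)]
      by (metis (mono_tags, lifting) group_characters_def inv_closed l_inv mem_Collect_eq)
    then have "inverse (\<theta> x) = \<theta> (inv x)" by (metis inverse_unique mult.commute)
    then show ?thesis using that g by (simp add: group_characters_def)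
  qed
  have "(\<Sum>\<theta>\<in>group_characters G. (\<Sum>x\<in>carrier G. \<kappa> x * inverse (\<theta> x)) * \<theta> g) =
    (\<Sum>\<theta>\<in>group_characters G. \<Sum>x\<in>carrier G. \<kappa> x * \<theta> (inv x \<otimes> g))"
    by (auto simp: sum_distrib_right q mult.assoc intro!: sum.cong)
  also have "\<dots> = (\<Sum>x\<in>carrier G. \<kappa> x * (\<Sum>\<theta>\<in>group_characters G. \<theta> (inv x \<otimes> g)))"
    by (subst sum.swap) (simp add: sum_distrib_left)
  also have "\<dots> = (\<Sum>x\<in>carrier G. if x = g then of_nat (card (group_characters G)) * \<kappa> x else 0)"
  proof (intro sum.cong refl)
    fix x assume x: "x \<in> carrier G"
    have "inv x \<otimes> g = \<one> \<longleftrightarrow> x = g"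
      using x g by (metis inv_equality inv_inv l_inv m_comm inv_closed)
    then show "\<kappa> x * (\<Sum>\<theta>\<in>group_characters G. \<theta> (inv x \<otimes> g)) =
        (if x = g then of_nat (card (group_characters G)) * \<kappa> x else 0)"
      using x g by (simp add: sum_group_characters[OF fin])
  qed
  finally show ?thesis using g fin by simp
qed

end

section \<open>Group algebra elements over a finite group\<close>

lemma poly_mapping_finite_sum:
  fixes z :: "('h::finite, 'k::comm_monoid_add) poly_mapping"
  shows "(\<Sum>h\<in>UNIV. Poly_Mapping.single h (Poly_Mapping.lookup z h)) = z"
  by (rule poly_mapping_eqI) (simp add: lookup_sum lookup_single when_def)

text \<open>Reduces identities that are additive in an element of \<open>kH\<close> to multiples of
  single group elements.\<close>

lemma poly_mapping_finite_induct [case_names single add]: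
  fixes z :: "('h::finite, 'k::comm_monoid_add) poly_mapping"
  assumes "\<And>h c. P (Poly_Mapping.single h c)" "\<And>x y. P x \<Longrightarrow> P y \<Longrightarrow> P (x + y)"
  shows "P z"
proof -
  have "P (\<Sum>h\<in>F. Poly_Mapping.single h (Poly_Mapping.lookup z h))" if "finite F" for F
    using that
  proof (induction F)
    case empty
    show ?case using assms(1)[of _ 0] by simp
  qed (use assms in simp)
  from this[OF finite_class.finite_UNIV] show ?thesis by (simp add: poly_mapping_finite_sum)
qed

lemma finite_poly_mapping: "finite (UNIV :: ('h::finite, 'k::{finite,zero}) poly_mapping set)"
proof (rule finite_imageD)
  show "finite (range (Poly_Mapping.lookup :: ('h, 'k) poly_mapping \<Rightarrow> _))"
    by (rule finite)
  show "inj (Poly_Mapping.lookup :: ('h, 'k) poly_mapping \<Rightarrow> _)"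
    by (rule injI) (simp add: poly_mapping_eqI)
qed

subsection \<open>The ring structure of \<open>A\<close>\<close>

context triangular_type
begin

lemma finite_J: "finite (UNIV :: 'j set)"
proof -
  obtain B where B: "finite_dimensional_vector_space scale B" using finite_dim by auto
  interpret fd: finite_dimensional_vector_space scale B by (rule B)
  have "x \<in> (\<lambda>u. \<Sum>v\<in>B. scale (u v) v) ` (PiE B (\<lambda>_. UNIV))" for x
  proof -
    have "x \<in> span B" by (simp add: fd.span_Basis)
    then obtain u where "x = (\<Sum>v\<in>B. scale (u v) v)"
      unfolding span_finite[OF fd.finite_Basis] by auto
    then have "x = (\<Sum>v\<in>B. scale (restrict u B v) v)" by simp
    then show ?thesis by (intro image_eqI[where x = "restrict u B"]) auto
  qed
  then have "(UNIV :: 'j set) \<subseteq> (\<lambda>u. \<Sum>v\<in>B. scale (u v) v) ` (PiE B (\<lambda>_. UNIV))" by auto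
  then show ?thesis
    by (rule finite_subset) (intro finite_imageI finite_PiE fd.finite_Basis finite)
qed

lemma finite_alg: "finite (M :: ('h, 'k, 'j) alg set)"
proof (rule finite_subset)
  show "finite (UNIV \<times> UNIV :: ('h, 'k, 'j) alg set)"
    using finite_poly_mapping finite_J by (rule finite_cartesian_product)
qed simp

text \<open>With \<open>actr\<close>, the linear extension of the actions of \<open>H\<close>,
  making \<open>J\<close> a \<open>kH\<close>-bimodule; the lemmas up to \<open>act_times\<close>
  collect the identities behind associativity of \<open>A\<close>.\<close>

definition actl :: "('h, 'k) poly_mapping \<Rightarrow> 'j \<Rightarrow> 'j" where
  "actl z x = (\<Sum>h\<in>UNIV. scale (Poly_Mapping.lookup z h) (lact h x))"

definition actr :: "'j \<Rightarrow> ('h, 'k) poly_mapping \<Rightarrow> 'j" where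
  "actr x z = (\<Sum>h\<in>UNIV. scale (Poly_Mapping.lookup z h) (ract x h))"

lemma mulA_eq: "a \<cdot> b = (fst a * fst b, actl (fst a) (snd b) + actr (snd a) (fst b) + snd a * snd b)"
  by (simp add: mulA_def actl_def actr_def)

lemma lact_zero: "lact h 0 = 0"
  using lact_add[of h 0 0] by simp

lemma ract_zero: "ract 0 h = 0"
  using ract_add[of 0 0 h] by simp

lemma act_add:
  "actl (z + w) x = actl z x + actl w x" "actl z (x + y) = actl z x + actl z y"
  "actr x (z + w) = actr x z + actr x w" "actr (x + y) z = actr x z + actr y z"
  by (simp_all add: actl_def actr_def lookup_add lact_add ract_add scale_left_distrib
      scale_right_distrib sum.distrib)

lemma act_zero: "actl z 0 = 0" "actr 0 z = 0" "actl 0 x = 0" "actr x 0 = 0"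
  by (simp_all add: actl_def actr_def lact_zero ract_zero)

lemma act_single:
  "actl (Poly_Mapping.single h c) x = scale c (lact h x)"
  "actr x (Poly_Mapping.single h c) = scale c (ract x h)"
proof -
  have *: "scale (Poly_Mapping.lookup (Poly_Mapping.single h c) h') y = (if h = h' then scale c y else 0)"
    for h' y by (simp add: lookup_single when_def)
  show "actl (Poly_Mapping.single h c) x = scale c (lact h x)"
    "actr x (Poly_Mapping.single h c) = scale c (ract x h)"
    by (simp_all add: actl_def actr_def *)
qed

lemma act_one: "actl 1 x = x" "actr x 1 = x"
  using act_single[where h = 0 and c = 1] by (simp_all add: lact_one ract_one)

lemma act_scale: "actl z (scale c x) = scale c (actl z x)" "actr (scale c x) z = scale c (actr x z)"
  by (simp_all add: actl_def actr_def lact_scale ract_scale scale_sum_right mult.commute)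

lemma act_mult:
  "actl (z * w) x = actl z (actl w x)" "actr x (z * w) = actr (actr x z) w"
proof -
  have "actl (z * w) x = actl z (actl w x) \<and> actr x (z * w) = actr (actr x z) w"
  proof (induction z rule: poly_mapping_finite_induct)
    case (single h c)
    show ?case
      by (induction w rule: poly_mapping_finite_induct)
        (simp_all add: mult_single act_single act_scale lact_mult[symmetric] ract_mult[symmetric]
          add.commute lact_scale ract_scale
          lact_add ract_add act_add scale_right_distrib distrib_left distrib_right mult.commute)
  qed (simp add: act_add distrib_right)
  then show "actl (z * w) x = actl z (actl w x)" "actr x (z * w) = actr (actr x z) w" by auto
qed

lemma act_act: "actr (actl z x) w = actl z (actr x w)"
proof -
  have "actr (lact h x) w = lact h (actr x w)" for h
    by (induction w rule: poly_mapping_finite_induct)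
      (simp_all add: act_single act_commute lact_scale lact_add act_add)
  then show ?thesis
    by (induction z rule: poly_mapping_finite_induct) (simp_all add: act_single act_scale act_add)
qed

lemma act_times:
  "actl z (x * y) = actl z x * y" "actr (x * y) z = x * actr y z" "x * actl z y = actr x z * y"
proof -
  have "actl z (x * y) = actl z x * y \<and> actr (x * y) z = x * actr y z \<and> x * actl z y = actr x z * y"
    by (induction z rule: poly_mapping_finite_induct)
      (simp_all add: act_single act_add distrib_left distrib_right mult_scale_left mult_scale_right
        lact_assoc ract_assoc act_balanced)
  then show "actl z (x * y) = actl z x * y" "actr (x * y) z = x * actr y z"
    "x * actl z y = actr x z * y" by auto
qed

lemma mulA_assoc: "a \<cdot> b \<cdot> c = a \<cdot> (b \<cdot> c)"
  by (simp add: mulA_eq act_add act_mult act_act act_times algebra_simps)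

lemma mulA_distrib: "a \<cdot> (b + c) = a \<cdot> b + a \<cdot> c" "(a + b) \<cdot> c = a \<cdot> c + b \<cdot> c"
  by (simp_all add: mulA_eq act_add algebra_simps)

lemma mulA_zero [simp]: "0 \<cdot> a = 0" "a \<cdot> 0 = 0"
  using mulA_distrib(2)[of 0 0 a] mulA_distrib(1)[of a 0 0] by simp_all

lemma mulA_minus: "(- a) \<cdot> b = - (a \<cdot> b)" "a \<cdot> (- b) = - (a \<cdot> b)"
  using mulA_distrib(2)[of a "- a" b] mulA_distrib(1)[of a b "- b"]
  by (simp_all add: eq_neg_iff_add_eq_0 add.commute)

lemma mulA_diff: "a \<cdot> (b - c) = a \<cdot> b - a \<cdot> c" "(a - b) \<cdot> c = a \<cdot> c - b \<cdot> c"
  using mulA_distrib(1)[of a b "- c"] mulA_distrib(2)[of a "- b" c]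
  by (simp_all add: mulA_minus)

lemma mulA_one [simp]: "oneA \<cdot> a = a" "a \<cdot> oneA = a"
  by (simp_all add: mulA_eq oneA_def act_one act_zero)

lemmas mulA_ring = mulA_assoc mulA_distrib mulA_diff mulA_minus

definition inK :: "('h, 'k) poly_mapping \<Rightarrow> ('h, 'k, 'j) alg" where
  "inK z = (z, 0)"

lemma inH_eq: "inH h = inK (Poly_Mapping.single h 1)"
  by (simp add: inH_def inK_def)

lemma oneA_eq: "oneA = inK 1" "oneA = inH 0"
  by (simp_all add: oneA_def inH_eq inK_def)

lemma in_mult:
  "inK z \<cdot> inK w = inK (z * w)" "inJ x \<cdot> inJ y = inJ (x * y)"
  "inK z \<cdot> inJ x = inJ (actl z x)" "inJ x \<cdot> inK z = inJ (actr x z)"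
  "inH h \<cdot> inH h' = inH (h + h')"
  by (simp_all add: inH_eq inK_def inJ_def mulA_eq act_zero mult_single)

lemma inH_inJ: "inH h \<cdot> inJ x = inJ (lact h x)" "inJ x \<cdot> inH h = inJ (ract x h)"
  by (simp_all add: inH_eq in_mult act_single)

lemma in_add:
  "inK z + inK w = inK (z + w)" "inJ x + inJ y = inJ (x + y)"
  "inK z - inK w = inK (z - w)" "inJ x - inJ y = inJ (x - y)"
  "- inJ x = inJ (- x)" "- inK z = inK (- z)"
  by (simp_all add: inK_def inJ_def uminus_prod_def)

lemma in_inject [simp]: "inJ x = inJ y \<longleftrightarrow> x = y" "inK z = inK w \<longleftrightarrow> z = w"
  by (simp_all add: inJ_def inK_def)

lemma inJ_0 [simp]: "inJ 0 = 0"
  by (simp add: inJ_def zero_prod_def)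

lemma inH_inject [simp]: "inH h = inH h' \<longleftrightarrow> h = h'"
  by (metis inH_eq in_inject(2) lookup_single_eq lookup_single_not_eq zero_neq_one)

lemma inK_commute: "inK z \<cdot> inK w = inK w \<cdot> inK z"
  by (simp add: in_mult mult.commute)

lemma inJ_snd: "fst a = 0 \<Longrightarrow> inJ (snd a) = a"
  by (simp add: inJ_def prod_eq_iff)

lemma in_fst_snd [simp]:
  "fst (inJ x) = 0" "snd (inJ x) = x" "fst (inK z) = z" "snd (inK z) = 0"
  by (simp_all add: inJ_def inK_def)

lemma fst_mulA: "fst (a \<cdot> b) = fst a * fst b"
  by (simp add: mulA_eq)

lemma range_inJ: "a \<in> range inJ \<longleftrightarrow> fst a = 0"
  by (metis in_fst_snd(1) inJ_snd imageE rangeI)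

lemma range_inK: "a \<in> range inK \<longleftrightarrow> snd a = 0"
  by (auto simp: inK_def prod_eq_iff intro!: image_eqI[of _ _ "fst a"])

text \<open>Scalars become left factors from \<open>kH\<close>, so the ring laws of \<open>A\<close>
  also handle scalar multiplication.\<close>

lemma scaleA_eq: "scaleA c a = inK (Poly_Mapping.single 0 c) \<cdot> a"
  by (simp add: scaleA_def inK_def mulA_eq mult_map_scale_conv_mult act_single act_zero lact_one)

lemma module_scaleA: "module scaleA"
proof
  fix c d :: 'k and a b :: "('h, 'k, 'j) alg"
  show "scaleA (c + d) a = scaleA c a + scaleA d a"
    by (simp add: scaleA_eq single_add in_add(1)[symmetric] mulA_ring)
  show "scaleA c (scaleA d a) = scaleA (c * d) a"
    by (simp add: scaleA_eq mulA_assoc[symmetric] in_mult mult_single)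
qed (simp_all add: scaleA_eq mulA_ring oneA_eq[symmetric])

interpretation A: module scaleA
  by (rule module_scaleA)

lemma span_H: "A.span (range inH) = range inK"
proof
  have "a \<in> range inK" if "a \<in> A.span (range inH)" for a
    using that
  proof (induction rule: A.span_induct)
    case base
    show ?case
      by (rule A.subspaceI) (auto simp: range_inK scaleA_def)
  qed (auto simp: inH_eq)
  then show "A.span (range inH) \<subseteq> range inK" by auto
  have "inK (Poly_Mapping.single h c) \<in> A.span (range inH)" for h c
  proof -
    have "scaleA c (inH h) \<in> A.span (range inH)" by (intro A.span_scale A.span_base) auto
    then show ?thesis by (simp add: scaleA_eq inH_eq in_mult mult_single)
  qed
  then have "inK z \<in> A.span (range inH)" for z
    by (induction z rule: poly_mapping_finite_induct) (simp_all add: in_add(1)[symmetric] A.span_add)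
  then show "range inK \<subseteq> A.span (range inH)" by auto
qed

lemma idempotents_H: "idempotents (range inH) = {inK z | z. z * z = z}"
  by (auto simp: idempotents_def span_H in_mult)

lemma idempotents_subset: "idempotents (inH ` H') \<subseteq> idempotents (range inH)"
  using A.span_mono[of "inH ` H'" "range inH"] by (auto simp: idempotents_def)

text \<open>As \<open>kH\<close> is commutative, the generators of the corner are multiples of
  \<open>z\<close>, and being fixed by \<open>z\<close> is preserved by linear combinations. Thus
  idempotents of the corner lie below \<open>z\<close>.\<close>

lemma span_corner: "f \<in> A.span (corner (inK z) (range inH)) \<Longrightarrow> z * z = z \<Longrightarrow> \<exists>w. f = inK w \<and> z * w = w"
proof (induction rule: A.span_induct)
  case base
  show ?case
  proof (rule A.subspaceI)
    show "0 \<in> {f. z * z = z \<longrightarrow> (\<exists>w. f = inK w \<and> z * w = w)}"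
      by (auto intro!: exI[of _ 0] simp: inK_def zero_prod_def)
  next
    fix x y assume "x \<in> {f. z * z = z \<longrightarrow> (\<exists>w. f = inK w \<and> z * w = w)}"
      "y \<in> {f. z * z = z \<longrightarrow> (\<exists>w. f = inK w \<and> z * w = w)}"
    then show "x + y \<in> {f. z * z = z \<longrightarrow> (\<exists>w. f = inK w \<and> z * w = w)}"
      by (auto simp: in_add distrib_left)
  next
    fix c x assume "x \<in> {f. z * z = z \<longrightarrow> (\<exists>w. f = inK w \<and> z * w = w)}"
    then show "scaleA c x \<in> {f. z * z = z \<longrightarrow> (\<exists>w. f = inK w \<and> z * w = w)}"
      by (auto simp: scaleA_eq in_mult) (metis mult.left_commute)
  qed
next
  case (step x)
  then show ?case
    by (auto simp: corner_def inH_eq in_mult mult.assoc[symmetric])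
qed

text \<open>Invariance under \<open>H'\<close> passes to linear combinations; it is used for the
  idempotents of \<open>kH'\<close>.\<close>

lemma span_act:
  assumes "subgroup_data H' J'" "f \<in> A.span (inH ` H')"
  shows "\<forall>x\<in>inJ ` J'. f \<cdot> x \<in> inJ ` J' \<and> x \<cdot> f \<in> inJ ` J'"
  using assms(2)
proof (induction rule: A.span_induct)
  case base
  have sub: "subspace J'" using assms(1) by (simp add: subgroup_data_def)
  have J0: "0 \<in> inJ ` J'" using subspace_0[OF sub] by (metis inJ_0 imageI)
  have Jadd: "a + b \<in> inJ ` J'" if "a \<in> inJ ` J'" "b \<in> inJ ` J'" for a b
    using that subspace_add[OF sub] by (auto simp: in_add)
  have Jsc: "inK (Poly_Mapping.single 0 c) \<cdot> a \<in> inJ ` J'" if "a \<in> inJ ` J'" for a c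
    using that subspace_scale[OF sub] by (auto simp: in_mult act_single lact_one)
  have Jcomm: "a \<cdot> (inK (Poly_Mapping.single 0 c) \<cdot> b) = inK (Poly_Mapping.single 0 c) \<cdot> (a \<cdot> b)"
    if "a \<in> inJ ` J'" for a b c
    using that by (auto simp: mulA_assoc[symmetric] in_mult act_single lact_one ract_one)
  show ?case
    by (rule A.subspaceI) (use J0 Jadd Jsc Jcomm in \<open>auto simp: mulA_ring scaleA_eq\<close>)
next
  case (step x)
  then show ?case using assms(1)
    by (auto simp: subgroup_data_def inH_eq in_mult act_single)
qed

subsection \<open>The groups of triangular type\<close>

text \<open>The properties shared by \<open>(1, H, J)\<close>, \<open>(1, H', J')\<close> and the
  corners of \<open>(1, H, J)\<close>, so that one proof gives the group structure in all cases.
  Lying inside \<open>kH\<close> makes \<open>S\<close> commutative.\<close>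

definition tri_data ::
    "('h, 'k, 'j) alg \<Rightarrow> ('h, 'k, 'j) alg set \<Rightarrow> ('h, 'k, 'j) alg set \<Rightarrow> bool" where
  "tri_data e S I \<longleftrightarrow> e \<in> S \<and> S \<subseteq> range inK \<and> (\<forall>s\<in>S. \<forall>t\<in>S. s \<cdot> t \<in> S) \<and>
     (\<forall>s\<in>S. e \<cdot> s = s \<and> (\<exists>t\<in>S. t \<cdot> s = e)) \<and>
     0 \<in> I \<and> I \<subseteq> range inJ \<and> (\<forall>x\<in>I. \<forall>y\<in>I. x + y \<in> I \<and> x - y \<in> I \<and> x \<cdot> y \<in> I) \<and>
     (\<forall>s\<in>S. \<forall>x\<in>I. s \<cdot> x \<in> I \<and> x \<cdot> s \<in> I) \<and> (\<forall>x\<in>I. e \<cdot> x = x \<and> x \<cdot> e = x)"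

lemma tri_data_subgroup:
  assumes "subgroup_data H' J'"
  shows "tri_data oneA (inH ` H') (inJ ` J')"
proof -
  have J': "subspace J'" using assms by (simp add: subgroup_data_def)
  show ?thesis
    unfolding tri_data_def
  proof (intro conjI ballI)
    show "oneA \<in> inH ` H'"
      unfolding oneA_eq(2) using assms by (simp add: subgroup_data_def)
    show "inH ` H' \<subseteq> range inK"
      by (auto simp: inH_eq)
    show "0 \<in> inJ ` J'" using subspace_0[OF J'] by (metis inJ_0 imageI)
    fix s assume s: "s \<in> inH ` H'"
    then obtain h where "h \<in> H'" "s = inH h" by auto
    then show "\<exists>t\<in>inH ` H'. t \<cdot> s = oneA"
      using assms by (auto simp: subgroup_data_def in_mult oneA_eq(2) intro!: bexI[of _ "- h"])
  qed (use assms J' in \<open>auto simp: subgroup_data_def in_mult in_add inH_inJ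
      subspace_add subspace_diff oneA_eq(2)[symmetric]\<close>)
qed

lemma subgroup_data_UNIV: "subgroup_data UNIV UNIV"
  by (simp add: subgroup_data_def)

lemma tri_data_UNIV: "tri_data oneA (range inH) (range inJ)"
  by (rule tri_data_subgroup[OF subgroup_data_UNIV])

lemma corner_image: "corner f (g ` M) = (\<lambda>x. f \<cdot> g x \<cdot> f) ` M"
  unfolding corner_def by blast

text \<open>Commutativity of \<open>kH\<close> turns \<open>z h z\<close> into \<open>z h\<close>,
  and an element of \<open>J\<close> lies in the corner exactly if \<open>z\<close> fixes it on both
  sides.\<close>

lemma tri_data_corner:
  assumes z: "z * z = z"
  shows "tri_data (inK z) (corner (inK z) (range inH)) (corner (inK z) (range inJ))"
proof -
  have zwz: "z * w * z = z * w" for w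
  proof -
    have "z * w * z = (z * z) * w" by (simp only: mult_ac)
    then show ?thesis using z by simp
  qed
  have S: "corner (inK z) (range inH) = range (\<lambda>h. inK (z * Poly_Mapping.single h 1))"
    by (simp add: corner_image inH_eq in_mult zwz)
  have zz: "inK z \<cdot> (inK z \<cdot> a) = inK z \<cdot> a" for a
    by (simp add: mulA_assoc[symmetric] in_mult z)
  have I: "a \<in> corner (inK z) (range inJ) \<longleftrightarrow> a \<in> range inJ \<and> inK z \<cdot> a = a \<and> a \<cdot> inK z = a" for a
  proof
    assume "a \<in> corner (inK z) (range inJ)"
    then obtain x where "a = inK z \<cdot> inJ x \<cdot> inK z" by (auto simp: corner_def)
    then show "a \<in> range inJ \<and> inK z \<cdot> a = a \<and> a \<cdot> inK z = a"
      by (simp add: range_inJ fst_mulA mulA_assoc zz) (simp add: in_mult z)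
  next
    assume "a \<in> range inJ \<and> inK z \<cdot> a = a \<and> a \<cdot> inK z = a"
    then show "a \<in> corner (inK z) (range inJ)"
      unfolding corner_def by (intro CollectI exI[of _ a]) simp
  qed
  have zs: "(z * w) * (z * w') = z * (w * w')" for w w'
    using zwz[of w] by (simp only: mult.assoc[symmetric])
  show ?thesis
    unfolding tri_data_def I
  proof (intro conjI ballI)
    show "inK z \<in> corner (inK z) (range inH)"
      unfolding S by (auto intro!: image_eqI[of _ _ 0])
    show "corner (inK z) (range inJ) \<subseteq> range inJ" using I by auto
    fix s assume "s \<in> corner (inK z) (range inH)"
    then obtain h where h: "s = inK (z * Poly_Mapping.single h 1)" unfolding S by auto
    show "inK z \<cdot> s = s" by (simp add: h in_mult z mult.assoc[symmetric])
    show "\<exists>t\<in>corner (inK z) (range inH). t \<cdot> s = inK z"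
      unfolding S h by (auto simp: in_mult zs mult_single intro!: exI[of _ "- h"])
    have sz: "s = inK z \<cdot> inK (Poly_Mapping.single h 1)" "s = inK (Poly_Mapping.single h 1) \<cdot> inK z"
      by (simp_all add: h in_mult mult.commute)
    fix x assume x: "x \<in> corner (inK z) (range inJ)"
    have sx: "s \<cdot> x \<cdot> inK z = s \<cdot> x" "inK z \<cdot> (x \<cdot> s) = x \<cdot> s"
      using x unfolding I by (simp_all add: mulA_assoc) (metis mulA_assoc)
    show "s \<cdot> x \<in> range inJ" "x \<cdot> s \<in> range inJ"
      using x unfolding I by (auto simp: range_inJ fst_mulA)
    show "inK z \<cdot> (s \<cdot> x) = s \<cdot> x" unfolding sz(1) by (simp add: mulA_assoc zz)
    show "s \<cdot> x \<cdot> inK z = s \<cdot> x" "inK z \<cdot> (x \<cdot> s) = x \<cdot> s" by (fact sx)+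
    show "x \<cdot> s \<cdot> inK z = x \<cdot> s" unfolding sz(2) by (simp add: mulA_assoc in_mult z mult.assoc)
  next
    fix s t assume "s \<in> corner (inK z) (range inH)" "t \<in> corner (inK z) (range inH)"
    then show "s \<cdot> t \<in> corner (inK z) (range inH)"
      unfolding S by (auto simp: in_mult zs mult_single)
  next
    fix x y assume xy: "x \<in> corner (inK z) (range inJ)" "y \<in> corner (inK z) (range inJ)"
    then show "x + y \<in> range inJ" "x - y \<in> range inJ" "x \<cdot> y \<in> range inJ"
      unfolding I by (auto simp: range_inJ fst_mulA)
    show "inK z \<cdot> (x + y) = x + y" "(x + y) \<cdot> inK z = x + y" "inK z \<cdot> (x - y) = x - y"
      "(x - y) \<cdot> inK z = x - y" "x \<cdot> y \<cdot> inK z = x \<cdot> y" "inK z \<cdot> (x \<cdot> y) = x \<cdot> y"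
      using xy unfolding I by (simp_all add: mulA_ring) (simp add: mulA_assoc[symmetric])
  qed (auto simp: I S range_inJ)
qed

lemma unipI: "x \<in> I \<Longrightarrow> e + x \<in> unip e I"
  unfolding unip_def by blast

lemma unipE:
  assumes "a \<in> unip e I" obtains x where "x \<in> I" "a = e + x"
  using assms unfolding unip_def by blast

text \<open>Iterating the equation writes \<open>y\<close> as a product with arbitrarily many
  factors.\<close>

lemma nilpotent_eq_0: "y * x = y \<Longrightarrow> y = (0 :: 'j)"
proof -
  assume yx: "y * x = y"
  have "foldl (*) y (replicate k x) = y" for k
    by (induction k) (simp_all add: yx)
  then show ?thesis using nilpotent by (metis length_replicate)
qed

text \<open>The inverse has to solve \<open>y + y \<cdot> x = - x\<close>. The left side is
  injective in \<open>y\<close> by nilpotency and maps the finite set \<open>I\<close> to itself, so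
  it is onto.\<close>

lemma left_inverse_unip:
  assumes "tri_data e S I" "x \<in> I"
  obtains y where "y \<in> I" "(e + y) \<cdot> (e + x) = e"
proof -
  have D: "x + y \<in> I" "x - y \<in> I" "x \<cdot> y \<in> I" if "x \<in> I" "y \<in> I" for x y
    using assms(1) that by (auto simp: tri_data_def)
  have e: "e \<cdot> y = y" "y \<cdot> e = y" if "y \<in> I" for y
    using assms(1) that by (auto simp: tri_data_def)
  have IJ: "I \<subseteq> range inJ" "0 \<in> I" using assms(1) by (auto simp: tri_data_def)
  have "inj_on (\<lambda>y. y + y \<cdot> x) I"
  proof (rule inj_onI)
    fix a b assume ab: "a \<in> I" "b \<in> I" "a + a \<cdot> x = b + b \<cdot> x"
    obtain d v where d: "a - b = inJ d" "x = inJ v"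
      using D(2)[OF ab(1,2)] IJ assms(2) by (metis imageE subsetD)
    have "(a - b) + (a - b) \<cdot> x = (a + a \<cdot> x) - (b + b \<cdot> x)" by (simp add: mulA_ring)
    then have "(a - b) + (a - b) \<cdot> x = 0" unfolding ab(3) by simp
    then have "inJ (d + d * v) = inJ 0" unfolding d by (simp add: in_mult in_add)
    then have "d + d * v = 0" by (simp only: in_inject)
    then have "d = - (d * v)" by (simp only: eq_neg_iff_add_eq_0)
    then have "d * (- v) = d" by simp
    then have "d = 0" by (rule nilpotent_eq_0)
    then show "a = b" using d by simp
  qed
  then have "(\<lambda>y. y + y \<cdot> x) ` I = I"
    by (intro card_subset_eq finite_alg) (auto simp: card_image D assms(2))
  moreover have "0 - x \<in> I" using D IJ assms(2) by blast
  ultimately have "0 - x \<in> (\<lambda>y. y + y \<cdot> x) ` I" by simp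
  then obtain y where y: "y \<in> I" "0 - x = y + y \<cdot> x" by (rule imageE)
  have "e \<cdot> e = e" using assms(1) by (auto simp: tri_data_def)
  then have "(e + y) \<cdot> (e + x) = e + (y + y \<cdot> x + x)"
    using e y(1) assms(2) by (simp add: mulA_ring algebra_simps)
  also have "\<dots> = e" unfolding y(2)[symmetric] by simp
  finally show ?thesis using that y(1) by blast
qed

lemma tri_dataD:
  assumes "tri_data e S I"
  shows "e \<in> S" "e \<cdot> e = e" "0 \<in> I" "s \<in> S \<Longrightarrow> e \<cdot> s = s" "s \<in> S \<Longrightarrow> s \<cdot> e = s"
    "s \<in> S \<Longrightarrow> t \<in> S \<Longrightarrow> s \<cdot> t \<in> S" "s \<in> S \<Longrightarrow> t \<in> S \<Longrightarrow> s \<cdot> t = t \<cdot> s"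
    "x \<in> I \<Longrightarrow> y \<in> I \<Longrightarrow> x + y \<in> I" "x \<in> I \<Longrightarrow> y \<in> I \<Longrightarrow> x \<cdot> y \<in> I"
    "s \<in> S \<Longrightarrow> x \<in> I \<Longrightarrow> s \<cdot> x \<in> I" "s \<in> S \<Longrightarrow> x \<in> I \<Longrightarrow> x \<cdot> s \<in> I"
    "x \<in> I \<Longrightarrow> e \<cdot> x = x" "x \<in> I \<Longrightarrow> x \<cdot> e = x"
proof -
  have "S \<subseteq> range inK" using assms by (simp add: tri_data_def)
  then show c: "s \<in> S \<Longrightarrow> t \<in> S \<Longrightarrow> s \<cdot> t = t \<cdot> s" for s t
    using inK_commute by blast
  show "s \<in> S \<Longrightarrow> s \<cdot> e = s" using assms c[of s e] by (simp add: tri_data_def)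
qed (use assms in \<open>auto simp: tri_data_def\<close>)

lemma carrier_tri_group: "carrier (tri_group e S I) = {h + x | h x. h \<in> S \<and> x \<in> I}"
  by (simp add: tri_group_def)

lemma tri_group_sel [simp]:
  "mult (tri_group e S I) = (\<cdot>)" "one (tri_group e S I) = e"
  by (simp_all add: tri_group_def)

lemma tri_groupI: "s \<in> S \<Longrightarrow> x \<in> I \<Longrightarrow> s + x \<in> carrier (tri_group e S I)"
  unfolding carrier_tri_group by blast

lemma tri_groupE:
  assumes "g \<in> carrier (tri_group e S I)" obtains s x where "g = s + x" "s \<in> S" "x \<in> I"
  using assms unfolding carrier_tri_group by blast

lemma tri_group_S: "0 \<in> I \<Longrightarrow> s \<in> S \<Longrightarrow> s \<in> carrier (tri_group e S I)"
  unfolding carrier_tri_group by (rule CollectI, rule exI[of _ s], rule exI[of _ 0]) simp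

lemma group_tri_group:
  assumes T: "tri_data e S I"
  shows "group (tri_group e S I)"
proof (rule groupI)
  note D = tri_dataD(1-6,8-13)[OF T]
  show "\<one>\<^bsub>tri_group e S I\<^esub> \<in> carrier (tri_group e S I)"
    using tri_group_S D(1,3) by simp
  fix g assume "g \<in> carrier (tri_group e S I)"
  then obtain h x where g: "g = h + x" "h \<in> S" "x \<in> I" by (rule tri_groupE)
  show "\<one>\<^bsub>tri_group e S I\<^esub> \<otimes>\<^bsub>tri_group e S I\<^esub> g = g"
    using D g by (simp add: mulA_ring)
  obtain s where s: "s \<in> S" "s \<cdot> h = e" using T g(2) by (auto simp: tri_data_def)
  \<comment> \<open>Factor \<open>h + x\<close> as \<open>(e + x \<cdot> s) \<cdot> h\<close> and
    invert the unipotent factor; the left inverse of \<open>h + x\<close> is then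
    \<open>s \<cdot> (e + y)\<close>.\<close>
  obtain y where y: "y \<in> I" "(e + y) \<cdot> (e + x \<cdot> s) = e"
    using left_inverse_unip[OF T] D g(3) s(1) by metis
  have "(s + s \<cdot> y) \<cdot> (h + x) = s \<cdot> (((e + y) \<cdot> (e + x \<cdot> s)) \<cdot> h)"
    using D s y(1) g by (simp add: mulA_ring)
  also have "\<dots> = e" using D s y(2) g by simp
  finally show "\<exists>y\<in>carrier (tri_group e S I). y \<otimes>\<^bsub>tri_group e S I\<^esub> g = \<one>\<^bsub>tri_group e S I\<^esub>"
    unfolding g(1) using tri_groupI[OF s(1) D(9)[OF s(1) y(1)]]
    by (intro bexI[of _ "s + s \<cdot> y"]) simp_all
  fix g' assume "g' \<in> carrier (tri_group e S I)"
  then obtain h' x' where g': "g' = h' + x'" "h' \<in> S" "x' \<in> I" by (rule tri_groupE)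
  have "g \<cdot> g' = h \<cdot> h' + (h \<cdot> x' + x \<cdot> h' + x \<cdot> x')"
    unfolding g g' by (simp add: mulA_ring)
  then show "g \<otimes>\<^bsub>tri_group e S I\<^esub> g' \<in> carrier (tri_group e S I)"
    using tri_groupI[of "h \<cdot> h'" S "h \<cdot> x' + x \<cdot> h' + x \<cdot> x'" I e] D g g' by simp
qed (simp add: mulA_assoc)

lemma tri_inv_S:
  assumes T: "tri_data e S I" and t: "t \<in> S"
  shows "inv\<^bsub>tri_group e S I\<^esub> t \<in> S" "inv\<^bsub>tri_group e S I\<^esub> t \<cdot> t = e" "t \<cdot> inv\<^bsub>tri_group e S I\<^esub> t = e"
proof -
  interpret G: group "tri_group e S I" by (rule group_tri_group[OF T])
  note D = tri_dataD(1-6,8-13)[OF T]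
  have SG: "s \<in> carrier (tri_group e S I)" if "s \<in> S" for s
    using that D(3) by (simp only: tri_group_S)
  obtain s where s: "s \<in> S" "s \<cdot> t = e" using T t by (auto simp: tri_data_def)
  have "inv\<^bsub>tri_group e S I\<^esub> t = s"
    by (rule G.inv_equality) (use s t SG in \<open>simp_all\<close>)
  then show "inv\<^bsub>tri_group e S I\<^esub> t \<in> S" "inv\<^bsub>tri_group e S I\<^esub> t \<cdot> t = e"
    "t \<cdot> inv\<^bsub>tri_group e S I\<^esub> t = e"
    using s tri_dataD(7)[OF T t s(1)] by simp_all
qed

lemma tri_inv_unip:
  assumes T: "tri_data e S I" and a: "a \<in> unip e I"
  shows "inv\<^bsub>tri_group e S I\<^esub> a \<in> unip e I" "inv\<^bsub>tri_group e S I\<^esub> a \<cdot> a = e"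
    "a \<cdot> inv\<^bsub>tri_group e S I\<^esub> a = e" "a \<in> carrier (tri_group e S I)"
proof -
  interpret G: group "tri_group e S I" by (rule group_tri_group[OF T])
  note D = tri_dataD(1-6,8-13)[OF T]
  have NG: "s \<in> carrier (tri_group e S I)" if "s \<in> unip e I" for s
    using that D(1) by (elim unipE) (simp only: tri_groupI)
  obtain x where x: "x \<in> I" "a = e + x" using a by (rule unipE)
  obtain y where y: "y \<in> I" "(e + y) \<cdot> a = e"
    using left_inverse_unip[OF T] x by metis
  have yN: "e + y \<in> unip e I" using y by (simp add: unipI)
  have "inv\<^bsub>tri_group e S I\<^esub> a = e + y"
    by (rule G.inv_equality) (use y NG[OF yN] NG[OF a] in \<open>simp_all\<close>)
  then show "inv\<^bsub>tri_group e S I\<^esub> a \<in> unip e I" "inv\<^bsub>tri_group e S I\<^esub> a \<cdot> a = e"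
    using y yN by simp_all
  show "a \<cdot> inv\<^bsub>tri_group e S I\<^esub> a = e" using G.r_inv[OF NG[OF a]] by simp
  show "a \<in> carrier (tri_group e S I)" using a by (rule NG)
qed

lemma unip_mult:
  assumes T: "tri_data e S I" and "a \<in> unip e I" "b \<in> unip e I"
  shows "a \<cdot> b \<in> unip e I"
proof -
  note D = tri_dataD(1-6,8-13)[OF T]
  obtain x y where xy: "x \<in> I" "a = e + x" "y \<in> I" "b = e + y"
    using assms by (metis unipE)
  then have "a \<cdot> b = e + (x + (y + x \<cdot> y))" using D by (simp add: mulA_ring algebra_simps)
  then show ?thesis using D xy by (simp add: unipI)
qed

lemma unip_conj:
  assumes T: "tri_data e S I" and "a \<in> unip e I" "s \<in> S" "t \<in> S" "s \<cdot> t = e"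
  shows "s \<cdot> a \<cdot> t \<in> unip e I"
proof -
  note D = tri_dataD(1-6,8-13)[OF T]
  obtain x where "x \<in> I" "a = e + x"
    using assms(2) by (rule unipE)
  then have "s \<cdot> a \<cdot> t = e + s \<cdot> x \<cdot> t" "s \<cdot> x \<cdot> t \<in> I"
    using D assms(3-5) by (simp_all add: mulA_ring)
  then show ?thesis by (simp add: unipI)
qed

lemma group_triples:
  assumes T: "tri_data e S I"
  shows "group (triples e S I)"
proof -
  note D = tri_dataD(1-6,8-13)[OF T]
  note i = tri_inv_S[OF T]
  let ?i = "\<lambda>t. inv\<^bsub>tri_group e S I\<^esub> t"
  have eN: "e \<in> unip e I" using unipI[OF D(3), of e] by simp
  have ie: "?i e = e" using i(2,1)[OF D(1)] D(4,5) by metis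
  have eu: "e \<cdot> a = a" "a \<cdot> e = a" if "a \<in> unip e I" for a
    using that by (elim unipE; simp add: mulA_ring D(2,11,12))+
  have ii: "?i (s \<cdot> t) = ?i t \<cdot> ?i s" if "s \<in> S" "t \<in> S" for s t
  proof -
    interpret G: group "tri_group e S I" by (rule group_tri_group[OF T])
    have SG: "s \<in> carrier (tri_group e S I)" if "s \<in> S" for s
      using that D(3) by (simp only: tri_group_S)
    show ?thesis using G.inv_mult_group[OF SG SG] that by simp
  qed
  have ti: "t \<cdot> (?i t \<cdot> a) = a" if "t \<in> S" "a \<in> unip e I" for t a
    using i(3)[OF that(1)] eu that by (simp add: mulA_assoc[symmetric])
  have c: "?i t \<cdot> a \<cdot> t \<cdot> b \<in> unip e I" if "t \<in> S" "a \<in> unip e I" "b \<in> unip e I" for t a b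
    using unip_mult[OF T unip_conj[OF T]] i that by metis
  show ?thesis
  proof (rule groupI)
    fix \<sigma> assume "\<sigma> \<in> carrier (triples e S I)"
    then obtain t a b where tab: "\<sigma> = (t, a, b)" "t \<in> S" "a \<in> unip e I" "b \<in> unip e I"
      by (auto simp: triples_def)
    show "\<one>\<^bsub>triples e S I\<^esub> \<otimes>\<^bsub>triples e S I\<^esub> \<sigma> = \<sigma>"
      using tab D i eu by (simp add: triples_def)
    \<comment> \<open>The twisted multiplication makes the inverse of \<open>(t, a, b)\<close> carry
      the inverses of \<open>a\<close> and \<open>b\<close> conjugated by \<open>t\<close>.\<close>
    let ?n = "\<lambda>a. t \<cdot> ?i a \<cdot> ?i t"
    have n: "?n a \<in> unip e I" "?i t \<cdot> ?n a \<cdot> t \<cdot> a = e" if a: "a \<in> unip e I" for a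
    proof -
      note ia = tri_inv_unip[OF T a]
      show "?n a \<in> unip e I"
        using unip_conj[OF T ia(1) tab(2) i(1)[OF tab(2)] i(3)[OF tab(2)]] .
      have "?i t \<cdot> ?n a \<cdot> t \<cdot> a = (?i t \<cdot> t) \<cdot> ?i a \<cdot> ((?i t \<cdot> t) \<cdot> a)"
        by (simp add: mulA_assoc)
      then show "?i t \<cdot> ?n a \<cdot> t \<cdot> a = e" using i(2)[OF tab(2)] ia eu a by simp
    qed
    show "\<exists>\<tau>\<in>carrier (triples e S I). \<tau> \<otimes>\<^bsub>triples e S I\<^esub> \<sigma> = \<one>\<^bsub>triples e S I\<^esub>"
      by (rule bexI[of _ "(?i t, ?n a, ?n b)"]) (use tab n i in \<open>simp_all add: triples_def\<close>)
    fix \<sigma>' assume "\<sigma>' \<in> carrier (triples e S I)"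
    then obtain t' a' b' where tab': "\<sigma>' = (t', a', b')" "t' \<in> S" "a' \<in> unip e I" "b' \<in> unip e I"
      by (auto simp: triples_def)
    show "\<sigma> \<otimes>\<^bsub>triples e S I\<^esub> \<sigma>' \<in> carrier (triples e S I)"
      using tab tab' D(6) c by (simp add: triples_def)
    fix \<sigma>'' assume "\<sigma>'' \<in> carrier (triples e S I)"
    then obtain t'' a'' b'' where tab'': "\<sigma>'' = (t'', a'', b'')" "t'' \<in> S" "a'' \<in> unip e I" "b'' \<in> unip e I"
      by (auto simp: triples_def)
    have "?i t'' \<cdot> (?i t' \<cdot> (a \<cdot> (t' \<cdot> (a' \<cdot> (t'' \<cdot> a''))))) =
       ?i t'' \<cdot> (?i t' \<cdot> (a \<cdot> (t' \<cdot> (t'' \<cdot> (?i t'' \<cdot> (a' \<cdot> (t'' \<cdot> a'')))))))"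
      if "a' \<in> unip e I" "a'' \<in> unip e I" for a a' a''
    proof -
      have "t'' \<cdot> (?i t'' \<cdot> (a' \<cdot> (t'' \<cdot> a''))) = (t'' \<cdot> (?i t'' \<cdot> a')) \<cdot> (t'' \<cdot> a'')"
        by (simp add: mulA_assoc)
      then show ?thesis using ti[OF tab''(2) that(1)] by (simp add: mulA_assoc)
    qed
    then show "\<sigma> \<otimes>\<^bsub>triples e S I\<^esub> \<sigma>' \<otimes>\<^bsub>triples e S I\<^esub> \<sigma>'' =
        \<sigma> \<otimes>\<^bsub>triples e S I\<^esub> (\<sigma>' \<otimes>\<^bsub>triples e S I\<^esub> \<sigma>'')"
      using tab tab' tab'' ii by (simp add: triples_def mulA_assoc)
  qed (use eN D in \<open>simp add: triples_def\<close>)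
qed

end

subsection \<open>Fourier analysis on \<open>J\<close>\<close>

locale triangular_type_character = triangular_type scale lact ract
  for scale :: "'k::{field,finite} \<Rightarrow> 'j::ring \<Rightarrow> 'j"
    and lact :: "'h::{ab_group_add,finite} \<Rightarrow> 'j \<Rightarrow> 'j"
    and ract :: "'j \<Rightarrow> 'h \<Rightarrow> 'j" +
  fixes \<epsilon> :: "'k \<Rightarrow> complex"
  assumes eps: "nontrivial_additive_character \<epsilon>"
begin

lemma eps_nz [simp]: "\<epsilon> s \<noteq> 0" and eps_add: "\<epsilon> (s + t) = \<epsilon> s * \<epsilon> t"
  using eps by (simp_all add: nontrivial_additive_character_def)

lemma eps_0 [simp]: "\<epsilon> 0 = 1"
  using eps_add[of 0 0] by simp

lemma eps_minus: "\<epsilon> (- s) = inverse (\<epsilon> s)"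
  using eps_add[of s "- s"] by (simp add: inverse_unique)

text \<open>Total functions on the type of \<open>J\<close>, so that Fourier sums run over a whole
  type; \<open>form_ext\<close> translates them into members of
  \<open>dual (range inJ)\<close>.\<close>

definition Dual :: "('j \<Rightarrow> 'k) set" where
  "Dual = {\<mu>. (\<forall>x y. \<mu> (x + y) = \<mu> x + \<mu> y) \<and> (\<forall>c x. \<mu> (scale c x) = c * \<mu> x)}"

lemma DualD:
  assumes "\<mu> \<in> Dual"
  shows "\<mu> (x + y) = \<mu> x + \<mu> y" "\<mu> (scale c x) = c * \<mu> x" "\<mu> 0 = 0" "\<mu> (- x) = - \<mu> x"
    "\<mu> (x - y) = \<mu> x - \<mu> y"
proof -
  have a: "additive \<mu>" using assms by unfold_locales (simp add: Dual_def)
  show "\<mu> (x + y) = \<mu> x + \<mu> y" "\<mu> (scale c x) = c * \<mu> x" using assms by (auto simp: Dual_def)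
  show "\<mu> 0 = 0" "\<mu> (- x) = - \<mu> x" "\<mu> (x - y) = \<mu> x - \<mu> y"
    using a by (auto simp: additive.zero additive.minus additive.diff)
qed

lemma Dual_diff: "\<mu> \<in> Dual \<Longrightarrow> \<nu> \<in> Dual \<Longrightarrow> (\<lambda>x. \<mu> x - \<nu> x) \<in> Dual"
  by (simp add: Dual_def algebra_simps)

lemma Dual_minus: "\<mu> \<in> Dual \<Longrightarrow> (\<lambda>x. - \<mu> x) \<in> Dual"
  by (simp add: Dual_def)

lemma finite_Dual: "finite Dual"
proof (rule finite_subset)
  show "finite (PiE (UNIV :: 'j set) (\<lambda>_. UNIV :: 'k set))"
    by (intro finite_PiE finite_J) simp
qed (simp add: PiE_def)

lemma card_J_nz: "of_nat (card (UNIV :: 'j set)) \<noteq> (0 :: complex)"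
  using finite_J by (simp add: card_eq_0_iff)

text \<open>A nonzero form can be scaled to take a value \<open>s\<close> with
  \<open>\<epsilon> s \<noteq> 1\<close>; translation by that vector multiplies the sum by
  \<open>\<epsilon> s\<close>.\<close>

lemma sum_eps:
  assumes "\<mu> \<in> Dual"
  shows "(\<Sum>x\<in>UNIV. \<epsilon> (\<mu> x)) = (if \<forall>x. \<mu> x = 0 then of_nat (card (UNIV :: 'j set)) else 0)"
proof (cases "\<forall>x. \<mu> x = 0")
  case False
  then obtain y where y: "\<mu> y \<noteq> 0" by auto
  obtain s where s: "\<epsilon> s \<noteq> 1" using eps by (auto simp: nontrivial_additive_character_def)
  define z where "z = scale (s / \<mu> y) y"
  have "\<mu> z = s" using y by (simp add: z_def DualD[OF assms])
  then have "(\<Sum>x\<in>UNIV. \<epsilon> (\<mu> x)) = 0"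
    using s by (intro sum_eq_0_by_shift[where f = "(+) z" and c = "\<epsilon> s"])
      (auto simp: finite_J DualD[OF assms] eps_add)
  with False show ?thesis by auto
qed simp

lemma Dual_nonzero:
  assumes "x \<noteq> 0"
  shows "\<exists>\<mu>\<in>Dual. \<mu> x = s"
proof -
  interpret vp: vector_space_pair scale "(*) :: 'k \<Rightarrow> 'k \<Rightarrow> 'k"
    by unfold_locales (auto simp: algebra_simps)
  have "\<not> dependent {x}" using assms by simp
  then obtain g where g: "Vector_Spaces.linear scale (*) g" "g x = s"
    using vp.linear_independent_extend[of "{x}" "\<lambda>_. s"] by auto
  interpret g: Vector_Spaces.linear scale "(*)" g by (rule g(1))
  have "g \<in> Dual" by (simp add: Dual_def g.add g.scale)
  with g(2) show ?thesis by blast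
qed

text \<open>The dual orthogonality: translate within \<open>Dual\<close> by a form whose value at
  \<open>x\<close> is some \<open>s\<close> with \<open>\<epsilon> s \<noteq> 1\<close>.\<close>

lemma sum_Dual_eps:
  "(\<Sum>\<mu>\<in>Dual. \<epsilon> (\<mu> x)) = (if x = 0 then of_nat (card Dual) else 0)"
proof (cases "x = 0")
  case True
  then show ?thesis by (simp add: DualD)
next
  case False
  obtain s where s: "\<epsilon> s \<noteq> 1" using eps by (auto simp: nontrivial_additive_character_def)
  obtain \<mu> where \<mu>: "\<mu> \<in> Dual" "\<mu> x = s" using Dual_nonzero[OF False] by metis
  have "(\<Sum>\<mu>\<in>Dual. \<epsilon> (\<mu> x)) = 0"
  proof (rule sum_eq_0_by_shift[where f = "\<lambda>\<nu> y. \<mu> y + \<nu> y" and c = "\<epsilon> s"])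
    show "inj_on (\<lambda>\<nu> y. \<mu> y + \<nu> y) Dual"
      by (rule inj_onI) (simp add: fun_eq_iff)
    fix \<nu> assume "\<nu> \<in> Dual"
    then show "(\<lambda>y. \<mu> y + \<nu> y) \<in> Dual" using \<mu>(1) by (simp add: Dual_def algebra_simps)
    show "\<epsilon> (\<mu> x + \<nu> x) = \<epsilon> s * \<epsilon> (\<nu> x)" using \<mu>(2) by (simp add: eps_add)
  qed (use s finite_Dual in auto)
  with False show ?thesis by simp
qed

section \<open>Coordinates on the full group\<close>

definition gel :: "'h \<Rightarrow> 'j \<Rightarrow> ('h, 'k, 'j) alg" where
  "gel h x = inH h + inJ x"

abbreviation Gr :: "('h, 'k, 'j) alg monoid" where
  "Gr \<equiv> tri_group oneA (range inH) (range inJ)"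

lemma gel_sel [simp]: "fst (gel h x) = Poly_Mapping.single h 1" "snd (gel h x) = x"
  by (simp_all add: gel_def inH_eq)

lemma gel_inject [simp]: "gel h x = gel h' x' \<longleftrightarrow> h = h' \<and> x = x'"
proof
  assume eq: "gel h x = gel h' x'"
  then have "x = x'" by (metis gel_sel(2))
  moreover from eq have "inH h = inH h'" unfolding gel_def \<open>x = x'\<close> by simp
  ultimately show "h = h' \<and> x = x'" by simp
qed simp

lemma gel_mult: "gel h x \<cdot> gel h' x' = gel (h + h') (lact h x' + ract x h' + x * x')"
  by (simp add: gel_def mulA_ring in_mult inH_inJ in_add[symmetric] algebra_simps)

lemma gel_0 [simp]: "gel 0 0 = oneA"
  by (simp add: gel_def oneA_eq(2))

lemma carrier_Gr: "g \<in> carrier Gr \<longleftrightarrow> (\<exists>h x. g = gel h x)"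
  unfolding carrier_tri_group gel_def by blast

lemma gel_in_Gr [simp]: "gel h x \<in> carrier Gr"
  unfolding carrier_Gr by blast

lemma group_Gr: "group Gr"
  by (rule group_tri_group[OF tri_data_UNIV])

sublocale Gr: group Gr
  by (rule group_Gr)

lemma gel_inverse:
  obtains x' where "gel h x \<cdot> gel (- h) x' = oneA" "gel (- h) x' \<cdot> gel h x = oneA"
    "inv\<^bsub>Gr\<^esub> (gel h x) = gel (- h) x'"
proof -
  obtain h' x' where i: "inv\<^bsub>Gr\<^esub> (gel h x) = gel h' x'"
    using Gr.inv_closed[OF gel_in_Gr] unfolding carrier_Gr by blast
  have "gel h x \<cdot> gel h' x' = oneA" "gel h' x' \<cdot> gel h x = oneA"
    using Gr.r_inv[OF gel_in_Gr, of h x] Gr.l_inv[OF gel_in_Gr, of h x]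
    unfolding i tri_group_sel by auto
  moreover from this have "h' = - h"
    unfolding gel_mult gel_0[symmetric] by (simp add: eq_neg_iff_add_eq_0 del: gel_0)
  ultimately show ?thesis using that i by simp
qed

lemma finite_Gr: "finite (carrier Gr)"
  by (rule finite_alg)

lemma scaleA_mult: "scaleA c a \<cdot> b = scaleA c (a \<cdot> b)" "a \<cdot> scaleA c b = scaleA c (a \<cdot> b)"
proof -
  show "scaleA c a \<cdot> b = scaleA c (a \<cdot> b)" by (simp add: scaleA_eq mulA_assoc)
  have "a \<cdot> inK (Poly_Mapping.single 0 c) = inK (Poly_Mapping.single 0 c) \<cdot> a"
    by (simp add: mulA_eq inK_def act_zero act_single lact_one ract_one mult.commute)
  then show "a \<cdot> scaleA c b = scaleA c (a \<cdot> b)" by (simp add: scaleA_eq mulA_assoc[symmetric])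
qed

lemma inJ_scale: "inJ (scale c x) = scaleA c (inJ x)"
  by (simp add: scaleA_eq in_mult act_single lact_one)

lemma snd_scaleA: "snd (scaleA c a) = scale c (snd a)"
  by (simp add: scaleA_def)

text \<open>Serves two purposes: with \<open>a\<close> and \<open>b\<close> in \<open>G\<close> it
  is the action on forms, and with \<open>a = b\<close> an idempotent it is compression to a
  corner.\<close>

definition twist :: "('j \<Rightarrow> 'k) \<Rightarrow> ('h, 'k, 'j) alg \<Rightarrow> ('h, 'k, 'j) alg \<Rightarrow> 'j \<Rightarrow> 'k" where
  "twist \<mu> a b x = \<mu> (snd (a \<cdot> inJ x \<cdot> b))"

lemma twist_Dual:
  assumes "\<mu> \<in> Dual"
  shows "twist \<mu> a b \<in> Dual"
  unfolding Dual_def mem_Collect_eq twist_def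
  by (simp add: in_add(2)[symmetric] mulA_distrib inJ_scale scaleA_mult snd_scaleA DualD[OF assms])

lemma fst_inJ_mult: "fst (a \<cdot> inJ x \<cdot> b) = 0"
  by (simp add: fst_mulA)

lemma inJ_twist_arg: "inJ (snd (a \<cdot> inJ x \<cdot> b)) = a \<cdot> inJ x \<cdot> b"
  by (rule inJ_snd) (rule fst_inJ_mult)

lemma twist_twist: "twist (twist \<mu> a b) c d = twist \<mu> (a \<cdot> c) (d \<cdot> b)"
  by (rule ext) (simp only: twist_def inJ_twist_arg, simp only: mulA_assoc)

lemma twist_one [simp]: "twist \<mu> oneA oneA = \<mu>"
  by (rule ext) (simp add: twist_def)

text \<open>
  The pairs \<open>(t a, b\<inverse> t\<inverse>)\<close> with \<open>t \<in> H\<close> and \<open>a, b \<in> N\<close> are exactly the pairs of elements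
  of \<open>G\<close> whose components in \<open>H\<close> are inverse to each other.
\<close>

definition superclass_function :: "(('h, 'k, 'j) alg \<Rightarrow> complex) \<Rightarrow> bool" where
  "superclass_function F \<longleftrightarrow> (\<forall>t u v h x.
     F (oneA + gel t u \<cdot> (gel h x - oneA) \<cdot> gel (- t) v) = F (gel h x))"

lemma gel_minus_one: "gel h x - oneA = inK (Poly_Mapping.single h 1 - 1) + inJ x"
  by (simp add: gel_def inH_eq oneA_eq(1) in_add(3)[symmetric])

lemma oneA_sel: "fst oneA = 1" "snd oneA = 0"
  by (simp_all add: oneA_def)

text \<open>As \<open>kH\<close> is commutative, \<open>t\<close> and \<open>- t\<close> cancel; so
  the action permutes each coset \<open>h + J\<close>.\<close>

lemma fst_act: "fst (gel t u \<cdot> (gel h x - oneA) \<cdot> gel (- t) v) = Poly_Mapping.single h 1 - 1"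
proof -
  have "fst (gel t u \<cdot> (gel h x - oneA) \<cdot> gel (- t) v) =
    (Poly_Mapping.single t 1 * Poly_Mapping.single (- t) 1) * (Poly_Mapping.single h 1 - 1)"
    by (simp add: fst_mulA gel_minus_one mult_ac)
  then show ?thesis by (simp add: mult_single)
qed

lemma act_gel:
  "oneA + gel t u \<cdot> (gel h x - oneA) \<cdot> gel (- t) v =
    gel h (snd (gel t u \<cdot> (gel h x - oneA) \<cdot> gel (- t) v))"
proof (rule prod_eqI)
  show "fst (oneA + gel t u \<cdot> (gel h x - oneA) \<cdot> gel (- t) v) =
    fst (gel h (snd (gel t u \<cdot> (gel h x - oneA) \<cdot> gel (- t) v)))"
    by (simp add: fst_act oneA_sel)
qed (simp add: oneA_sel)

lemma gel_sandwich_bij: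
  "bij (\<lambda>x. snd (gel t u \<cdot> (gel h x - oneA) \<cdot> gel (- t) v))"
proof -
  have "inj (\<lambda>x. snd (gel t u \<cdot> (gel h x - oneA) \<cdot> gel (- t) v))"
  proof (rule injI)
    fix x y assume eq: "snd (gel t u \<cdot> (gel h x - oneA) \<cdot> gel (- t) v) =
      snd (gel t u \<cdot> (gel h y - oneA) \<cdot> gel (- t) v)"
    then have eq: "gel t u \<cdot> (gel h x - oneA) \<cdot> gel (- t) v =
      gel t u \<cdot> (gel h y - oneA) \<cdot> gel (- t) v"
      by (intro prod_eqI) (simp_all add: fst_act)
    obtain a where a: "gel (- t) a \<cdot> gel t u = oneA" using gel_inverse by metis
    obtain b where b: "gel (- t) v \<cdot> gel (- (- t)) b = oneA" using gel_inverse by metis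
    have "gel (- t) a \<cdot> (gel t u \<cdot> (gel h x - oneA) \<cdot> gel (- t) v) \<cdot> gel (- (- t)) b = gel h x - oneA"
      for x
    proof -
      have "gel (- t) a \<cdot> (gel t u \<cdot> (gel h x - oneA) \<cdot> gel (- t) v) \<cdot> gel (- (- t)) b =
        (gel (- t) a \<cdot> gel t u) \<cdot> (gel h x - oneA) \<cdot> (gel (- t) v \<cdot> gel (- (- t)) b)"
        by (simp only: mulA_assoc)
      then show ?thesis by (simp only: a b mulA_one)
    qed
    from this[of x] this[of y] have "gel h x - oneA = gel h y - oneA" unfolding eq by simp
    then show "x = y" by simp
  qed
  then show ?thesis by (simp add: bij_def finite_UNIV_inj_surj finite_J)
qed

section \<open>Fourier transform along the cosets of \<open>J\<close>\<close>

definition FT :: "(('h, 'k, 'j) alg \<Rightarrow> complex) \<Rightarrow> 'h \<Rightarrow> ('j \<Rightarrow> 'k) \<Rightarrow> complex" where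
  "FT F h \<mu> = (\<Sum>x\<in>UNIV. F (gel h x) * \<epsilon> (- \<mu> x))"

text \<open>Fourier inversion: summing \<open>FT F h \<mu> * \<epsilon> (\<mu> x)\<close> over all
  forms isolates the value at \<open>x\<close>.\<close>

lemma FT_eq_0_imp:
  assumes "\<And>\<mu>. \<mu> \<in> Dual \<Longrightarrow> FT F h \<mu> = 0"
  shows "F (gel h x) = 0"
proof -
  have "0 = (\<Sum>\<mu>\<in>Dual. FT F h \<mu> * \<epsilon> (\<mu> x))" using assms by simp
  also have "\<dots> = (\<Sum>\<mu>\<in>Dual. \<Sum>y\<in>UNIV. F (gel h y) * \<epsilon> (\<mu> (x - y)))"
    unfolding FT_def sum_distrib_right
    by (intro sum.cong refl) (simp add: DualD eps_add[symmetric] mult.assoc)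
  also have "\<dots> = (\<Sum>y\<in>UNIV. F (gel h y) * (\<Sum>\<mu>\<in>Dual. \<epsilon> (\<mu> (x - y))))"
    by (subst sum.swap) (simp add: sum_distrib_left)
  also have "\<dots> = (\<Sum>y\<in>UNIV. if y = x then F (gel h y) * of_nat (card Dual) else 0)"
    unfolding sum_Dual_eps by (intro sum.cong refl) auto
  also have "\<dots> = F (gel h x) * of_nat (card Dual)"
    using finite_J by simp
  finally have "F (gel h x) = 0 \<or> card Dual = 0" by simp
  moreover have "(\<lambda>_. 0) \<in> Dual" by (simp add: Dual_def)
  ultimately show ?thesis using finite_Dual by auto
qed

lemma FT_shift:
  assumes "superclass_function F"
  shows "FT F h \<mu> = (\<Sum>x\<in>UNIV. F (gel h x) * \<epsilon> (- \<mu> (snd (gel t u \<cdot> (gel h x - oneA) \<cdot> gel (- t) v))))"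
proof -
  let ?A = "\<lambda>x. snd (gel t u \<cdot> (gel h x - oneA) \<cdot> gel (- t) v)"
  have "F (gel h (?A x)) = F (gel h x)" for x
    using assms unfolding superclass_function_def act_gel[symmetric] by blast
  then show ?thesis
    unfolding FT_def using sum.reindex_bij_betw[OF gel_sandwich_bij, of "\<lambda>x. F (gel h x) * \<epsilon> (- \<mu> x)"]
    by (metis (no_types, lifting) sum.cong)
qed

text \<open>For \<open>g = h + x\<close> split \<open>g - 1\<close> into \<open>h - 1\<close> and
  \<open>x\<close>. The second part produces the twisted form; the first does not depend on the
  summation variable and leaves the scalar factor.\<close>

lemma FT_twist:
  assumes F: "superclass_function F" and \<mu>: "\<mu> \<in> Dual"
  shows "FT F h (twist \<mu> (gel t u) (gel (- t) v)) =
    \<epsilon> (\<mu> (snd (gel t u \<cdot> (inH h - oneA) \<cdot> gel (- t) v))) * FT F h \<mu>"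
proof -
  have "snd (gel t u \<cdot> (gel h x - oneA) \<cdot> gel (- t) v) =
    snd (gel t u \<cdot> (inH h - oneA) \<cdot> gel (- t) v) + snd (gel t u \<cdot> inJ x \<cdot> gel (- t) v)" for x
    by (simp add: gel_def[of h] mulA_ring)
  then have "FT F h \<mu> = (\<Sum>x\<in>UNIV. F (gel h x) *
    (\<epsilon> (- \<mu> (snd (gel t u \<cdot> (inH h - oneA) \<cdot> gel (- t) v))) *
     \<epsilon> (- twist \<mu> (gel t u) (gel (- t) v) x)))"
    unfolding FT_shift[OF F, of h \<mu> t u v]
    by (simp add: DualD[OF \<mu>] twist_def eps_add[symmetric])
  then show ?thesis
    by (simp add: FT_def sum_distrib_left eps_minus mult.left_commute field_simps)
qed

text \<open>Average the shift by \<open>1 + v\<close> over all \<open>v\<close>: the inner sum is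
  zero unless the form \<open>v \<mapsto> \<mu>((g - 1) v)\<close> vanishes identically.\<close>

lemma FT_right:
  assumes F: "superclass_function F" and \<mu>: "\<mu> \<in> Dual"
  shows "FT F h \<mu> = (\<Sum>x \<in> {x. \<forall>v. \<mu> (snd ((gel h x - oneA) \<cdot> inJ v)) = 0}. F (gel h x) * \<epsilon> (- \<mu> x))"
proof -
  let ?n = "of_nat (card (UNIV :: 'j set)) :: complex"
  have "?n * FT F h \<mu> = (\<Sum>v\<in>(UNIV :: 'j set). FT F h \<mu>)" by simp
  also have "\<dots> = (\<Sum>v\<in>UNIV. \<Sum>x\<in>UNIV. F (gel h x) * \<epsilon> (- \<mu> x) *
      \<epsilon> (- \<mu> (snd ((gel h x - oneA) \<cdot> inJ v))))"
  proof (intro sum.cong refl)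
    fix v :: 'j
    have "snd (gel 0 0 \<cdot> (gel h x - oneA) \<cdot> gel (- 0) v) = x + snd ((gel h x - oneA) \<cdot> inJ v)" for x
      by (simp add: gel_def[of 0 v] oneA_eq(2)[symmetric] mulA_distrib) (simp add: oneA_def)
    then show "FT F h \<mu> = (\<Sum>x\<in>UNIV. F (gel h x) * \<epsilon> (- \<mu> x) *
      \<epsilon> (- \<mu> (snd ((gel h x - oneA) \<cdot> inJ v))))"
      unfolding FT_shift[OF F, of h \<mu> 0 0 v]
      by (simp add: DualD[OF \<mu>] mult.assoc eps_add[symmetric])
  qed
  also have "\<dots> = (\<Sum>x\<in>UNIV. F (gel h x) * \<epsilon> (- \<mu> x) *
      (\<Sum>v\<in>UNIV. \<epsilon> (- \<mu> (snd ((gel h x - oneA) \<cdot> inJ v)))))"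
    by (subst sum.swap) (simp add: sum_distrib_left)
  also have "\<dots> = (\<Sum>x\<in>UNIV. if \<forall>v. \<mu> (snd ((gel h x - oneA) \<cdot> inJ v)) = 0
      then ?n * (F (gel h x) * \<epsilon> (- \<mu> x)) else 0)"
  proof (intro sum.cong refl)
    fix x :: 'j
    have "(\<lambda>v. - \<mu> (snd ((gel h x - oneA) \<cdot> inJ v))) \<in> Dual"
      using Dual_minus[OF twist_Dual[OF \<mu>, of "gel h x - oneA" oneA]] by (simp add: twist_def)
    from sum_eps[OF this]
    show "F (gel h x) * \<epsilon> (- \<mu> x) * (\<Sum>v\<in>UNIV. \<epsilon> (- \<mu> (snd ((gel h x - oneA) \<cdot> inJ v)))) =
      (if \<forall>v. \<mu> (snd ((gel h x - oneA) \<cdot> inJ v)) = 0 then ?n * (F (gel h x) * \<epsilon> (- \<mu> x)) else 0)"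
      by simp
  qed
  also have "\<dots> = ?n * (\<Sum>x \<in> {x. \<forall>v. \<mu> (snd ((gel h x - oneA) \<cdot> inJ v)) = 0}. F (gel h x) * \<epsilon> (- \<mu> x))"
    using finite_J by (simp add: sum.If_cases sum_distrib_left)
  finally show ?thesis using card_J_nz by simp
qed

text \<open>The same averaging over left factors \<open>1 + u\<close>: if no \<open>x\<close>
  survived, the transform would vanish.\<close>

lemma FT_left:
  assumes F: "superclass_function F" and \<mu>: "\<mu> \<in> Dual" and nz: "FT F h \<mu> \<noteq> 0"
  shows "\<exists>x. \<forall>v. \<mu> (snd (inJ v \<cdot> (gel h x - oneA))) = 0"
proof (rule ccontr)
  assume N: "\<not> ?thesis"
  let ?n = "of_nat (card (UNIV :: 'j set)) :: complex"
  have "?n * FT F h \<mu> = (\<Sum>u\<in>(UNIV :: 'j set). FT F h \<mu>)" by simp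
  also have "\<dots> = (\<Sum>u\<in>UNIV. \<Sum>x\<in>UNIV. F (gel h x) * \<epsilon> (- \<mu> x) *
      \<epsilon> (- \<mu> (snd (inJ u \<cdot> (gel h x - oneA)))))"
  proof (intro sum.cong refl)
    fix u :: 'j
    have "snd (gel 0 u \<cdot> (gel h x - oneA) \<cdot> gel (- 0) 0) = x + snd (inJ u \<cdot> (gel h x - oneA))" for x
      by (simp add: gel_def[of 0 u] oneA_eq(2)[symmetric] mulA_distrib) (simp add: oneA_def)
    then show "FT F h \<mu> = (\<Sum>x\<in>UNIV. F (gel h x) * \<epsilon> (- \<mu> x) *
      \<epsilon> (- \<mu> (snd (inJ u \<cdot> (gel h x - oneA)))))"
      unfolding FT_shift[OF F, of h \<mu> 0 u 0]
      by (simp add: DualD[OF \<mu>] mult.assoc eps_add[symmetric])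
  qed
  also have "\<dots> = (\<Sum>x\<in>UNIV. F (gel h x) * \<epsilon> (- \<mu> x) *
      (\<Sum>u\<in>UNIV. \<epsilon> (- \<mu> (snd (inJ u \<cdot> (gel h x - oneA))))))"
    by (subst sum.swap) (simp add: sum_distrib_left)
  also have "\<dots> = 0"
  proof (intro sum.neutral ballI)
    fix x :: 'j
    have "(\<lambda>u. - \<mu> (snd (inJ u \<cdot> (gel h x - oneA)))) \<in> Dual"
      using Dual_minus[OF twist_Dual[OF \<mu>, of oneA "gel h x - oneA"]] by (simp add: twist_def)
    from sum_eps[OF this] spec[OF N[unfolded not_ex], of x]
    show "F (gel h x) * \<epsilon> (- \<mu> x) * (\<Sum>u\<in>UNIV. \<epsilon> (- \<mu> (snd (inJ u \<cdot> (gel h x - oneA))))) = 0"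
      by auto
  qed
  finally show False using nz card_J_nz by simp
qed

end

section \<open>The idempotent of the part fixed by a group element\<close>

lemma fixed_idempotent_ex:
  fixes z c :: "'a::comm_ring_1"
  assumes z: "z ^ n = 1" and c: "c * of_nat n = 1"
  obtains p s where "p * p = p" "z * p = p" "1 - p = (z - 1) * s"
proof -
  \<comment> \<open>As \<open>c\<close> inverts \<open>n\<close>, \<open>c * \<Sigma>\<close> is the
    average of the powers of \<open>z\<close>; it absorbs each of them and is therefore
    idempotent.\<close>
  define \<Sigma> where "\<Sigma> = (\<Sum>i<n. z ^ i)"
  have "(1 - z) * \<Sigma> = 0" using one_diff_power_eq[of z n] z by (simp add: \<Sigma>_def)
  then have z\<Sigma>: "z * \<Sigma> = \<Sigma>" by (simp add: left_diff_distrib)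
  have zi: "z ^ i * \<Sigma> = \<Sigma>" for i by (induction i) (simp_all add: z\<Sigma> mult.assoc)
  have "\<Sigma> * \<Sigma> = (\<Sum>i<n. z ^ i * \<Sigma>)" by (subst (1) \<Sigma>_def) (simp add: sum_distrib_right)
  then have \<Sigma>\<Sigma>: "\<Sigma> * \<Sigma> = of_nat n * \<Sigma>" by (simp add: zi)
  have "(c * \<Sigma>) * (c * \<Sigma>) = c * c * (\<Sigma> * \<Sigma>)" by (simp add: mult_ac)
  also have "\<dots> = (c * of_nat n) * (c * \<Sigma>)" by (simp add: \<Sigma>\<Sigma> mult_ac)
  finally have "(c * \<Sigma>) * (c * \<Sigma>) = c * \<Sigma>" using c by simp
  moreover have "z * (c * \<Sigma>) = c * \<Sigma>" using z\<Sigma> by (simp add: mult.left_commute)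
  \<comment> \<open>The complement is the average of the \<open>1 - z ^ i\<close>, each of which is
    divisible by \<open>z - 1\<close> through a geometric sum.\<close>
  moreover have "1 - c * \<Sigma> = (z - 1) * (- c * (\<Sum>i<n. \<Sum>j<i. z ^ j))"
  proof -
    have "1 - c * \<Sigma> = c * (\<Sum>i<n. 1 - z ^ i)"
      using c by (simp add: \<Sigma>_def sum_subtractf right_diff_distrib)
    also have "\<dots> = c * ((1 - z) * (\<Sum>i<n. \<Sum>j<i. z ^ j))"
      by (simp add: one_diff_power_eq sum_distrib_left)
    finally show ?thesis by (simp add: algebra_simps)
  qed
  ultimately show ?thesis using that by blast
qed

text \<open>Multiplication by \<open>h\<close> permutes the group, so the product of all elements
  absorbs the power of \<open>h\<close>; multiplying by the product of all inverses cancels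
  it.\<close>

lemma single_power_card:
  fixes h :: "'h::{ab_group_add,finite}"
  shows "Poly_Mapping.single h (1::'k::comm_ring_1) ^ CARD('h) = 1"
proof -
  let ?s = "\<lambda>h::'h. Poly_Mapping.single h (1::'k)"
  have "(\<Prod>x\<in>UNIV. ?s x) = (\<Prod>x\<in>UNIV. ?s (h + x))"
    by (rule prod.reindex_bij_betw[symmetric]) (rule bij_plus)
  also have "\<dots> = (\<Prod>x\<in>UNIV. ?s h * ?s x)" by (simp add: mult_single)
  also have "\<dots> = ?s h ^ CARD('h) * (\<Prod>x\<in>UNIV. ?s x)" by (simp add: prod.distrib)
  finally have e: "(\<Prod>x\<in>UNIV. ?s x) = ?s h ^ CARD('h) * (\<Prod>x\<in>UNIV. ?s x)" .
  have "(\<Prod>x\<in>UNIV. ?s x) * (\<Prod>x\<in>UNIV. ?s (- x)) = 1"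
    by (simp add: prod.distrib[symmetric] mult_single)
  moreover have "\<dots> = ?s h ^ CARD('h) * ((\<Prod>x\<in>UNIV. ?s x) * (\<Prod>x\<in>UNIV. ?s (- x)))"
    using arg_cong[OF e, of "\<lambda>P. P * (\<Prod>x\<in>UNIV. ?s (- x))"] calculation by (simp only: mult.assoc)
  ultimately show ?thesis by simp
qed

context triangular_type_character
begin

text \<open>\<open>char_not_dvd\<close> enters here, to divide by the order of \<open>H\<close>.
  \<open>p\<close> projects onto the part where \<open>h\<close> acts as 1, and \<open>s\<close>
  inverts \<open>h - 1\<close> on the complement.\<close>

lemma fixed_idempotent:
  fixes h :: 'h
  obtains p s where "p * p = p" "Poly_Mapping.single h (1::'k) * p = p"
    "1 - p = (Poly_Mapping.single h 1 - 1) * s"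
proof -
  have "of_nat CARD('h) \<noteq> (0 :: 'k)" using char_not_dvd by (simp add: of_nat_eq_0_iff_char_dvd)
  then have "Poly_Mapping.single (0::'h) (1 / of_nat CARD('h) :: 'k) * of_nat CARD('h) = 1"
    by (simp add: single_of_nat[symmetric] mult_single del: single_of_nat)
  then show ?thesis by (rule fixed_idempotent_ex[OF single_power_card[of h]]) (rule that)
qed

section \<open>Orbits of linear forms\<close>

definition orb :: "('j \<Rightarrow> 'k) \<Rightarrow> ('j \<Rightarrow> 'k) set" where
  "orb \<mu> = {twist \<mu> (gel t u) (gel (- t) v) | t u v. True}"

lemma orb_refl: "\<mu> \<in> orb \<mu>"
  unfolding orb_def by (auto intro!: exI[of _ 0])

lemma orb_Dual: "\<mu> \<in> Dual \<Longrightarrow> \<nu> \<in> orb \<mu> \<Longrightarrow> \<nu> \<in> Dual"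
  by (auto simp: orb_def twist_Dual)

lemma twist_in_orb: "twist \<mu> (gel t u) (gel (- t) v) \<in> orb \<mu>"
  by (auto simp: orb_def)

lemma orb_trans: "\<nu> \<in> orb \<mu> \<Longrightarrow> \<kappa> \<in> orb \<nu> \<Longrightarrow> \<kappa> \<in> orb \<mu>"
proof -
  assume "\<nu> \<in> orb \<mu>" "\<kappa> \<in> orb \<nu>"
  then obtain t u v t' u' v' where "\<nu> = twist \<mu> (gel t u) (gel (- t) v)"
    "\<kappa> = twist \<nu> (gel t' u') (gel (- t') v')" unfolding orb_def by blast
  then have "\<kappa> = twist \<mu> (gel t u \<cdot> gel t' u') (gel (- t') v' \<cdot> gel (- t) v)" by (simp add: twist_twist)
  moreover have "- t' + - t = - (t + t')" by simp
  ultimately show ?thesis unfolding gel_mult using twist_in_orb by metis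
qed

lemma orb_sym: "\<nu> \<in> orb \<mu> \<Longrightarrow> \<mu> \<in> orb \<nu>"
proof -
  assume "\<nu> \<in> orb \<mu>"
  then obtain t u v where \<nu>: "\<nu> = twist \<mu> (gel t u) (gel (- t) v)" unfolding orb_def by blast
  obtain a where a: "gel t u \<cdot> gel (- t) a = oneA" using gel_inverse by metis
  obtain b where b: "gel (- (- t)) b \<cdot> gel (- t) v = oneA" using gel_inverse by metis
  have "\<mu> = twist \<nu> (gel (- t) a) (gel (- (- t)) b)"
    unfolding \<nu> twist_twist a b by simp
  then show ?thesis using twist_in_orb by metis
qed

lemma orb_eq: "\<nu> \<in> orb \<mu> \<Longrightarrow> orb \<nu> = orb \<mu>"
  using orb_trans orb_sym by blast

subsection \<open>Minimal idempotents of an orbit\<close>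

text \<open>That \<open>\<eta>\<close> belongs to the dual of the corner of \<open>z\<close> is
  expressed as invariance under compression. Minimality is tested on the orbit under the full group,
  not only under the corner group.\<close>

definition minimal_pair :: "('h, 'k) poly_mapping \<Rightarrow> ('j \<Rightarrow> 'k) \<Rightarrow> bool" where
  "minimal_pair z \<eta> \<longleftrightarrow> z * z = z \<and> \<eta> \<in> Dual \<and> twist \<eta> (inK z) (inK z) = \<eta> \<and>
     (\<forall>w. w * w = w \<and> z * w = w \<and> w \<noteq> z \<longrightarrow> (\<forall>\<nu>\<in>orb \<eta>. twist \<nu> (inK w) (inK w) \<noteq> \<nu>))"

text \<open>Among the idempotents whose corner dual meets the orbit, 1 being one, take one whose
  ideal in \<open>kH\<close> has the fewest elements. An idempotent strictly below \<open>z\<close>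
  has a strictly smaller ideal.\<close>

lemma minimal_pair_ex:
  assumes "\<mu> \<in> Dual"
  shows "\<exists>z \<eta>. \<eta> \<in> orb \<mu> \<and> minimal_pair z \<eta>"
proof -
  let ?P = "\<lambda>z. z * z = z \<and> (\<exists>\<eta>\<in>orb \<mu>. twist \<eta> (inK z) (inK z) = \<eta>)"
  let ?m = "\<lambda>z :: ('h, 'k) poly_mapping. card {w. z * w = w}"
  have "?P 1" using orb_refl[of \<mu>] by (auto simp: oneA_eq(1)[symmetric])
  from ex_has_least_nat[of ?P, OF this, of ?m] obtain z
    where z: "?P z" and min: "\<And>w. ?P w \<Longrightarrow> ?m z \<le> ?m w" by blast
  then obtain \<eta> where \<eta>: "\<eta> \<in> orb \<mu>" "twist \<eta> (inK z) (inK z) = \<eta>" by blast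
  have "twist \<nu> (inK w) (inK w) \<noteq> \<nu>" if w: "w * w = w" "z * w = w" "w \<noteq> z" and \<nu>: "\<nu> \<in> orb \<eta>" for w \<nu>
  proof
    assume "twist \<nu> (inK w) (inK w) = \<nu>"
    then have "?m z \<le> ?m w" using min[of w] w(1) \<nu> orb_trans[OF \<eta>(1)] by blast
    moreover have "?m w < ?m z"
    proof (rule psubset_card_mono)
      show "finite {w. z * w = w}"
        using finite_poly_mapping by (rule finite_subset[rotated]) simp
      have "z * v = v" if "w * v = v" for v
        using that w(2) by (metis mult.assoc)
      moreover have "w * z \<noteq> z" using w(2,3) by (simp add: mult.commute)
      ultimately show "{v. w * v = v} \<subset> {v. z * v = v}" using z by blast
    qed
    ultimately show False by simp
  qed
  then have "minimal_pair z \<eta>"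
    using z \<eta> orb_Dual[OF assms] by (auto simp: minimal_pair_def)
  then show ?thesis using \<eta>(1) by blast
qed

lemma sandwich:
  assumes "twist \<eta> e e = \<eta>" "fst a = 0"
  shows "\<eta> (snd (e \<cdot> a \<cdot> e)) = \<eta> (snd a)"
  using fun_cong[OF assms(1), of "snd a"] assms(2) by (simp add: twist_def inJ_snd)

lemma vanish_left:
  assumes "\<eta> \<in> Dual" "twist \<eta> e e = \<eta>" "fst a = 0" "e \<cdot> a = 0"
  shows "\<eta> (snd a) = 0"
  using sandwich[OF assms(2,3)] assms(4) DualD(3)[OF assms(1)] by simp

lemma vanish_right:
  assumes "\<eta> \<in> Dual" "twist \<eta> e e = \<eta>" "fst a = 0" "a \<cdot> e = 0"
  shows "\<eta> (snd a) = 0"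
  using sandwich[OF assms(2,3)] assms(4) DualD(3)[OF assms(1)] by (simp add: mulA_assoc)

text \<open>
  If \<open>h e \<noteq> e\<close>, the part of \<open>e\<close> on which \<open>h - 1\<close> is invertible could be split off from \<open>e\<close>,
  contradicting minimality.
\<close>

lemma FT_eq_0:
  assumes F: "superclass_function F" and m: "minimal_pair z \<eta>"
    and nz: "FT F h \<eta> \<noteq> 0"
  shows "Poly_Mapping.single h 1 * z = z"
proof -
  have z: "z * z = z" and \<eta>: "\<eta> \<in> Dual" and tw: "twist \<eta> (inK z) (inK z) = \<eta>"
    using m by (simp_all add: minimal_pair_def)
  let ?h = "Poly_Mapping.single h (1::'k)"
  obtain p s where p: "p * p = p" "?h * p = p" "1 - p = (?h - 1) * s" by (rule fixed_idempotent)
  define f where "f = 1 - p"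
  have ff: "f * f = f" using p(1) by (simp add: f_def algebra_simps)
  \<comment> \<open>The nonzero transform yields \<open>x\<close> and \<open>x'\<close> such that
    \<open>\<eta>\<close> vanishes on \<open>(h - 1 + x) J\<close> and on
    \<open>J (h - 1 + x')\<close>.\<close>
  have "{x. \<forall>v. \<eta> (snd ((gel h x - oneA) \<cdot> inJ v)) = 0} \<noteq> {}"
    using nz FT_right[OF F \<eta>, of h] by (metis (no_types, lifting) sum.empty)
  then obtain x where x: "\<And>v. \<eta> (snd ((gel h x - oneA) \<cdot> inJ v)) = 0" by blast
  obtain x' where x': "\<And>v. \<eta> (snd (inJ v \<cdot> (gel h x' - oneA))) = 0"
    using FT_left[OF F \<eta> nz] by blast
  define e where "e = inK z"
  \<comment> \<open>Since \<open>s\<close> inverts \<open>h - 1\<close> on the range of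
    \<open>f\<close>, \<open>(h - 1 + x) s f = (1 + c) f\<close>, so \<open>\<eta>\<close> vanishes
    on \<open>(1 + c) f J\<close>; \<open>d\<close> plays the same role on the other side.\<close>
  define c where "c = inJ x \<cdot> inK s"
  define d where "d = inK s \<cdot> inJ x'"
  have ee: "e \<cdot> e = e" by (simp add: e_def in_mult z)
  have ef: "e \<cdot> inK f = inK f \<cdot> e" by (simp add: e_def inK_commute)
  have fc: "fst c = 0" "fst d = 0" by (simp_all add: c_def d_def fst_mulA)
  have sf: "inK (?h - 1) \<cdot> inK s = inK f" "inK s \<cdot> inK (?h - 1) = inK f"
    by (simp_all add: in_mult f_def p(3) mult.commute)
  have ff': "inK f \<cdot> inK f = inK f" by (simp add: in_mult ff)
  have cf: "\<eta> (snd ((oneA + c) \<cdot> inK f \<cdot> a)) = 0" if "fst a = 0" for a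
  proof -
    have "(oneA + c) \<cdot> inK f \<cdot> a = (gel h x - oneA) \<cdot> (inK s \<cdot> inK f \<cdot> a)"
      unfolding gel_minus_one mulA_distrib c_def mulA_assoc[symmetric] sf ff' by simp
    moreover have "inK s \<cdot> inK f \<cdot> a = inJ (snd (inK s \<cdot> inK f \<cdot> a))"
      using that by (simp add: inJ_snd fst_mulA)
    ultimately show ?thesis using x by metis
  qed
  have df: "\<eta> (snd (a \<cdot> inK f \<cdot> (oneA + d))) = 0" if "fst a = 0" for a
  proof -
    have "a \<cdot> inK f \<cdot> (oneA + d) = (a \<cdot> inK f \<cdot> inK s) \<cdot> (gel h x' - oneA)"
      unfolding gel_minus_one mulA_distrib d_def mulA_assoc sf ff' by simp
    moreover have "a \<cdot> inK f \<cdot> inK s = inJ (snd (a \<cdot> inK f \<cdot> inK s))"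
      using that by (simp add: inJ_snd fst_mulA)
    ultimately show ?thesis using x' by metis
  qed
  \<comment> \<open>Compressing \<open>c\<close> and \<open>d\<close> by \<open>e\<close> makes
    \<open>C\<close> and \<open>D\<close> commute with \<open>e\<close>; the vanishing survives
    because \<open>\<eta>\<close> is invariant under compression by \<open>e\<close>.\<close>
  define C where "C = oneA + e \<cdot> c \<cdot> e"
  define D where "D = oneA + e \<cdot> d \<cdot> e"
  have eC: "e \<cdot> C = C \<cdot> e" "e \<cdot> D = D \<cdot> e"
    by (simp_all add: C_def D_def mulA_distrib mulA_assoc ee) (simp_all add: mulA_assoc[symmetric] ee)
  have ece: "e \<cdot> (oneA + c) \<cdot> e = C \<cdot> e" "e \<cdot> (oneA + d) \<cdot> e = e \<cdot> D"
    by (simp_all add: C_def D_def mulA_distrib mulA_assoc ee) (simp_all add: mulA_assoc[symmetric] ee)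
  have tw: "twist \<eta> e e = \<eta>" using tw by (simp add: e_def)
  \<comment> \<open>The candidate below \<open>z\<close> is its part fixed by \<open>h\<close>.
    \<open>L\<close> and \<open>R\<close> show that next to \<open>C\<close> and \<open>D\<close>
    the remaining part \<open>f e\<close> is not seen by \<open>\<eta>\<close>.\<close>
  define w where "w = p * z"
  have W: "inK w = e - inK f \<cdot> e" by (simp add: w_def e_def f_def in_mult in_add algebra_simps)
  have L: "\<eta> (snd (C \<cdot> inK w \<cdot> a)) = \<eta> (snd (C \<cdot> a))" if a: "fst a = 0" for a
  proof -
    have "\<eta> (snd (C \<cdot> e \<cdot> a)) = \<eta> (snd (e \<cdot> (C \<cdot> e \<cdot> a) \<cdot> e))"
      by (rule sandwich[OF tw, symmetric]) (simp add: fst_mulA a)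
    also have "e \<cdot> (C \<cdot> e \<cdot> a) \<cdot> e = e \<cdot> (C \<cdot> a) \<cdot> e"
      by (metis mulA_assoc eC(1) ee)
    also have "\<eta> (snd \<dots>) = \<eta> (snd (C \<cdot> a))"
      by (rule sandwich[OF tw]) (simp add: fst_mulA a)
    finally have 1: "\<eta> (snd (C \<cdot> e \<cdot> a)) = \<eta> (snd (C \<cdot> a))" .
    have "C \<cdot> (inK f \<cdot> e) \<cdot> a = C \<cdot> e \<cdot> inK f \<cdot> a" by (simp add: ef mulA_assoc)
    also have "\<dots> = e \<cdot> (oneA + c) \<cdot> e \<cdot> inK f \<cdot> a" by (simp add: ece)
    finally have "C \<cdot> (inK f \<cdot> e) \<cdot> a = e \<cdot> ((oneA + c) \<cdot> inK f \<cdot> (e \<cdot> a))"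
      by (simp only: mulA_assoc) (simp only: mulA_assoc[symmetric] ef)
    then have "\<eta> (snd (C \<cdot> (inK f \<cdot> e) \<cdot> a)) = \<eta> (snd (e \<cdot> (e \<cdot> ((oneA + c) \<cdot> inK f \<cdot> (e \<cdot> a))) \<cdot> e))"
      by (subst sandwich[OF tw]) (simp_all add: fst_mulA a)
    also have "\<dots> = \<eta> (snd (e \<cdot> ((oneA + c) \<cdot> inK f \<cdot> (e \<cdot> a)) \<cdot> e))"
      by (metis mulA_assoc ee)
    also have "\<dots> = \<eta> (snd ((oneA + c) \<cdot> inK f \<cdot> (e \<cdot> a)))"
      by (rule sandwich[OF tw]) (simp add: fst_mulA a)
    also have "\<dots> = 0" by (rule cf) (simp add: fst_mulA a)
    finally have 2: "\<eta> (snd (C \<cdot> (inK f \<cdot> e) \<cdot> a)) = 0" .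
    show ?thesis unfolding W by (simp add: mulA_diff DualD[OF \<eta>] 1 2)
  qed
  have R: "\<eta> (snd (a \<cdot> inK w \<cdot> D)) = \<eta> (snd (a \<cdot> D))" if a: "fst a = 0" for a
  proof -
    have "\<eta> (snd (a \<cdot> e \<cdot> D)) = \<eta> (snd (e \<cdot> (a \<cdot> e \<cdot> D) \<cdot> e))"
      by (rule sandwich[OF tw, symmetric]) (simp add: fst_mulA a)
    also have "e \<cdot> (a \<cdot> e \<cdot> D) \<cdot> e = e \<cdot> (a \<cdot> D) \<cdot> e"
      by (metis mulA_assoc eC(2) ee)
    also have "\<eta> (snd \<dots>) = \<eta> (snd (a \<cdot> D))"
      by (rule sandwich[OF tw]) (simp add: fst_mulA a)
    finally have 1: "\<eta> (snd (a \<cdot> e \<cdot> D)) = \<eta> (snd (a \<cdot> D))" .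
    have "a \<cdot> (inK f \<cdot> e) \<cdot> D = a \<cdot> inK f \<cdot> (e \<cdot> D)" by (simp add: mulA_assoc)
    also have "\<dots> = a \<cdot> inK f \<cdot> (e \<cdot> (oneA + d) \<cdot> e)" by (simp add: ece)
    finally have "a \<cdot> (inK f \<cdot> e) \<cdot> D = (a \<cdot> e \<cdot> inK f \<cdot> (oneA + d)) \<cdot> e"
      by (simp only: mulA_assoc) (simp only: mulA_assoc[symmetric] ef)
    then have "\<eta> (snd (a \<cdot> (inK f \<cdot> e) \<cdot> D)) = \<eta> (snd (e \<cdot> ((a \<cdot> e \<cdot> inK f \<cdot> (oneA + d)) \<cdot> e) \<cdot> e))"
      by (subst sandwich[OF tw]) (simp_all add: fst_mulA a)
    also have "\<dots> = \<eta> (snd (e \<cdot> (a \<cdot> e \<cdot> inK f \<cdot> (oneA + d)) \<cdot> e))"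
      by (metis mulA_assoc ee)
    also have "\<dots> = \<eta> (snd (a \<cdot> e \<cdot> inK f \<cdot> (oneA + d)))"
      by (rule sandwich[OF tw]) (simp add: fst_mulA a)
    also have "\<dots> = 0" by (rule df) (simp add: fst_mulA a)
    finally have 2: "\<eta> (snd (a \<cdot> (inK f \<cdot> e) \<cdot> D)) = 0" .
    show ?thesis unfolding W by (simp add: mulA_diff DualD[OF \<eta>] 1 2)
  qed
  define \<nu> where "\<nu> = twist \<eta> C D"
  have CD: "C = gel 0 (snd (e \<cdot> c \<cdot> e))" "D = gel (- 0) (snd (e \<cdot> d \<cdot> e))"
    by (simp_all add: C_def D_def gel_def oneA_eq(2)[symmetric] inJ_snd fst_mulA fc)
  have "\<nu> \<in> orb \<eta>"
    unfolding \<nu>_def CD by (rule twist_in_orb)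
  moreover have "twist \<nu> (inK w) (inK w) = \<nu>"
  proof
    fix y
    have "twist \<nu> (inK w) (inK w) y = \<eta> (snd (C \<cdot> inK w \<cdot> (inJ y \<cdot> inK w \<cdot> D)))"
      by (simp add: \<nu>_def twist_twist) (simp add: twist_def mulA_assoc)
    also have "\<dots> = \<eta> (snd (C \<cdot> (inJ y \<cdot> inK w \<cdot> D)))" by (rule L) (simp add: fst_mulA)
    also have "\<dots> = \<eta> (snd ((C \<cdot> inJ y) \<cdot> inK w \<cdot> D))" by (simp add: mulA_assoc)
    also have "\<dots> = \<eta> (snd ((C \<cdot> inJ y) \<cdot> D))" by (rule R) (simp add: fst_mulA)
    finally show "twist \<nu> (inK w) (inK w) y = \<nu> y" by (simp add: \<nu>_def twist_def)
  qed
  moreover have "w * w = (p * p) * (z * z)" by (simp add: w_def mult_ac)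
  then have "w * w = w" by (simp add: p(1) z) (simp add: w_def)
  moreover have "z * w = p * (z * z)" by (simp add: w_def mult_ac)
  then have "z * w = w" by (simp add: z) (simp add: w_def)
  \<comment> \<open>The form \<open>\<nu>\<close> lies both in the orbit and in the dual of the
    corner of \<open>w\<close>, so minimality gives \<open>p * z = z\<close>; as \<open>h\<close>
    fixes \<open>p\<close>, it fixes \<open>z\<close>.\<close>
  ultimately have "w = z" using m unfolding minimal_pair_def by blast
  then have "?h * z = ?h * p * z" by (simp add: w_def mult.assoc)
  then show ?thesis using \<open>w = z\<close> p(2) by (simp add: w_def)
qed

text \<open>Removes the phase from the summands of an induced character at \<open>\<eta>\<close>.
  Put \<open>m = h - 1\<close> and \<open>y = t + u\<close> in \<open>y m y\<inverse>\<close>. The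
  term \<open>m\<close> has no component in \<open>J\<close>, and the term
  \<open>u m t\<inverse>\<close> dies by \<open>m e = 0\<close>. The rest is
  \<open>y X y\<inverse>\<close> with \<open>X = m u' y\<close>, which the hypothesis on
  \<open>b\<close> trades for \<open>X b\<close>; that dies by \<open>e m = 0\<close>.\<close>

lemma conj_vanish:
  assumes \<eta>: "\<eta> \<in> Dual" and tw: "twist \<eta> (inK z) (inK z) = \<eta>"
    and h: "Poly_Mapping.single h 1 * z = z"
    and inv: "gel (- t) u' \<cdot> gel t u = oneA"
    and b: "twist \<eta> oneA b = twist \<eta> (gel t u) (gel (- t) u')"
  shows "\<eta> (snd (gel t u \<cdot> (inH h - oneA) \<cdot> gel (- t) u')) = 0"
proof -
  define e where "e = inK z"
  have tw: "twist \<eta> e e = \<eta>" using tw by (simp add: e_def)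
  define m where "m = inH h - oneA"
  have m: "m = inK (Poly_Mapping.single h 1 - 1)" by (simp add: m_def inH_eq oneA_eq(1) in_add)
  have em: "e \<cdot> m = 0" "m \<cdot> e = 0"
    using h by (simp_all add: e_def m in_mult algebra_simps mult.commute) (simp_all add: inK_def zero_prod_def)
  have comm: "inH t \<cdot> m = m \<cdot> inH t" "inH t \<cdot> e = e \<cdot> inH t" for t
    by (simp_all add: e_def m inH_eq inK_commute)
  have "inH t \<cdot> m \<cdot> inH (- t) = m \<cdot> (inH t \<cdot> inH (- t))" by (simp add: comm mulA_assoc)
  then have tmt: "inH t \<cdot> m \<cdot> inH (- t) = m" by (simp add: in_mult(5) oneA_eq(2)[symmetric])
  have "gel t u \<cdot> m \<cdot> gel (- t) u' =
    m + inH t \<cdot> m \<cdot> inJ u' + inJ u \<cdot> m \<cdot> inH (- t) + inJ u \<cdot> m \<cdot> inJ u'"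
    by (simp add: gel_def mulA_distrib tmt algebra_simps)
  also have "inJ u \<cdot> m \<cdot> inJ u' = gel t u \<cdot> m \<cdot> inJ u' - inH t \<cdot> m \<cdot> inJ u'"
    by (simp add: gel_def mulA_distrib)
  finally have "gel t u \<cdot> m \<cdot> gel (- t) u' = m + inJ u \<cdot> m \<cdot> inH (- t) + gel t u \<cdot> m \<cdot> inJ u'"
    by simp
  then have "\<eta> (snd (gel t u \<cdot> m \<cdot> gel (- t) u')) =
    \<eta> (snd (inJ u \<cdot> m \<cdot> inH (- t))) + \<eta> (snd (gel t u \<cdot> m \<cdot> inJ u'))"
    by (simp add: m DualD[OF \<eta>])
  also have "\<eta> (snd (inJ u \<cdot> m \<cdot> inH (- t))) = 0"
    by (rule vanish_right[OF \<eta> tw]) (simp_all add: fst_mulA mulA_assoc comm, simp add: mulA_assoc[symmetric] em)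
  also have "\<eta> (snd (gel t u \<cdot> m \<cdot> inJ u')) = 0"
  proof -
    define X where "X = m \<cdot> inJ u' \<cdot> gel t u"
    have X: "inJ (snd X) = X" by (simp add: X_def inJ_snd fst_mulA)
    have "gel t u \<cdot> gel (- t) u' = oneA"
      using inv by (metis gel_inverse mulA_assoc mulA_one)
    then have "gel t u \<cdot> m \<cdot> inJ u' = gel t u \<cdot> X \<cdot> gel (- t) u'"
      by (simp add: X_def mulA_assoc)
    then have "\<eta> (snd (gel t u \<cdot> m \<cdot> inJ u')) = twist \<eta> (gel t u) (gel (- t) u') (snd X)"
      by (simp add: twist_def X)
    also have "\<dots> = \<eta> (snd (X \<cdot> b))" by (simp add: b[symmetric] twist_def X)
    also have "\<dots> = 0"
      by (rule vanish_left[OF \<eta> tw]) (simp_all add: X_def fst_mulA mulA_assoc[symmetric] em)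
    finally show ?thesis .
  qed
  finally show ?thesis by (simp add: m_def)
qed

end

section \<open>Linear characters of the label groups\<close>

lemma induced_character_eq:
  assumes "finite (carrier G)" "g \<in> carrier G"
  shows "induced_character G Q \<xi> g =
    (\<Sum>y\<in>carrier G. if inv\<^bsub>G\<^esub> y \<otimes>\<^bsub>G\<^esub> g \<otimes>\<^bsub>G\<^esub> y \<in> Q then \<xi> (inv\<^bsub>G\<^esub> y \<otimes>\<^bsub>G\<^esub> g \<otimes>\<^bsub>G\<^esub> y) else 0) / of_nat (card Q)"
  using assms by (simp add: induced_character_def sum.inter_filter)

context triangular_type_character
begin

lemma dualD:
  assumes "subgroup_data H' J'" "\<mu> \<in> dual (inJ ` J')" "x \<in> inJ ` J'" "y \<in> inJ ` J'"
  shows "\<mu> (x + y) = \<mu> x + \<mu> y" "\<mu> 0 = 0" "\<mu> (x - y) = \<mu> x - \<mu> y"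
proof -
  have T: "tri_data oneA (inH ` H') (inJ ` J')" by (rule tri_data_subgroup[OF assms(1)])
  have add: "\<mu> (x + y) = \<mu> x + \<mu> y" if "x \<in> inJ ` J'" "y \<in> inJ ` J'" for x y
    using assms(2) that unfolding dual_def by blast
  show "\<mu> (x + y) = \<mu> x + \<mu> y" by (rule add[OF assms(3,4)])
  show "\<mu> 0 = 0" using add[OF tri_dataD(3)[OF T] tri_dataD(3)[OF T]] by (metis add_cancel_left_left add_0)
  have "x - y \<in> inJ ` J'" using T assms(3,4) unfolding tri_data_def by blast
  from add[OF this assms(4)] show "\<mu> (x - y) = \<mu> x - \<mu> y" by simp
qed

text \<open>Peirce decomposition of \<open>x\<close> with respect to \<open>f\<close> and
  \<open>1 - f\<close>, where the form vanishes on three of the four pieces.\<close>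

lemma corner_dual_sandwich:
  assumes sd: "subgroup_data H' J'" and f: "f \<in> idempotents (inH ` H')"
    and \<mu>: "\<mu> \<in> corner_dual oneA (inJ ` J') f" and x: "x \<in> inJ ` J'"
  shows "\<mu> (f \<cdot> x \<cdot> f) = \<mu> x"
proof -
  have T: "tri_data oneA (inH ` H') (inJ ` J')" by (rule tri_data_subgroup[OF sd])
  have diff: "a - b \<in> inJ ` J'" if "a \<in> inJ ` J'" "b \<in> inJ ` J'" for a b
    using T that unfolding tri_data_def by blast
  have fI: "f \<cdot> a \<in> inJ ` J'" "a \<cdot> f \<in> inJ ` J'" if "a \<in> inJ ` J'" for a
    using span_act[OF sd] f that unfolding idempotents_def by blast+
  have d: "\<mu> \<in> dual (inJ ` J')" using \<mu> by (simp add: corner_dual_def)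
  have z: "\<mu> (f \<cdot> x \<cdot> (oneA - f)) = 0" "\<mu> ((oneA - f) \<cdot> x \<cdot> f) = 0"
    "\<mu> ((oneA - f) \<cdot> x \<cdot> (oneA - f)) = 0"
    using \<mu> x unfolding corner_dual_def by blast+
  have "\<mu> (f \<cdot> x) = \<mu> (f \<cdot> x \<cdot> f)"
    using z(1) dualD(3)[OF sd d, of "f \<cdot> x" "f \<cdot> x \<cdot> f"] fI x by (simp add: mulA_diff)
  moreover have "\<mu> (x \<cdot> f) = \<mu> (f \<cdot> x \<cdot> f)"
    using z(2) dualD(3)[OF sd d, of "x \<cdot> f" "f \<cdot> x \<cdot> f"] fI x by (simp add: mulA_diff)
  moreover have "(oneA - f) \<cdot> x \<cdot> (oneA - f) = (x - f \<cdot> x) - (x \<cdot> f - f \<cdot> x \<cdot> f)"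
    by (simp add: mulA_diff)
  then have "\<mu> x - \<mu> (f \<cdot> x) - (\<mu> (x \<cdot> f) - \<mu> (f \<cdot> x \<cdot> f)) = 0"
    using z(3) by (simp add: dualD(3)[OF sd d] fI x diff)
  ultimately show ?thesis by simp
qed

lemma xi_eq:
  assumes "h \<in> range inK" "x \<in> range inJ"
  shows "xi \<epsilon> \<theta> \<mu> (h + x) = \<theta> h * \<epsilon> (\<mu> x)"
proof -
  obtain z where "h = inK z" using assms(1) by auto
  moreover obtain y where "x = inJ y" using assms(2) by auto
  ultimately show ?thesis by (simp add: xi_def inK_def inJ_def)
qed

text \<open>As \<open>\<mu>\<close> only sees \<open>f x f\<close>, elements fixing \<open>f\<close>
  act trivially under \<open>\<mu>\<close>: the cross terms contribute \<open>\<mu> x'\<close> and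
  \<open>\<mu> x\<close>, and \<open>x \<cdot> x'\<close> contributes 0 since \<open>x\<close> is in
  the right annihilator. Applied to the full group and to the subgroup.\<close>

lemma label_group_mult:
  assumes sd: "subgroup_data H' J'" and f: "f \<in> idempotents (inH ` H')"
    and \<mu>: "\<mu> \<in> corner_dual oneA (inJ ` J') f"
    and \<theta>: "\<theta> \<in> linear_characters (fixing (inH ` H') f)"
    and g: "g \<in> label_group (inH ` H') (inJ ` J') f \<mu>"
    and g': "g' \<in> label_group (inH ` H') (inJ ` J') f \<mu>"
  shows "g \<cdot> g' \<in> label_group (inH ` H') (inJ ` J') f \<mu>"
    "xi \<epsilon> \<theta> \<mu> (g \<cdot> g') = xi \<epsilon> \<theta> \<mu> g * xi \<epsilon> \<theta> \<mu> g'" "xi \<epsilon> \<theta> \<mu> g \<noteq> 0"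
proof -
  let ?S = "inH ` H'" and ?I = "inJ ` J'"
  have T: "tri_data oneA ?S ?I" by (rule tri_data_subgroup[OF sd])
  note D = tri_dataD(1-6,8-13)[OF T]
  have d: "\<mu> \<in> dual ?I" using \<mu> by (simp add: corner_dual_def)
  note sand = corner_dual_sandwich[OF sd f \<mu>]
  have SK: "?S \<subseteq> range inK" by (auto simp: inH_eq)
  obtain w where w: "f = inK w" using f idempotents_subset idempotents_H by blast
  obtain h x where h: "h \<in> ?S" "h \<cdot> f = f" "x \<in> ?I" "\<forall>y\<in>?I. \<mu> (x \<cdot> y) = 0" "g = h + x"
    using g unfolding label_group_def fixing_def J_right_def by blast
  obtain h' x' where h': "h' \<in> ?S" "h' \<cdot> f = f" "x' \<in> ?I" "\<forall>y\<in>?I. \<mu> (x' \<cdot> y) = 0" "g' = h' + x'"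
    using g' unfolding label_group_def fixing_def J_right_def by blast
  have fh: "f \<cdot> h = f" "f \<cdot> h' = f"
  proof -
    have "f \<cdot> a = a \<cdot> f" if "a \<in> ?S" for a
      using that unfolding w by (auto simp only: inH_eq inK_commute[of w])
    then show "f \<cdot> h = f" "f \<cdot> h' = f" using h(1,2) h'(1,2) by simp_all
  qed
  have left: "\<mu> (h \<cdot> y) = \<mu> y" if "y \<in> ?I" for y
  proof -
    have "\<mu> (h \<cdot> y) = \<mu> (f \<cdot> (h \<cdot> y) \<cdot> f)" by (rule sand[symmetric]) (use D h that in simp)
    also have "f \<cdot> (h \<cdot> y) \<cdot> f = f \<cdot> y \<cdot> f" by (metis mulA_assoc fh(1))
    also have "\<mu> \<dots> = \<mu> y" by (rule sand[OF that])
    finally show ?thesis .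
  qed
  have right: "\<mu> (y \<cdot> h') = \<mu> y" if "y \<in> ?I" for y
  proof -
    have "\<mu> (y \<cdot> h') = \<mu> (f \<cdot> (y \<cdot> h') \<cdot> f)" by (rule sand[symmetric]) (use D h' that in simp)
    also have "f \<cdot> (y \<cdot> h') \<cdot> f = f \<cdot> y \<cdot> f" by (metis mulA_assoc h'(2))
    also have "\<mu> \<dots> = \<mu> y" by (rule sand[OF that])
    finally show ?thesis .
  qed
  let ?X = "h \<cdot> x' + x \<cdot> h' + x \<cdot> x'"
  have gg: "g \<cdot> g' = h \<cdot> h' + ?X" by (simp add: h(5) h'(5) mulA_distrib algebra_simps)
  have I: "h \<cdot> x' \<in> ?I" "x \<cdot> h' \<in> ?I" "x \<cdot> x' \<in> ?I" "?X \<in> ?I"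
    using D h h' by simp_all
  have "\<mu> (?X \<cdot> y) = 0" if y: "y \<in> ?I" for y
  proof -
    have "\<mu> (?X \<cdot> y) = \<mu> (h \<cdot> (x' \<cdot> y)) + \<mu> (x \<cdot> (h' \<cdot> y)) + \<mu> (x \<cdot> (x' \<cdot> y))"
      using D h h' y by (simp add: mulA_distrib mulA_assoc dualD(1)[OF sd d])
    also have "\<dots> = 0" using left[of "x' \<cdot> y"] D h(1,3) h'(1,3) y bspec[OF h(4)] bspec[OF h'(4)] by simp
    finally show ?thesis .
  qed
  moreover have hh: "h \<cdot> h' \<in> fixing ?S f"
    using D h h' by (simp add: fixing_def mulA_assoc)
  ultimately show "g \<cdot> g' \<in> label_group ?S ?I f \<mu>"
    unfolding gg label_group_def J_right_def using I(4) by blast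
  have xx: "\<mu> (x \<cdot> x') = 0" using h(4) h'(3) by blast
  have "h \<cdot> x' + x \<cdot> h' \<in> ?I" using I D(7) by blast
  then have "\<mu> ?X = \<mu> x + \<mu> x'"
    using I left[OF h'(3)] right[OF h(3)] xx by (simp add: dualD(1)[OF sd d])
  moreover have "\<theta> (h \<cdot> h') = \<theta> h * \<theta> h'" "\<theta> h \<noteq> 0"
    using \<theta> h(1,2) h'(1,2) unfolding linear_characters_def fixing_def by blast+
  moreover have "xi \<epsilon> \<theta> \<mu> (g \<cdot> g') = \<theta> (h \<cdot> h') * \<epsilon> (\<mu> ?X)"
    unfolding gg by (rule xi_eq) (use hh SK I(4) in \<open>auto simp: fixing_def\<close>)
  moreover have "xi \<epsilon> \<theta> \<mu> g = \<theta> h * \<epsilon> (\<mu> x)" "xi \<epsilon> \<theta> \<mu> g' = \<theta> h' * \<epsilon> (\<mu> x')"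
    unfolding h(5) h'(5) by (rule xi_eq; use h h' SK in auto)+
  ultimately show "xi \<epsilon> \<theta> \<mu> (g \<cdot> g') = xi \<epsilon> \<theta> \<mu> g * xi \<epsilon> \<theta> \<mu> g'" "xi \<epsilon> \<theta> \<mu> g \<noteq> 0"
    by (simp_all add: eps_add)
qed

definition form_ext :: "('j \<Rightarrow> 'k) \<Rightarrow> ('h, 'k, 'j) alg \<Rightarrow> 'k" where
  "form_ext \<eta> = (\<lambda>a\<in>range inJ. \<eta> (snd a))"

lemma form_ext_inJ [simp]: "form_ext \<eta> (inJ x) = \<eta> x"
  by (simp add: form_ext_def)

lemma form_ext_eq: "fst a = 0 \<Longrightarrow> form_ext \<eta> a = \<eta> (snd a)"
  by (simp add: form_ext_def range_inJ)

lemma form_ext_dual: "\<eta> \<in> Dual \<Longrightarrow> form_ext \<eta> \<in> dual (range inJ)"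
  unfolding dual_def
  by (auto simp: in_add inJ_scale[symmetric] DualD) (auto simp: form_ext_def)

lemma form_ext_corner_dual:
  assumes z: "z * z = z" and \<eta>: "\<eta> \<in> Dual" and tw: "twist \<eta> (inK z) (inK z) = \<eta>"
  shows "form_ext \<eta> \<in> corner_dual oneA (range inJ) (inK z)"
proof -
  have ee: "inK z \<cdot> inK z = inK z" by (simp add: in_mult z)
  then have e0: "inK z \<cdot> (oneA - inK z) = 0" "(oneA - inK z) \<cdot> inK z = 0" by (simp_all add: mulA_diff)
  have "form_ext \<eta> (inK z \<cdot> inJ x \<cdot> (oneA - inK z)) = 0" for x
    unfolding form_ext_eq[OF fst_inJ_mult]
    by (rule vanish_right[OF \<eta> tw]) (simp_all add: fst_mulA mulA_assoc e0)
  moreover have "form_ext \<eta> ((oneA - inK z) \<cdot> inJ x \<cdot> inK z) = 0"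
    "form_ext \<eta> ((oneA - inK z) \<cdot> inJ x \<cdot> (oneA - inK z)) = 0" for x
    unfolding form_ext_eq[OF fst_inJ_mult]
    by (rule vanish_left[OF \<eta> tw]; simp add: fst_mulA mulA_assoc[symmetric] e0)+
  ultimately show ?thesis using form_ext_dual[OF \<eta>] by (auto simp: corner_dual_def)
qed

definition lgroup :: "('h, 'k) poly_mapping \<Rightarrow> ('j \<Rightarrow> 'k) \<Rightarrow> ('h, 'k, 'j) alg set" where
  "lgroup z \<eta> = label_group (range inH) (range inJ) (inK z) (form_ext \<eta>)"

lemma gel_in_lgroup:
  "gel h x \<in> lgroup z \<eta> \<longleftrightarrow> Poly_Mapping.single h 1 * z = z \<and> (\<forall>v. \<eta> (x * v) = 0)"
proof
  assume "gel h x \<in> lgroup z \<eta>"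
  then obtain h' x' where *: "gel h x = inH h' + inJ x'" "inH h' \<cdot> inK z = inK z"
    "\<forall>y\<in>range inJ. form_ext \<eta> (inJ x' \<cdot> y) = 0"
    unfolding lgroup_def label_group_def fixing_def J_right_def by blast
  then have "h' = h" "x' = x" using gel_inject by (simp_all add: gel_def[symmetric])
  with * show "Poly_Mapping.single h 1 * z = z \<and> (\<forall>v. \<eta> (x * v) = 0)"
    by (auto simp: inH_eq in_mult)
next
  assume "Poly_Mapping.single h 1 * z = z \<and> (\<forall>v. \<eta> (x * v) = 0)"
  then have "inH h \<in> fixing (range inH) (inK z)" "inJ x \<in> J_right (range inJ) (form_ext \<eta>)"
    unfolding fixing_def J_right_def by (auto simp: inH_eq in_mult)
  then show "gel h x \<in> lgroup z \<eta>"
    unfolding lgroup_def label_group_def gel_def by blast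
qed

lemma lgroup_subset: "lgroup z \<eta> \<subseteq> carrier Gr"
  unfolding lgroup_def label_group_def fixing_def J_right_def carrier_tri_group by blast

lemma card_lgroup:
  assumes "\<eta> \<in> Dual"
  shows "card (lgroup z \<eta>) > 0"
proof -
  have "gel 0 0 \<in> lgroup z \<eta>" unfolding gel_in_lgroup by (simp add: DualD[OF assms])
  then show ?thesis using finite_alg card_gt_0_iff by blast
qed

definition xi0 where
  "xi0 z \<theta> \<eta> g = (if g \<in> lgroup z \<eta> then xi \<epsilon> \<theta> (form_ext \<eta>) g else 0)"

text \<open>The average of \<open>\<epsilon> (\<eta> (x * v))\<close> over \<open>v\<close> detects
  the right annihilator, so \<open>\<xi>\<close> extended by zero becomes an average of additive
  characters over the twists of \<open>\<eta>\<close> by \<open>1 + v\<close>.\<close>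

lemma xi0_gel:
  assumes \<eta>: "\<eta> \<in> Dual"
  shows "xi0 z \<theta> \<eta> (gel h x) = (if Poly_Mapping.single h 1 * z = z
    then \<theta> (inH h) * (\<Sum>v\<in>UNIV. \<epsilon> (twist \<eta> oneA (gel 0 v) x)) / of_nat CARD('j) else 0)"
proof (cases "Poly_Mapping.single h (1::'k) * z = z")
  case True
  have "twist \<eta> oneA (gel 0 v) x = \<eta> x + \<eta> (x * v)" for v
    by (simp add: twist_def gel_def oneA_eq(2)[symmetric] mulA_distrib in_mult DualD[OF \<eta>])
  then have "(\<Sum>v\<in>UNIV. \<epsilon> (twist \<eta> oneA (gel 0 v) x)) = \<epsilon> (\<eta> x) * (\<Sum>v\<in>UNIV. \<epsilon> (\<eta> (x * v)))"
    by (simp add: eps_add sum_distrib_left)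
  moreover have "(\<lambda>v. \<eta> (x * v)) \<in> Dual"
    using twist_Dual[OF \<eta>, of "inJ x" oneA] by (simp add: twist_def[abs_def] in_mult)
  moreover have "xi \<epsilon> \<theta> (form_ext \<eta>) (gel h x) = \<theta> (inH h) * \<epsilon> (\<eta> x)"
    unfolding gel_def by (subst xi_eq) (auto simp: inH_eq)
  ultimately show ?thesis using True card_J_nz by (auto simp: xi0_def gel_in_lgroup sum_eps)
qed (simp add: xi0_def gel_in_lgroup)

text \<open>By orthogonality each additive character in \<open>xi0_gel\<close> contributes only at
  its own form, so the transform counts.\<close>

lemma FT_xi0:
  assumes \<eta>: "\<eta> \<in> Dual" and \<nu>: "\<nu> \<in> Dual"
  shows "FT (xi0 z \<theta> \<eta>) h \<nu> = (if Poly_Mapping.single h 1 * z = z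
    then \<theta> (inH h) * of_nat (card {v. twist \<eta> oneA (gel 0 v) = \<nu>}) else 0)"
proof (cases "Poly_Mapping.single h (1::'k) * z = z")
  case True
  have "FT (xi0 z \<theta> \<eta>) h \<nu> =
    \<theta> (inH h) / of_nat CARD('j) * (\<Sum>x\<in>UNIV. \<Sum>v\<in>UNIV. \<epsilon> (twist \<eta> oneA (gel 0 v) x - \<nu> x))"
    using True unfolding FT_def xi0_gel[OF \<eta>]
    by (simp add: sum_distrib_left sum_distrib_right sum_divide_distrib eps_add[of _ "- _", simplified] mult_ac)
  also have "(\<Sum>x\<in>UNIV. \<Sum>v\<in>UNIV. \<epsilon> (twist \<eta> oneA (gel 0 v) x - \<nu> x)) =
    (\<Sum>v\<in>UNIV. \<Sum>x\<in>UNIV. \<epsilon> (twist \<eta> oneA (gel 0 v) x - \<nu> x))" by (rule sum.swap)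
  also have "\<dots> = (\<Sum>v\<in>UNIV. if twist \<eta> oneA (gel 0 v) = \<nu> then of_nat CARD('j) else 0)"
  proof (intro sum.cong refl)
    fix v
    have "(\<lambda>x. twist \<eta> oneA (gel 0 v) x - \<nu> x) \<in> Dual" by (intro Dual_diff twist_Dual \<eta> \<nu>)
    from sum_eps[OF this]
    show "(\<Sum>x\<in>UNIV. \<epsilon> (twist \<eta> oneA (gel 0 v) x - \<nu> x)) =
      (if twist \<eta> oneA (gel 0 v) = \<nu> then of_nat CARD('j) else 0)" by (simp add: fun_eq_iff)
  qed
  also have "\<dots> = of_nat CARD('j) * of_nat (card {v. twist \<eta> oneA (gel 0 v) = \<nu>})"
    using finite_J by (simp add: sum.If_cases)
  finally show ?thesis using True card_J_nz by simp
qed (simp add: FT_def xi0_gel[OF \<eta>])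

text \<open>The shift reindexes the average in \<open>xi0_gel\<close>, \<open>1 + w\<close> becoming
  \<open>(1 + v)(1 + w)\<close>. The extra term \<open>(h - 1) v\<close> is invisible to
  \<open>\<eta>\<close>, because \<open>z\<close> annihilates \<open>h - 1\<close>.\<close>

lemma xi0_right:
  assumes \<eta>: "\<eta> \<in> Dual" and tw: "twist \<eta> (inK z) (inK z) = \<eta>"
  shows "xi0 z \<theta> \<eta> (oneA + (gel h x - oneA) \<cdot> gel 0 v) = xi0 z \<theta> \<eta> (gel h x)"
proof (cases "Poly_Mapping.single h (1::'k) * z = z")
  case True
  let ?m = "inK (Poly_Mapping.single h 1 - 1)"
  have em: "inK z \<cdot> ?m = 0"
    using True by (simp add: in_mult algebra_simps mult.commute) (simp add: inK_def zero_prod_def)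
  define x' where "x' = snd ((gel h x - oneA) \<cdot> gel 0 v)"
  have 1: "oneA + (gel h x - oneA) \<cdot> gel 0 v = gel h x'"
    using act_gel[of 0 0 h x v] by (simp add: x'_def)
  have "inJ x' = gel h x' - oneA - ?m" unfolding gel_minus_one by simp
  also have "\<dots> = (gel h x - oneA) \<cdot> gel 0 v - ?m" by (simp add: 1[symmetric])
  also have "\<dots> = inJ x \<cdot> gel 0 v + ?m \<cdot> inJ v"
    unfolding gel_minus_one by (simp add: gel_def oneA_eq(2)[symmetric] mulA_distrib)
  finally have x': "inJ x' = inJ x \<cdot> gel 0 v + ?m \<cdot> inJ v" .
  have tw': "twist \<eta> oneA (gel 0 w) x' = twist \<eta> oneA (gel 0 (v + w + v * w)) x" for w
  proof -
    have "\<eta> (snd (?m \<cdot> inJ v \<cdot> gel 0 w)) = 0"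
      by (rule vanish_left[OF \<eta> tw]) (simp_all add: fst_mulA mulA_assoc[symmetric] em)
    moreover have "gel 0 v \<cdot> gel 0 w = gel 0 (v + w + v * w)"
      by (simp add: gel_mult lact_one ract_one algebra_simps)
    ultimately show ?thesis
      by (simp add: twist_def x' mulA_distrib DualD[OF \<eta>]) (simp add: mulA_assoc)
  qed
  have "bij (\<lambda>w. v + w + v * w)"
  proof -
    obtain v' where "gel (- 0) v' \<cdot> gel 0 v = oneA" using gel_inverse by metis
    then have v': "gel 0 v' \<cdot> (gel 0 v \<cdot> a) = a" for a by (simp add: mulA_assoc[symmetric])
    have "inj (\<lambda>w. v + w + v * w)"
    proof (rule injI)
      fix w w' assume "v + w + v * w = v + w' + v * w'"
      then have "gel 0 v \<cdot> gel 0 w = gel 0 v \<cdot> gel 0 w'"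
        by (simp add: gel_mult lact_one ract_one algebra_simps)
      then have "gel 0 w = gel 0 w'" using v'[of "gel 0 w"] v'[of "gel 0 w'"] by metis
      then show "w = w'" by simp
    qed
    then show ?thesis by (simp add: bij_def finite_UNIV_inj_surj finite_J)
  qed
  from sum.reindex_bij_betw[OF this, of "\<lambda>w. \<epsilon> (twist \<eta> oneA (gel 0 w) x)"]
  show ?thesis unfolding 1 xi0_gel[OF \<eta>] tw' by simp
next
  case False
  have "oneA + (gel h x - oneA) \<cdot> gel 0 v = gel h (snd ((gel h x - oneA) \<cdot> gel 0 v))"
    using act_gel[of 0 0 h x v] by simp
  then show ?thesis using False by (simp add: xi0_gel[OF \<eta>])
qed

subsection \<open>The Fourier transform of a supercharacter\<close>

definition chi where
  "chi z \<theta> \<eta> = supercharacter \<epsilon> oneA (range inH) (range inJ) (inK z) \<theta> (form_ext \<eta>)"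

lemma chi_eq:
  assumes "g \<in> carrier Gr"
  shows "chi z \<theta> \<eta> g =
    (\<Sum>y\<in>carrier Gr. xi0 z \<theta> \<eta> (inv\<^bsub>Gr\<^esub> y \<cdot> g \<cdot> y)) / of_nat (card (lgroup z \<eta>))"
  unfolding chi_def supercharacter_def
  by (subst induced_character_eq[OF finite_Gr assms]) (simp add: xi0_def lgroup_def cong: if_cong)

text \<open>Conjugating by \<open>y k\<close> instead of \<open>k\<close> removes the left factor
  \<open>y\<close> of the action and turns the right factor \<open>w\<close> into
  \<open>k\<inverse> w y k\<close>, an element of \<open>N\<close>, to which
  \<open>xi0_right\<close> applies.\<close>

lemma chi_superclass:
  assumes \<eta>: "\<eta> \<in> Dual" and tw: "twist \<eta> (inK z) (inK z) = \<eta>"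
  shows "superclass_function (chi z \<theta> \<eta>)"
  unfolding superclass_function_def
proof (intro allI)
  fix t u v h x
  let ?y = "gel t u" and ?w = "gel (- t) v" and ?g = "gel h x"
  have conj: "xi0 z \<theta> \<eta> (inv\<^bsub>Gr\<^esub> (?y \<cdot> k) \<cdot> (oneA + ?y \<cdot> (?g - oneA) \<cdot> ?w) \<cdot> (?y \<cdot> k)) =
    xi0 z \<theta> \<eta> (inv\<^bsub>Gr\<^esub> k \<cdot> ?g \<cdot> k)" if "k \<in> carrier Gr" for k
  proof -
    obtain a b where k: "k = gel a b" using \<open>k \<in> carrier Gr\<close> carrier_Gr by blast
    obtain b' where k': "inv\<^bsub>Gr\<^esub> k = gel (- a) b'" "gel (- a) b' \<cdot> k = oneA"
      using gel_inverse[of a b] unfolding k by metis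
    obtain u' where y': "inv\<^bsub>Gr\<^esub> ?y = gel (- t) u'" "gel (- t) u' \<cdot> ?y = oneA"
      using gel_inverse[of t u] by metis
    have inv: "inv\<^bsub>Gr\<^esub> (?y \<cdot> k) = gel (- a) b' \<cdot> gel (- t) u'"
      using Gr.inv_mult_group[OF gel_in_Gr \<open>k \<in> carrier Gr\<close>, of t u] k' y' by simp
    have yk: "gel (- t) u' \<cdot> (?y \<cdot> c) = c" "gel (- a) b' \<cdot> (k \<cdot> c) = c" for c
      using y'(2) k'(2) by (simp_all add: mulA_assoc[symmetric])
    have kk: "k \<cdot> (gel (- a) b' \<cdot> c) = c" for c
      using k' Gr.r_inv[OF \<open>k \<in> carrier Gr\<close>] by (simp add: mulA_assoc[symmetric])
    obtain c where c: "gel (- a) b' \<cdot> (?w \<cdot> ?y) \<cdot> k = gel 0 c"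
      unfolding k gel_mult by simp
    obtain x' where x': "gel (- a) b' \<cdot> ?g \<cdot> k = gel h x'"
      unfolding k gel_mult by simp
    have "inv\<^bsub>Gr\<^esub> (?y \<cdot> k) \<cdot> (oneA + ?y \<cdot> (?g - oneA) \<cdot> ?w) \<cdot> (?y \<cdot> k) =
      oneA + gel (- a) b' \<cdot> (?g - oneA) \<cdot> (?w \<cdot> ?y) \<cdot> k"
      unfolding inv mulA_distrib by (simp add: mulA_assoc yk k')
    also have "gel (- a) b' \<cdot> (?g - oneA) \<cdot> (?w \<cdot> ?y) \<cdot> k =
      (gel (- a) b' \<cdot> (?g - oneA) \<cdot> k) \<cdot> (gel (- a) b' \<cdot> (?w \<cdot> ?y) \<cdot> k)"
      by (simp add: mulA_assoc kk)
    also have "gel (- a) b' \<cdot> (?g - oneA) \<cdot> k = gel h x' - oneA"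
      by (simp add: mulA_diff x' k')
    finally show ?thesis unfolding c k'(1) x' by (simp add: xi0_right[OF \<eta> tw])
  qed
  have bij: "bij_betw (\<lambda>k. ?y \<cdot> k) (carrier Gr) (carrier Gr)"
  proof -
    have "inj_on (\<lambda>k. ?y \<cdot> k) (carrier Gr)" using Gr.inj_on_cmult[OF gel_in_Gr, of t u] by simp
    moreover have "(\<lambda>k. ?y \<cdot> k) ` carrier Gr = carrier Gr"
      using Gr.surj_const_mult[OF gel_in_Gr, of t u] by simp
    ultimately show ?thesis by (simp add: bij_betw_def)
  qed
  have G: "oneA + ?y \<cdot> (?g - oneA) \<cdot> ?w \<in> carrier Gr" unfolding act_gel by simp
  show "chi z \<theta> \<eta> (oneA + ?y \<cdot> (?g - oneA) \<cdot> ?w) = chi z \<theta> \<eta> ?g"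
    unfolding chi_eq[OF G] chi_eq[OF gel_in_Gr]
    by (subst sum.reindex_bij_betw[OF bij, symmetric]) (simp add: conj)
qed

text \<open>Substitute along the conjugation in each summand of the induced character:
  \<open>h - 1\<close> leaves a phase and \<open>x\<close> a twisted form.\<close>

lemma FT_chi:
  assumes \<eta>: "\<eta> \<in> Dual" and \<mu>: "\<mu> \<in> Dual"
  shows "FT (chi z \<theta> \<eta>) h \<mu> =
    (\<Sum>y\<in>carrier Gr. \<epsilon> (- \<mu> (snd (y \<cdot> (inH h - oneA) \<cdot> inv\<^bsub>Gr\<^esub> y))) *
      FT (xi0 z \<theta> \<eta>) h (twist \<mu> y (inv\<^bsub>Gr\<^esub> y))) / of_nat (card (lgroup z \<eta>))"
proof -
  have "(\<Sum>x\<in>UNIV. xi0 z \<theta> \<eta> (inv\<^bsub>Gr\<^esub> y \<cdot> gel h x \<cdot> y) * \<epsilon> (- \<mu> x)) =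
    \<epsilon> (- \<mu> (snd (y \<cdot> (inH h - oneA) \<cdot> inv\<^bsub>Gr\<^esub> y))) * FT (xi0 z \<theta> \<eta>) h (twist \<mu> y (inv\<^bsub>Gr\<^esub> y))"
    if "y \<in> carrier Gr" for y
  proof -
    obtain t u where y: "y = gel t u" using \<open>y \<in> carrier Gr\<close> carrier_Gr by blast
    obtain u' where y': "inv\<^bsub>Gr\<^esub> y = gel (- t) u'" "gel (- t) u' \<cdot> gel t u = oneA" "gel t u \<cdot> gel (- t) u' = oneA"
      using gel_inverse[of t u] unfolding y by metis
    let ?A = "\<lambda>x. snd (gel t u \<cdot> (gel h x - oneA) \<cdot> gel (- t) u')"
    have A: "gel (- t) u' \<cdot> gel h (?A x) \<cdot> gel t u = gel h x" for x
    proof -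
      have "gel (- t) u' \<cdot> gel h (?A x) \<cdot> gel t u =
        gel (- t) u' \<cdot> gel t u + (gel (- t) u' \<cdot> gel t u) \<cdot> (gel h x - oneA) \<cdot> (gel (- t) u' \<cdot> gel t u)"
        unfolding act_gel[symmetric] mulA_distrib by (simp add: mulA_assoc)
      then show ?thesis by (simp add: y')
    qed
    have "(\<Sum>x\<in>UNIV. xi0 z \<theta> \<eta> (gel (- t) u' \<cdot> gel h x \<cdot> gel t u) * \<epsilon> (- \<mu> x)) =
      (\<Sum>x\<in>UNIV. xi0 z \<theta> \<eta> (gel h x) * \<epsilon> (- \<mu> (?A x)))"
      by (subst sum.reindex_bij_betw[OF gel_sandwich_bij[of t u h u'], symmetric]) (simp only: A)
    moreover have "?A x = snd (gel t u \<cdot> (inH h - oneA) \<cdot> gel (- t) u') + snd (gel t u \<cdot> inJ x \<cdot> gel (- t) u')" for x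
      by (simp add: gel_def[of h] mulA_ring)
    ultimately show ?thesis
      unfolding y'(1) unfolding y
      by (simp add: FT_def DualD[OF \<mu>] twist_def eps_add[of "- _" "- _", simplified] sum_distrib_left mult_ac)
  qed
  then show ?thesis
    unfolding FT_def[of "chi z \<theta> \<eta>"] chi_eq[OF gel_in_Gr] times_divide_eq_left sum_distrib_right
      sum_divide_distrib[symmetric]
    by (subst sum.swap) (simp)
qed

text \<open>A summand survives only if the conjugate of \<open>\<mu>\<close> is a twist of
  \<open>\<eta>\<close> by some \<open>1 + v\<close>, which would put \<open>\<mu>\<close> into the
  orbit.\<close>

lemma FT_chi_other:
  assumes \<eta>: "\<eta> \<in> Dual" and \<mu>: "\<mu> \<in> Dual" and "\<mu> \<notin> orb \<eta>"
  shows "FT (chi z \<theta> \<eta>) h \<mu> = 0"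
proof -
  have "FT (xi0 z \<theta> \<eta>) h (twist \<mu> y (inv\<^bsub>Gr\<^esub> y)) = 0" if "y \<in> carrier Gr" for y
  proof -
    obtain t u where y: "y = gel t u" using \<open>y \<in> carrier Gr\<close> carrier_Gr by blast
    obtain u' where y': "inv\<^bsub>Gr\<^esub> y = gel (- t) u'" "gel (- t) u' \<cdot> gel t u = oneA" "gel t u \<cdot> gel (- t) u' = oneA"
      using gel_inverse[of t u] unfolding y by metis
    have "twist \<eta> oneA (gel 0 v) \<noteq> twist \<mu> y (inv\<^bsub>Gr\<^esub> y)" for v
    proof
      assume "twist \<eta> oneA (gel 0 v) = twist \<mu> y (inv\<^bsub>Gr\<^esub> y)"
      then have "twist (twist \<eta> oneA (gel 0 v)) (gel (- t) u') (gel t u) = \<mu>"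
        unfolding y'(1) unfolding y by (simp add: twist_twist y')
      then have "twist \<eta> (gel (- t) u') (gel (- (- t)) u \<cdot> gel 0 v) = \<mu>"
        by (simp add: twist_twist)
      then show False using assms(3) twist_in_orb unfolding gel_mult by (metis add.right_neutral)
    qed
    then show ?thesis by (simp add: FT_xi0[OF \<eta> twist_Dual[OF \<mu>]])
  qed
  then show ?thesis by (simp add: FT_chi[OF \<eta> \<mu>])
qed

text \<open>By \<open>conj_vanish\<close> the surviving summands have phase 1, so the counts from
  \<open>FT_xi0\<close> add up without cancellation. A single \<open>q\<close> serves all
  \<open>\<theta>\<close> and \<open>h\<close>, as Fourier inversion on \<open>H(e)\<close>
  requires.\<close>

lemma FT_chi_self:
  assumes \<eta>: "\<eta> \<in> Dual" and tw: "twist \<eta> (inK z) (inK z) = \<eta>"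
  shows "\<exists>q::rat. q > 0 \<and> (\<forall>\<theta> h. FT (chi z \<theta> \<eta>) h \<eta> =
    (if Poly_Mapping.single h 1 * z = z then of_rat q * \<theta> (inH h) else 0))"
proof -
  define N where "N = (\<Sum>y\<in>carrier Gr. card {v. twist \<eta> oneA (gel 0 v) = twist \<eta> y (inv\<^bsub>Gr\<^esub> y)})"
  have "N > 0"
  proof -
    \<comment> \<open>The pair \<open>y = 1\<close>, \<open>v = 0\<close> makes the count
      positive.\<close>
    have "0 \<in> {v. twist \<eta> oneA (gel 0 v) = twist \<eta> (gel 0 0) (inv\<^bsub>Gr\<^esub> (gel 0 0))}"
      using Gr.inv_one by simp
    moreover have "finite {v. twist \<eta> oneA (gel 0 v) = twist \<eta> (gel 0 0) (inv\<^bsub>Gr\<^esub> (gel 0 0))}"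
      by (rule finite_subset[OF subset_UNIV finite_J])
    ultimately have "card {v. twist \<eta> oneA (gel 0 v) = twist \<eta> (gel 0 0) (inv\<^bsub>Gr\<^esub> (gel 0 0))} > 0"
      by (auto simp only: card_gt_0_iff)
    then show ?thesis
      unfolding N_def by (intro sum_pos2[OF finite_Gr gel_in_Gr[of 0 0]]) auto
  qed
  define q :: rat where "q = of_nat N / of_nat (card (lgroup z \<eta>))"
  have q: "of_rat q = (\<Sum>y\<in>carrier Gr. complex_of_nat (card {v. twist \<eta> oneA (gel 0 v) =
      twist \<eta> y (inv\<^bsub>Gr\<^esub> y)})) / of_nat (card (lgroup z \<eta>))"
    unfolding q_def of_rat_divide of_rat_of_nat_eq unfolding N_def of_nat_sum ..
  have "FT (chi z \<theta> \<eta>) h \<eta> =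
    (if Poly_Mapping.single h 1 * z = z then of_rat q * \<theta> (inH h) else 0)" for \<theta> h
  proof (cases "Poly_Mapping.single h (1::'k) * z = z")
    case True
    have "\<epsilon> (- \<eta> (snd (y \<cdot> (inH h - oneA) \<cdot> inv\<^bsub>Gr\<^esub> y))) *
        FT (xi0 z \<theta> \<eta>) h (twist \<eta> y (inv\<^bsub>Gr\<^esub> y)) =
      \<theta> (inH h) * of_nat (card {v. twist \<eta> oneA (gel 0 v) = twist \<eta> y (inv\<^bsub>Gr\<^esub> y)})"
      if "y \<in> carrier Gr" for y
    proof (cases "\<exists>v. twist \<eta> oneA (gel 0 v) = twist \<eta> y (inv\<^bsub>Gr\<^esub> y)")
      case ex: True
      obtain t u where y: "y = gel t u" using \<open>y \<in> carrier Gr\<close> carrier_Gr by blast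
      obtain u' where y': "inv\<^bsub>Gr\<^esub> y = gel (- t) u'" "gel (- t) u' \<cdot> gel t u = oneA"
        using gel_inverse[of t u] unfolding y by metis
      have "\<eta> (snd (y \<cdot> (inH h - oneA) \<cdot> inv\<^bsub>Gr\<^esub> y)) = 0"
        using ex conj_vanish[OF \<eta> tw True y'(2)] unfolding y'(1) unfolding y by blast
      then show ?thesis using True by (simp add: FT_xi0[OF \<eta> twist_Dual[OF \<eta>]])
    qed (use True in \<open>simp add: FT_xi0[OF \<eta> twist_Dual[OF \<eta>]]\<close>)
    then show ?thesis
      using True by (simp add: FT_chi[OF \<eta> \<eta>] q sum_distrib_left[symmetric] mult.commute)
  qed (simp add: FT_chi[OF \<eta> \<eta>] FT_xi0[OF \<eta> twist_Dual[OF \<eta>]])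
  moreover have "q > 0" using \<open>N > 0\<close> card_lgroup[OF \<eta>] by (simp add: q_def)
  ultimately show ?thesis by blast
qed

end

section \<open>Nonnegative rationals among the complex numbers\<close>

definition nnrat :: "complex set" where
  "nnrat = {of_rat q | q. 0 \<le> q}"

lemma nnrat_of_nat: "of_nat n \<in> nnrat"
  unfolding nnrat_def by (auto intro!: exI[of _ "of_nat n"])

lemma nnrat_0: "0 \<in> nnrat"
  using nnrat_of_nat[of 0] by simp

lemma nnrat_add: "a \<in> nnrat \<Longrightarrow> b \<in> nnrat \<Longrightarrow> a + b \<in> nnrat"
  unfolding nnrat_def by (auto simp: of_rat_add[symmetric])

lemma nnrat_mult: "a \<in> nnrat \<Longrightarrow> b \<in> nnrat \<Longrightarrow> a * b \<in> nnrat"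
  unfolding nnrat_def by (auto simp: of_rat_mult[symmetric])

lemma nnrat_divide: "a \<in> nnrat \<Longrightarrow> b \<in> nnrat \<Longrightarrow> a / b \<in> nnrat"
  unfolding nnrat_def by (auto simp: of_rat_divide[symmetric])

lemma nnrat_sum: "(\<And>x. x \<in> A \<Longrightarrow> f x \<in> nnrat) \<Longrightarrow> sum f A \<in> nnrat"
  by (induction A rule: infinite_finite_induct) (auto simp: nnrat_0 nnrat_add)

context triangular_type_character
begin

abbreviation lin_chars :: "('h, 'k) poly_mapping \<Rightarrow> (('h, 'k, 'j) alg \<Rightarrow> complex) set" where
  "lin_chars z \<equiv> linear_characters (fixing (range inH) (inK z))"

section \<open>Corner orbits and the labels of supercharacters\<close>

lemma corner_J:
  assumes "z * z = z"
  shows "a \<in> corner (inK z) (range inJ) \<longleftrightarrow> fst a = 0 \<and> inK z \<cdot> a = a \<and> a \<cdot> inK z = a"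
proof
  have zz: "inK z \<cdot> inK z = inK z" by (simp add: in_mult assms)
  assume "a \<in> corner (inK z) (range inJ)"
  then obtain x where "a = inK z \<cdot> inJ x \<cdot> inK z" unfolding corner_def by blast
  then show "fst a = 0 \<and> inK z \<cdot> a = a \<and> a \<cdot> inK z = a"
    by (metis fst_inJ_mult mulA_assoc zz)
next
  assume "fst a = 0 \<and> inK z \<cdot> a = a \<and> a \<cdot> inK z = a"
  then show "a \<in> corner (inK z) (range inJ)"
    unfolding corner_def by (intro CollectI exI[of _ a]) (simp add: range_inJ)
qed

text \<open>Lift the corner element \<open>s = f t\<close> to \<open>t\<close> and keep the
  nilpotent part: \<open>t + s x1\<close> commutes with \<open>f\<close>, and its product with
  \<open>f\<close> is \<open>s a\<close>. The other factor is treated alike, so the action on the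
  corner comes from the full group.\<close>

lemma corner_act_lift:
  assumes z: "z * z = z"
    and \<sigma>: "\<sigma> \<in> carrier (triples (inK z) (corner (inK z) (range inH)) (corner (inK z) (range inJ)))"
  obtains t u v where "inK z \<cdot> gel t u = gel t u \<cdot> inK z" "inK z \<cdot> gel (- t) v = gel (- t) v \<cdot> inK z"
    "\<And>x. x \<in> corner (inK z) (range inJ) \<Longrightarrow>
      rho (inK z) (corner (inK z) (range inH)) (corner (inK z) (range inJ)) \<sigma> x =
      gel t u \<cdot> x \<cdot> gel (- t) v"
proof -
  let ?f = "inK z" and ?S = "corner (inK z) (range inH)" and ?I = "corner (inK z) (range inJ)"
  let ?i = "\<lambda>a. inv\<^bsub>tri_group ?f ?S ?I\<^esub> a"
  have T: "tri_data ?f ?S ?I" by (rule tri_data_corner[OF z])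
  have ff: "?f \<cdot> ?f = ?f" by (simp add: in_mult z)
  have fH: "?f \<cdot> inH h = inH h \<cdot> ?f" for h by (simp add: inH_eq inK_commute)
  note I = corner_J[OF z]
  obtain s a b where \<sigma>': "\<sigma> = (s, a, b)" "s \<in> ?S" "a \<in> unip ?f ?I" "b \<in> unip ?f ?I"
    using \<sigma> by (auto simp: triples_def)
  obtain t where t: "s = ?f \<cdot> inH t \<cdot> ?f" using \<sigma>'(2) unfolding corner_def by blast
  then have s: "s = ?f \<cdot> inH t" by (simp add: mulA_assoc fH[symmetric]) (simp add: mulA_assoc[symmetric] ff)
  obtain x1 where x1: "x1 \<in> ?I" "a = ?f + x1" using \<sigma>'(3) by (rule unipE)
  obtain x2 where x2: "x2 \<in> ?I" "?i b = ?f + x2" using tri_inv_unip(1)[OF T \<sigma>'(4)] by (rule unipE)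
  \<comment> \<open>The inverse of \<open>s\<close> in the corner group, namely the compression of
    the inverse of \<open>t\<close>.\<close>
  define k where "k = ?f \<cdot> inH (- t)"
  have "s \<cdot> k = ?f \<cdot> (inH t \<cdot> ?f) \<cdot> inH (- t)" by (simp add: s k_def mulA_assoc)
  also have "\<dots> = (?f \<cdot> ?f) \<cdot> (inH t \<cdot> inH (- t))" by (simp only: fH[symmetric] mulA_assoc)
  also have "\<dots> = ?f" by (simp add: ff in_mult(5) oneA_eq(2)[symmetric])
  finally have sk: "s \<cdot> k = ?f" .
  have fk: "?f \<cdot> k = k" by (simp add: k_def mulA_assoc[symmetric] ff)
  have "k \<cdot> ?f = inH (- t) \<cdot> (?f \<cdot> ?f)" by (simp only: k_def fH mulA_assoc)
  also have "\<dots> = k" by (simp only: ff k_def fH)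
  finally have kf: "k \<cdot> ?f = k" .
  have kH: "inH (- t) \<cdot> ?f = k" by (simp only: k_def fH)
  have "?i s = ?i s \<cdot> (s \<cdot> k)"
    using tri_inv_S(1)[OF T \<sigma>'(2)] tri_dataD(5)[OF T] sk by simp
  also have "\<dots> = k" using tri_inv_S(2)[OF T \<sigma>'(2)] fk by (simp add: mulA_assoc[symmetric])
  finally have inv_s: "?i s = k" .
  have U: "s \<cdot> x1 \<in> ?I" using tri_dataD(10)[OF T \<sigma>'(2) x1(1)] .
  have V: "x2 \<cdot> k \<in> ?I"
    using tri_dataD(11)[OF T tri_inv_S(1)[OF T \<sigma>'(2)] x2(1)] unfolding inv_s .
  define Y where "Y = gel t (snd (s \<cdot> x1))"
  define Y' where "Y' = gel (- t) (snd (x2 \<cdot> k))"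
  have Y: "Y = inH t + s \<cdot> x1" and Y': "Y' = inH (- t) + x2 \<cdot> k"
    using U V unfolding I by (simp_all add: Y_def Y'_def gel_def inJ_snd)
  have fY: "?f \<cdot> Y = Y \<cdot> ?f" "?f \<cdot> Y' = Y' \<cdot> ?f"
    using U V unfolding I Y Y' by (simp_all add: mulA_distrib fH)
  have "s \<cdot> a = ?f \<cdot> Y"
    using U tri_dataD(5)[OF T \<sigma>'(2)] unfolding I Y x1 by (simp add: mulA_distrib s[symmetric])
  moreover have "?i b \<cdot> ?i s = Y' \<cdot> ?f"
    using V kf fk kH unfolding I Y' x2(2) inv_s by (simp add: mulA_distrib)
  ultimately have "rho ?f ?S ?I \<sigma> x = Y \<cdot> x \<cdot> Y'" if "x \<in> ?I" for x
  proof -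
    have "rho ?f ?S ?I \<sigma> x = (s \<cdot> a) \<cdot> x \<cdot> (?i b \<cdot> ?i s)" by (simp add: \<sigma>' mulA_assoc)
    also have "\<dots> = Y \<cdot> (?f \<cdot> x) \<cdot> (?f \<cdot> Y')"
      unfolding \<open>s \<cdot> a = ?f \<cdot> Y\<close> \<open>?i b \<cdot> ?i s = Y' \<cdot> ?f\<close> fY by (simp only: mulA_assoc)
    also have "\<dots> = Y \<cdot> ((?f \<cdot> x) \<cdot> ?f) \<cdot> Y'" by (simp only: mulA_assoc)
    also have "\<dots> = Y \<cdot> x \<cdot> Y'" using that unfolding I by simp
    finally show ?thesis .
  qed
  with fY show ?thesis using that[of t "snd (s \<cdot> x1)" "snd (x2 \<cdot> k)"] by (simp add: Y_def Y'_def)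
qed

text \<open>The point is regularity. If the corner orbit met the dual of a smaller corner,
  \<open>corner_act_lift\<close> would lift that point to a form in \<open>orb \<eta>\<close>
  invariant under compression by a smaller idempotent, against minimality.\<close>

lemma chi_supercharacter:
  assumes m: "minimal_pair z \<eta>" and \<theta>: "\<theta> \<in> lin_chars z"
  shows "chi z \<theta> \<eta> \<in> supercharacters_of \<epsilon> UNIV UNIV"
proof -
  have z: "z * z = z" and \<eta>: "\<eta> \<in> Dual" and tw: "twist \<eta> (inK z) (inK z) = \<eta>"
    using m by (simp_all add: minimal_pair_def)
  let ?f = "inK z" and ?S = "corner (inK z) (range inH)" and ?I = "corner (inK z) (range inJ)"
  have T: "tri_data ?f ?S ?I" by (rule tri_data_corner[OF z])
  note I = corner_J[OF z]
  define \<nu> where "\<nu> = restrict (form_ext \<eta>) ?I"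
  have \<nu>_eq: "\<nu> a = \<eta> (snd a)" if "a \<in> ?I" for a
    using that by (simp add: \<nu>_def I form_ext_eq)
  define \<omega> where "\<omega> = {rho_dual ?f ?S ?I \<tau> \<nu> | \<tau>. \<tau> \<in> carrier (triples ?f ?S ?I)}"
  have "\<nu> \<in> dual ?I"
    unfolding dual_def
  proof (intro CollectI conjI ballI allI)
    show "\<nu> \<in> extensional ?I" by (simp add: \<nu>_def)
    fix x assume x: "x \<in> ?I"
    fix c
    have "scaleA c x \<in> ?I" using x unfolding I by (simp add: scaleA_mult) (simp add: scaleA_eq fst_mulA)
    then show "\<nu> (scaleA c x) = c * \<nu> x" using x by (simp add: \<nu>_eq snd_scaleA DualD[OF \<eta>])
  next
    fix x y assume "x \<in> ?I" "y \<in> ?I"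
    moreover from this have "x + y \<in> ?I" by (rule tri_dataD(8)[OF T])
    ultimately show "\<nu> (x + y) = \<nu> x + \<nu> y" by (simp add: \<nu>_eq DualD[OF \<eta>])
  qed
  then have orbit: "\<omega> \<in> dual_orbits ?f ?S ?I" unfolding \<omega>_def dual_orbits_def by blast
  have regular: "\<omega> \<inter> corner_dual ?f ?I g = {}" if g: "g \<in> idempotents ?S" "g \<noteq> ?f" for g
  proof (rule ccontr)
    assume "\<omega> \<inter> corner_dual ?f ?I g \<noteq> {}"
    then obtain \<tau> where \<tau>: "\<tau> \<in> carrier (triples ?f ?S ?I)"
      and cd: "rho_dual ?f ?S ?I \<tau> \<nu> \<in> corner_dual ?f ?I g" unfolding \<omega>_def by blast
    obtain w where w: "g = inK w" "z * w = w"
      using g(1) span_corner[OF _ z] unfolding idempotents_def by blast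
    have ww: "w * w = w" using g(1) unfolding idempotents_def w by (simp add: in_mult)
    have "w * z = w" using w(2) by (simp add: mult.commute)
    then have gf: "g \<cdot> ?f = g" "?f \<cdot> g = g" by (simp_all add: w in_mult)
    have gg: "g \<cdot> g = g" by (simp add: w in_mult ww)
    obtain t u v where tuv: "?f \<cdot> gel t u = gel t u \<cdot> ?f" "?f \<cdot> gel (- t) v = gel (- t) v \<cdot> ?f"
      "\<And>x. x \<in> ?I \<Longrightarrow> rho ?f ?S ?I (inv\<^bsub>triples ?f ?S ?I\<^esub> \<tau>) x = gel t u \<cdot> x \<cdot> gel (- t) v"
      using corner_act_lift[OF z group.inv_closed[OF group_triples[OF T] \<tau>]] by metis
    define \<kappa> where "\<kappa> = twist \<eta> (gel t u) (gel (- t) v)"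
    have \<kappa>D: "\<kappa> \<in> Dual" unfolding \<kappa>_def by (rule twist_Dual[OF \<eta>])
    have "twist \<kappa> ?f ?f = twist (twist \<eta> ?f ?f) (gel t u) (gel (- t) v)"
      unfolding \<kappa>_def twist_twist tuv(1,2) ..
    then have \<kappa>f: "twist \<kappa> ?f ?f = \<kappa>" by (simp add: tw \<kappa>_def)
    have \<kappa>I: "rho_dual ?f ?S ?I \<tau> \<nu> x = \<kappa> (snd x)" if x: "x \<in> ?I" for x
    proof -
      have "?f \<cdot> (gel t u \<cdot> x \<cdot> gel (- t) v) = gel t u \<cdot> (?f \<cdot> x) \<cdot> gel (- t) v"
        by (metis mulA_assoc tuv(1))
      moreover have "gel t u \<cdot> x \<cdot> gel (- t) v \<cdot> ?f = gel t u \<cdot> (x \<cdot> ?f) \<cdot> gel (- t) v"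
        by (metis mulA_assoc tuv(2))
      ultimately have "gel t u \<cdot> x \<cdot> gel (- t) v \<in> ?I"
        using x unfolding I by (simp add: fst_mulA)
      then show ?thesis
        using x by (simp add: rho_dual_def tuv(3) \<nu>_eq \<kappa>_def twist_def) (simp add: I inJ_snd)
    qed
    have "twist \<kappa> g g y = \<kappa> y" for y
    proof -
      define x where "x = ?f \<cdot> inJ y \<cdot> ?f"
      have x: "x \<in> ?I" unfolding x_def corner_def by blast
      have fx: "?f \<cdot> x = x" "x \<cdot> ?f = x" using x unfolding I by simp_all
      have gI: "g \<cdot> x \<cdot> (?f - g) \<in> ?I" "(?f - g) \<cdot> x \<cdot> g \<in> ?I" "(?f - g) \<cdot> x \<cdot> (?f - g) \<in> ?I"
      proof -
        have ff: "?f \<cdot> ?f = ?f" by (simp add: in_mult z)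
        have 1: "?f \<cdot> (?f - g) = ?f - g" "(?f - g) \<cdot> ?f = ?f - g" by (simp_all add: mulA_diff ff gf)
        have "a \<cdot> x \<cdot> b \<in> ?I" if "?f \<cdot> a = a" "b \<cdot> ?f = b" for a b
        proof -
          have "?f \<cdot> (a \<cdot> x \<cdot> b) = (?f \<cdot> a) \<cdot> x \<cdot> b" "a \<cdot> x \<cdot> b \<cdot> ?f = a \<cdot> x \<cdot> (b \<cdot> ?f)"
            by (simp_all only: mulA_assoc)
          then show ?thesis using x unfolding I by (simp add: fst_mulA that)
        qed
        then show "g \<cdot> x \<cdot> (?f - g) \<in> ?I" "(?f - g) \<cdot> x \<cdot> g \<in> ?I" "(?f - g) \<cdot> x \<cdot> (?f - g) \<in> ?I"
          using 1 gf by blast+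
      qed
      have 0: "\<kappa> (snd (g \<cdot> x \<cdot> (?f - g))) = 0" "\<kappa> (snd ((?f - g) \<cdot> x \<cdot> g)) = 0"
        "\<kappa> (snd ((?f - g) \<cdot> x \<cdot> (?f - g))) = 0"
        using cd x unfolding corner_dual_def \<kappa>I[OF gI(1), symmetric] \<kappa>I[OF gI(2), symmetric]
          \<kappa>I[OF gI(3), symmetric] by blast+
      \<comment> \<open>Peirce decomposition inside the corner, relative to \<open>g\<close> and
        \<open>f - g\<close>.\<close>
      have "x = g \<cdot> x \<cdot> g + g \<cdot> x \<cdot> (?f - g) + (?f - g) \<cdot> x \<cdot> g + (?f - g) \<cdot> x \<cdot> (?f - g)"
        using fx by (simp add: mulA_ring)
      then have "\<kappa> (snd x) = \<kappa> (snd (g \<cdot> x \<cdot> g + g \<cdot> x \<cdot> (?f - g) + (?f - g) \<cdot> x \<cdot> g + (?f - g) \<cdot> x \<cdot> (?f - g)))"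
        by metis
      also have "\<dots> = \<kappa> (snd (g \<cdot> x \<cdot> g))" using 0 by (simp only: snd_add DualD(1)[OF \<kappa>D]) simp
      also have "g \<cdot> x \<cdot> g = (g \<cdot> ?f) \<cdot> inJ y \<cdot> (?f \<cdot> g)" by (simp add: x_def mulA_assoc)
      also have "\<kappa> (snd \<dots>) = twist \<kappa> g g y" by (simp add: twist_def gf)
      also have "\<kappa> (snd x) = \<kappa> y"
        unfolding x_def using fun_cong[OF \<kappa>f, of y] by (simp add: twist_def)
      finally show ?thesis by simp
    qed
    then have "twist \<kappa> (inK w) (inK w) = \<kappa>" unfolding w by blast
    moreover have "\<kappa> \<in> orb \<eta>" unfolding \<kappa>_def by (rule twist_in_orb)
    moreover have "w \<noteq> z" using g(2) w by blast
    ultimately show False using m ww w(2) unfolding minimal_pair_def by blast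
  qed
  have "\<nu> \<in> \<omega>"
  proof -
    interpret P: group "triples ?f ?S ?I" by (rule group_triples[OF T])
    interpret G: group "tri_group ?f ?S ?I" by (rule group_tri_group[OF T])
    have one: "\<one>\<^bsub>triples ?f ?S ?I\<^esub> = (?f, ?f, ?f)" by (simp add: triples_def)
    have "rho ?f ?S ?I (?f, ?f, ?f) x = x" if "x \<in> ?I" for x
      using that G.inv_one unfolding I by (simp add: mulA_assoc)
    then have "(\<lambda>x\<in>?I. \<nu> (rho ?f ?S ?I (?f, ?f, ?f) x)) = \<nu>"
      by (intro extensionalityI[of _ ?I]) (simp_all add: \<nu>_def)
    then have "rho_dual ?f ?S ?I \<one>\<^bsub>triples ?f ?S ?I\<^esub> \<nu> = \<nu>"
      unfolding rho_dual_def P.inv_one unfolding one .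
    then show ?thesis unfolding \<omega>_def using P.one_closed by (metis (mono_tags, lifting) mem_Collect_eq)
  qed
  moreover have "(?f, \<theta>, \<omega>) \<in> labels oneA (range inH) (range inJ)"
    using z \<theta> orbit regular unfolding labels_def regular_orbits_def idempotents_H by blast
  moreover have "form_ext \<eta> \<in> corner_dual oneA (range inJ) ?f" by (rule form_ext_corner_dual[OF z \<eta> tw])
  ultimately show ?thesis
    unfolding supercharacters_of_def supercharacters_def chi_def \<nu>_def
    by (intro CollectI exI conjI) (rule refl)
qed

subsection \<open>Superinduction\<close>

text \<open>The substitution \<open>y = t a\<close>, \<open>w = b\<inverse> t\<inverse>\<close>
  replaces the triples by freely varying parameters; \<open>B\<close> is its inverse.\<close>

lemma sum_triples:
  "(\<Sum>\<tau>\<in>carrier (triples oneA (range inH) (range inJ)). \<Phi> (R oneA (range inH) (range inJ) \<tau> g)) =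
   (\<Sum>(t, u, v)\<in>UNIV. \<Phi> (oneA + gel t u \<cdot> (g - oneA) \<cdot> gel (- t) v))"
proof -
  note T = tri_data_UNIV
  let ?i = "\<lambda>a. inv\<^bsub>Gr\<^esub> a"
  define B where "B = (\<lambda>(t, u, v). (inH t, inH (- t) \<cdot> gel t u, ?i (gel (- t) v \<cdot> inH t)))"
  have HH: "inH (- t) \<cdot> inH t = oneA" "inH t \<cdot> inH (- t) = oneA" for t
    by (simp_all add: in_mult(5) oneA_eq(2)[symmetric])
  have inH_G: "inH t \<in> carrier Gr" for t using gel_in_Gr[of t 0] by (simp add: gel_def)
  have iH: "?i (inH t) = inH (- t)" for t
    by (rule Gr.inv_equality) (simp_all add: HH inH_G)
  have unip: "a \<in> unip oneA (range inJ) \<longleftrightarrow> (\<exists>x. a = gel 0 x)" for a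
    unfolding unip_def gel_def oneA_eq(2)[symmetric] by blast
  have y: "inH t \<cdot> (inH (- t) \<cdot> gel t u) = gel t u" for t u
    by (simp add: mulA_assoc[symmetric] HH)
  have w: "?i (?i (gel (- t) v \<cdot> inH t)) \<cdot> inH (- t) = gel (- t) v" for t v
  proof -
    have "gel (- t) v \<cdot> inH t \<in> carrier Gr" using Gr.m_closed[OF gel_in_Gr inH_G] by simp
    then show ?thesis using Gr.inv_inv by (simp add: mulA_assoc HH)
  qed
  have inj: "inj B"
  proof (rule injI)
    fix p q assume eq: "B p = B q"
    obtain t u v where p: "p = (t, u, v)" by (cases p)
    obtain t' u' v' where q: "q = (t', u', v')" by (cases q)
    have tt: "t' = t" using eq by (simp add: p q B_def)
    have e: "inH (- t) \<cdot> gel t u = inH (- t) \<cdot> gel t u'"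
      "?i (gel (- t) v \<cdot> inH t) = ?i (gel (- t) v' \<cdot> inH t)"
      using eq by (simp_all only: p q B_def tt prod.case prod.inject)
    have "gel t u = gel t u'" using arg_cong[OF e(1), of "(\<cdot>) (inH t)"] unfolding y .
    moreover have "gel (- t) v = gel (- t) v'"
      using arg_cong[OF e(2), of "\<lambda>a. ?i a \<cdot> inH (- t)"] unfolding w .
    ultimately show "p = q" by (simp add: p q tt)
  qed
  have range: "range B = carrier (triples oneA (range inH) (range inJ))"
  proof
    show "range B \<subseteq> carrier (triples oneA (range inH) (range inJ))"
    proof (rule image_subsetI)
      fix p :: "'h \<times> 'j \<times> 'j"
      obtain t u v where p: "p = (t, u, v)" by (cases p)
      have 1: "inH (- t) \<cdot> gel t u = gel 0 (snd (inH (- t) \<cdot> gel t u))"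
        by (simp add: gel_def mulA_distrib HH in_mult oneA_eq(2)[symmetric] inH_inJ oneA_sel)
      have "gel (- t) v \<cdot> inH t = gel 0 (snd (gel (- t) v \<cdot> inH t))"
        by (simp add: gel_def mulA_distrib HH in_mult oneA_eq(2)[symmetric] inH_inJ oneA_sel)
      then have "?i (gel (- t) v \<cdot> inH t) \<in> unip oneA (range inJ)"
        by (intro tri_inv_unip(1)[OF T]) (auto simp only: unip)
      with 1 show "B p \<in> carrier (triples oneA (range inH) (range inJ))"
        unfolding p B_def triples_def by (auto simp add: unip)
    qed
    show "carrier (triples oneA (range inH) (range inJ)) \<subseteq> range B"
    proof
      fix \<tau> assume "\<tau> \<in> carrier (triples oneA (range inH) (range inJ))"
      then obtain t a b where \<tau>: "\<tau> = (inH t, a, b)" "a \<in> unip oneA (range inJ)" "b \<in> unip oneA (range inJ)"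
        by (auto simp: triples_def)
      obtain x where x: "a = gel 0 x" using \<tau>(2) unip by blast
      obtain x' where x': "?i b = gel 0 x'" using tri_inv_unip(1)[OF T \<tau>(3)] unip by blast
      have "inH t \<cdot> a = gel t (snd (inH t \<cdot> a))" "?i b \<cdot> inH (- t) = gel (- t) (snd (?i b \<cdot> inH (- t)))"
        unfolding x x' by (simp_all add: gel_def mulA_distrib in_mult inH_inJ) (simp_all add: inH_eq)
      then have "B (t, snd (inH t \<cdot> a), snd (?i b \<cdot> inH (- t))) =
        (inH t, inH (- t) \<cdot> (inH t \<cdot> a), ?i (?i b \<cdot> inH (- t) \<cdot> inH t))" by (simp add: B_def)
      also have "\<dots> = (inH t, a, ?i (?i b))"
        by (simp add: mulA_assoc HH) (simp add: mulA_assoc[symmetric] HH)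
      also have "\<dots> = \<tau>" using Gr.inv_inv[OF tri_inv_unip(4)[OF T \<tau>(3)]] by (simp add: \<tau>(1))
      finally show "\<tau> \<in> range B" by (metis rangeI)
    qed
  qed
  have "R oneA (range inH) (range inJ) (B (t, u, v)) g = oneA + gel t u \<cdot> (g - oneA) \<cdot> gel (- t) v" for t u v
  proof -
    have "R oneA (range inH) (range inJ) (B (t, u, v)) g = oneA + (inH t \<cdot> (inH (- t) \<cdot> gel t u)) \<cdot> (g - oneA) \<cdot>
      (?i (?i (gel (- t) v \<cdot> inH t)) \<cdot> inH (- t))"
      by (simp add: R_def B_def iH mulA_assoc)
    then show ?thesis unfolding y w .
  qed
  then show ?thesis
    unfolding range[symmetric] sum.reindex[OF inj] by (intro sum.cong refl) auto
qed

definition zext :: "'h set \<Rightarrow> 'j set \<Rightarrow> (('h, 'k, 'j) alg \<Rightarrow> complex) \<Rightarrow> ('h, 'k, 'j) alg \<Rightarrow> complex" where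
  "zext H' J' \<phi> g = (if g \<in> carrier (tri_subgroup H' J') then \<phi> g else 0)"

definition SInd_factor :: "'h set \<Rightarrow> 'j set \<Rightarrow> complex" where
  "SInd_factor H' J' = of_nat (CARD('h)) /
       (of_nat (card (carrier (tri_subgroup UNIV UNIV))) * of_nat (card (carrier (tri_subgroup H' J'))))"

lemma SInd_eq: "SInd H' J' \<phi> g = SInd_factor H' J' *
   (\<Sum>(t, u, v)\<in>UNIV. zext H' J' \<phi> (oneA + gel t u \<cdot> (g - oneA) \<cdot> gel (- t) v))"
  unfolding SInd_def Let_def SInd_factor_def zext_def[symmetric] sum_triples ..

text \<open>Acting on the argument composes with the action summed over, which permutes the
  parameters by \<open>B\<close>.\<close>

lemma SInd_superclass: "superclass_function (SInd H' J' \<phi>)"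
  unfolding superclass_function_def
proof (intro allI)
  fix t0 u0 v0 h x
  let ?y = "gel t0 u0" and ?w = "gel (- t0) v0" and ?g = "gel h x"
  define B where "B = (\<lambda>(t, u, v). (t + t0, snd (gel t u \<cdot> ?y), snd (?w \<cdot> gel (- t) v)))"
  have B1: "gel t u \<cdot> ?y = gel (t + t0) (snd (gel t u \<cdot> ?y))" for t u
    by (simp add: gel_mult)
  have B2: "?w \<cdot> gel (- t) v = gel (- (t + t0)) (snd (?w \<cdot> gel (- t) v))" for t v
    by (simp add: gel_mult)
  obtain a where a: "?y \<cdot> gel (- t0) a = oneA" using gel_inverse by metis
  obtain b where b: "gel (- (- t0)) b \<cdot> ?w = oneA" using gel_inverse by metis
  have "inj B"
  proof (rule injI)
    fix p q assume eq: "B p = B q"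
    obtain t u v where p: "p = (t, u, v)" by (cases p)
    obtain t' u' v' where q: "q = (t', u', v')" by (cases q)
    have tt: "t' = t" using eq by (simp add: p q B_def)
    have e: "snd (gel t u \<cdot> ?y) = snd (gel t u' \<cdot> ?y)"
      "snd (?w \<cdot> gel (- t) v) = snd (?w \<cdot> gel (- t) v')"
      using eq by (simp_all only: p q B_def tt prod.case prod.inject)
    have "gel t u \<cdot> ?y = gel t u' \<cdot> ?y" "?w \<cdot> gel (- t) v = ?w \<cdot> gel (- t) v'"
      by (rule trans[OF B1 trans[OF _ B1[symmetric]]], simp only: e)
        (rule trans[OF B2 trans[OF _ B2[symmetric]]], simp only: e)
    then have "gel t u \<cdot> (?y \<cdot> gel (- t0) a) = gel t u' \<cdot> (?y \<cdot> gel (- t0) a)"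
      "(gel (- (- t0)) b \<cdot> ?w) \<cdot> gel (- t) v = (gel (- (- t0)) b \<cdot> ?w) \<cdot> gel (- t) v'"
      by (simp_all only: mulA_assoc) (simp_all only: mulA_assoc[symmetric])
    then show "p = q" unfolding a b by (simp add: p q tt)
  qed
  moreover have "finite (UNIV :: ('h \<times> 'j \<times> 'j) set)"
    using finite_J by (simp add: finite_Prod_UNIV)
  ultimately have bij: "bij B" by (simp add: bij_def finite_UNIV_inj_surj)
  let ?\<Phi> = "\<lambda>(t, u, v). zext H' J' \<phi> (oneA + gel t u \<cdot> (?g - oneA) \<cdot> gel (- t) v)"
  have "?\<Phi> (B (t, u, v)) = zext H' J' \<phi> (oneA + gel t u \<cdot> (oneA + ?y \<cdot> (?g - oneA) \<cdot> ?w - oneA) \<cdot> gel (- t) v)"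
    for t u v
    unfolding B_def prod.case B1[symmetric] B2[symmetric] by (simp add: mulA_assoc)
  then have "(\<Sum>(t, u, v)\<in>UNIV. zext H' J' \<phi> (oneA + gel t u \<cdot> (oneA + ?y \<cdot> (?g - oneA) \<cdot> ?w - oneA) \<cdot> gel (- t) v)) =
    (\<Sum>p\<in>UNIV. ?\<Phi> (B p))" by (intro sum.cong refl) auto
  also have "\<dots> = (\<Sum>p\<in>UNIV. ?\<Phi> p)" by (rule sum.reindex_bij_betw[OF bij])
  finally show "SInd H' J' \<phi> (oneA + ?y \<cdot> (?g - oneA) \<cdot> ?w) = SInd H' J' \<phi> ?g"
    unfolding SInd_eq by simp
qed

text \<open>For \<open>h\<close> fixing \<open>z\<close> the element \<open>z (h - 1)\<close> is
  zero, so the condition in \<open>FT_right\<close> becomes membership of \<open>x\<close> in the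
  right annihilator. For a linear character \<open>\<theta>\<close> the result is the unnormalised
  inner product of \<open>F\<close> with \<open>\<xi>\<close> on the label group.\<close>

lemma sum_lgroup:
  assumes F: "superclass_function F" and z: "z * z = z" and \<eta>: "\<eta> \<in> Dual"
    and tw: "twist \<eta> (inK z) (inK z) = \<eta>"
  shows "(\<Sum>h | Poly_Mapping.single h 1 * z = z. FT F h \<eta> * inverse (\<theta> (inH h))) =
    (\<Sum>g\<in>lgroup z \<eta>. F g * inverse (xi \<epsilon> \<theta> (form_ext \<eta>) g))"
proof -
  let ?H = "{h. Poly_Mapping.single h (1::'k) * z = z}" and ?J = "{x. \<forall>v. \<eta> (x * v) = 0}"
  have xi: "xi \<epsilon> \<theta> (form_ext \<eta>) (gel h x) = \<theta> (inH h) * \<epsilon> (\<eta> x)" for h x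
    unfolding gel_def by (subst xi_eq) (auto simp: inH_eq)
  have FT: "FT F h \<eta> = (\<Sum>x\<in>?J. F (gel h x) * \<epsilon> (- \<eta> x))" if "h \<in> ?H" for h
  proof -
    have "inK z \<cdot> inK (Poly_Mapping.single h 1 - 1) = 0"
      using that by (simp add: in_mult algebra_simps mult.commute) (simp add: inK_def zero_prod_def)
    then have "\<eta> (snd (inK (Poly_Mapping.single h 1 - 1) \<cdot> inJ v)) = 0" for v
      by (intro vanish_left[OF \<eta> tw]) (simp_all add: fst_mulA mulA_assoc[symmetric])
    then have "\<eta> (snd ((gel h x - oneA) \<cdot> inJ v)) = \<eta> (x * v)" for x v
      unfolding gel_minus_one by (simp add: mulA_distrib DualD[OF \<eta>]) (simp add: in_mult)
    then show ?thesis using FT_right[OF F \<eta>, of h] by simp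
  qed
  have "lgroup z \<eta> = (\<lambda>(h, x). gel h x) ` (?H \<times> ?J)"
  proof
    show "lgroup z \<eta> \<subseteq> (\<lambda>(h, x). gel h x) ` (?H \<times> ?J)"
    proof
      fix g assume g: "g \<in> lgroup z \<eta>"
      then obtain h x where hx: "g = gel h x" using lgroup_subset carrier_Gr by blast
      then have "(h, x) \<in> ?H \<times> ?J" using g gel_in_lgroup by simp
      then show "g \<in> (\<lambda>(h, x). gel h x) ` (?H \<times> ?J)" unfolding hx by (rule rev_image_eqI) simp
    qed
  qed (auto simp: gel_in_lgroup)
  moreover have "inj_on (\<lambda>(h, x). gel h x) (?H \<times> ?J)" by (auto simp: inj_on_def)
  ultimately have "(\<Sum>g\<in>lgroup z \<eta>. F g * inverse (xi \<epsilon> \<theta> (form_ext \<eta>) g)) =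
    (\<Sum>(h, x)\<in>?H \<times> ?J. F (gel h x) * inverse (\<theta> (inH h) * \<epsilon> (\<eta> x)))"
    by (simp add: sum.reindex case_prod_unfold xi)
  also have "\<dots> = (\<Sum>h\<in>?H. \<Sum>x\<in>?J. F (gel h x) * inverse (\<theta> (inH h) * \<epsilon> (\<eta> x)))"
    by (rule sum.cartesian_product[symmetric])
  also have "\<dots> = (\<Sum>h\<in>?H. FT F h \<eta> * inverse (\<theta> (inH h)))"
    by (intro sum.cong refl) (simp add: FT eps_minus sum_distrib_left mult_ac)
  finally show ?thesis by simp
qed

text \<open>Either \<open>\<psi>\<close> is constantly 1 and the sum counts \<open>M\<close>, or
  left multiplication by some \<open>g\<close> with \<open>\<psi> g \<noteq> 1\<close> makes the sum
  vanish.\<close>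

lemma sum_multiplicative_nnrat:
  assumes "finite M" and M: "M \<subseteq> carrier Gr"
    and closed: "\<And>a b. a \<in> M \<Longrightarrow> b \<in> M \<Longrightarrow> a \<cdot> b \<in> M"
    and mult: "\<And>a b. a \<in> M \<Longrightarrow> b \<in> M \<Longrightarrow> \<psi> (a \<cdot> b) = \<psi> a * \<psi> b"
  shows "sum \<psi> M \<in> nnrat"
proof (cases "\<forall>g\<in>M. \<psi> g = 1")
  case True
  then show ?thesis by (simp add: nnrat_of_nat)
next
  case False
  then obtain g where g: "g \<in> M" "\<psi> g \<noteq> 1" by blast
  have "inj_on ((\<cdot>) g) M"
    using Gr.inj_on_cmult[of g] g(1) M by (auto intro: inj_on_subset)
  then have "sum \<psi> M = 0"
    using g closed mult by (intro sum_eq_0_by_shift[OF assms(1), where f = "(\<cdot>) g" and c = "\<psi> g"]) auto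
  then show ?thesis by (simp add: nnrat_0)
qed

text \<open>A computation in the style of Mackey: unfolding superinduction and the induced character
  \<open>\<phi>\<close> leaves sums, each of which compares two linear characters on the part of a
  label group of \<open>G\<close> that is conjugated into a label group of
  \<open>G'\<close>.\<close>

lemma SInd_coefficient:
  assumes sd: "subgroup_data H' J'" and f: "f \<in> idempotents (inH ` H')"
    and \<theta>': "\<theta>' \<in> linear_characters (fixing (inH ` H') f)"
    and \<mu>: "\<mu> \<in> corner_dual oneA (inJ ` J') f"
    and \<phi>: "\<phi> = supercharacter \<epsilon> oneA (inH ` H') (inJ ` J') f \<theta>' \<mu>"
    and z: "z * z = z" and \<eta>: "\<eta> \<in> Dual" and tw: "twist \<eta> (inK z) (inK z) = \<eta>"
    and \<theta>: "\<theta> \<in> lin_chars z"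
  shows "(\<Sum>h | Poly_Mapping.single h 1 * z = z. FT (SInd H' J' \<phi>) h \<eta> * inverse (\<theta> (inH h))) \<in> nnrat"
proof -
  let ?G' = "tri_group oneA (inH ` H') (inJ ` J')"
  let ?Q' = "label_group (inH ` H') (inJ ` J') f \<mu>" and ?\<xi>' = "xi \<epsilon> \<theta>' \<mu>"
  let ?\<xi> = "xi \<epsilon> \<theta> (form_ext \<eta>)" and ?Q = "lgroup z \<eta>"
  interpret G': group ?G' by (rule group_tri_group[OF tri_data_subgroup[OF sd]])
  have z_idem: "inK z \<in> idempotents (range inH)" using z by (auto simp: idempotents_H)
  note Q = label_group_mult[OF subgroup_data_UNIV z_idem form_ext_corner_dual[OF z \<eta> tw] \<theta>, folded lgroup_def]
  note Q' = label_group_mult[OF sd f \<mu> \<theta>']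
  have finG': "finite (carrier ?G')" by (rule finite_alg)
  have inner: "(\<Sum>g\<in>?Q. zext H' J' \<phi> (oneA + gel t u \<cdot> (g - oneA) \<cdot> gel (- t) v) * inverse (?\<xi> g)) \<in> nnrat" for t u v
  proof -
    let ?y = "gel t u"
    obtain u' where y': "?y \<cdot> gel (- t) u' = oneA" "gel (- t) u' \<cdot> ?y = oneA" using gel_inverse by metis
    let ?y' = "gel (- t) u'"
    have y'y: "?y' \<cdot> (?y \<cdot> a) = a" for a using y' by (simp add: mulA_assoc[symmetric])
    \<comment> \<open>Write the right factor as \<open>(w y) y\<inverse>\<close> with
      \<open>w y\<close> in \<open>N\<close>. Every translate is thus a conjugate by
      \<open>y\<close> of the shift \<open>S g\<close>, and \<open>S\<close> permutes
      \<open>?Q\<close> without changing \<open>\<xi>\<close>.\<close>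
    obtain c where c: "gel (- t) v \<cdot> ?y = gel 0 c" unfolding gel_mult by simp
    have cy: "gel 0 c \<cdot> ?y' = gel (- t) v" unfolding c[symmetric] by (simp add: mulA_assoc y')
    define S where "S g = oneA + (g - oneA) \<cdot> gel 0 c" for g
    have Sy: "oneA + ?y \<cdot> (g - oneA) \<cdot> gel (- t) v = ?y \<cdot> S g \<cdot> ?y'" for g
      unfolding S_def cy[symmetric] by (simp add: mulA_distrib mulA_assoc y')
    have Sxi: "xi0 z \<theta> \<eta> (S g) = xi0 z \<theta> \<eta> g" if "g \<in> ?Q" for g
    proof -
      obtain h x where "g = gel h x" using \<open>g \<in> ?Q\<close> lgroup_subset carrier_Gr by blast
      then show ?thesis unfolding S_def by (simp only: xi0_right[OF \<eta> tw])
    qed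
    have SQ: "S g \<in> ?Q \<and> ?\<xi> (S g) = ?\<xi> g" if g: "g \<in> ?Q" for g
      using Sxi[OF g] g Q(3)[OF g g] by (auto simp: xi0_def split: if_splits)
    have "inj_on S ?Q"
    proof (rule inj_onI)
      fix g g' assume "S g = S g'"
      then have "(g - oneA) \<cdot> gel 0 c = (g' - oneA) \<cdot> gel 0 c" by (simp add: S_def)
      moreover obtain c' where "gel 0 c \<cdot> gel (- 0) c' = oneA" using gel_inverse by metis
      ultimately have "g - oneA = g' - oneA" by (metis mulA_assoc mulA_one(2))
      then show "g = g'" by simp
    qed
    moreover from this have "S ` ?Q = ?Q"
      using SQ by (intro card_subset_eq[OF finite_alg] card_image) blast+
    ultimately have "bij_betw S ?Q ?Q" unfolding bij_betw_def ..
    from sum.reindex_bij_betw[OF this, of "\<lambda>g. zext H' J' \<phi> (?y \<cdot> g \<cdot> ?y') * inverse (?\<xi> g)"]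
    have "(\<Sum>g\<in>?Q. zext H' J' \<phi> (oneA + ?y \<cdot> (g - oneA) \<cdot> gel (- t) v) * inverse (?\<xi> g)) =
      (\<Sum>g\<in>?Q. zext H' J' \<phi> (?y \<cdot> g \<cdot> ?y') * inverse (?\<xi> g))"
      unfolding Sy using SQ by simp
    also have "\<dots> = (\<Sum>g\<in>?Q. \<Sum>k\<in>carrier ?G'.
      if ?y \<cdot> g \<cdot> ?y' \<in> carrier ?G' \<and> inv\<^bsub>?G'\<^esub> k \<cdot> (?y \<cdot> g \<cdot> ?y') \<cdot> k \<in> ?Q'
      then ?\<xi>' (inv\<^bsub>?G'\<^esub> k \<cdot> (?y \<cdot> g \<cdot> ?y') \<cdot> k) * inverse (?\<xi> g) else 0) / of_nat (card ?Q')"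
    proof -
      have "zext H' J' \<phi> (?y \<cdot> g \<cdot> ?y') * inverse (?\<xi> g) = (\<Sum>k\<in>carrier ?G'.
        if ?y \<cdot> g \<cdot> ?y' \<in> carrier ?G' \<and> inv\<^bsub>?G'\<^esub> k \<cdot> (?y \<cdot> g \<cdot> ?y') \<cdot> k \<in> ?Q'
        then ?\<xi>' (inv\<^bsub>?G'\<^esub> k \<cdot> (?y \<cdot> g \<cdot> ?y') \<cdot> k) * inverse (?\<xi> g) else 0) / of_nat (card ?Q')" for g
      proof (cases "?y \<cdot> g \<cdot> ?y' \<in> carrier ?G'")
        case True
        have "zext H' J' \<phi> (?y \<cdot> g \<cdot> ?y') = (\<Sum>k\<in>carrier ?G'.
          if inv\<^bsub>?G'\<^esub> k \<cdot> (?y \<cdot> g \<cdot> ?y') \<cdot> k \<in> ?Q' then ?\<xi>' (inv\<^bsub>?G'\<^esub> k \<cdot> (?y \<cdot> g \<cdot> ?y') \<cdot> k) else 0)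
          / of_nat (card ?Q')"
          using True unfolding zext_def tri_subgroup_def \<phi> supercharacter_def
          by (simp add: induced_character_eq[OF finG' True] cong: if_cong)
        then show ?thesis using True
          by (simp add: sum_distrib_right if_distrib[of "\<lambda>x. x * _"] cong: if_cong)
      qed (simp add: zext_def tri_subgroup_def)
      then show ?thesis by (simp add: sum_divide_distrib)
    qed
    also have "\<dots> = (\<Sum>k\<in>carrier ?G'. \<Sum>g | g \<in> ?Q \<and>
      ?y \<cdot> g \<cdot> ?y' \<in> carrier ?G' \<and> inv\<^bsub>?G'\<^esub> k \<cdot> (?y \<cdot> g \<cdot> ?y') \<cdot> k \<in> ?Q'.
      ?\<xi>' (inv\<^bsub>?G'\<^esub> k \<cdot> (?y \<cdot> g \<cdot> ?y') \<cdot> k) * inverse (?\<xi> g)) / of_nat (card ?Q')"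
      by (subst sum.swap) (simp add: sum.inter_filter finite_alg)
    also have "\<dots> \<in> nnrat"
    proof (rule nnrat_divide[OF nnrat_sum[OF sum_multiplicative_nnrat[OF finite_alg]] nnrat_of_nat])
      fix k assume k: "k \<in> carrier ?G'"
      let ?M = "{g \<in> ?Q. ?y \<cdot> g \<cdot> ?y' \<in> carrier ?G' \<and> inv\<^bsub>?G'\<^esub> k \<cdot> (?y \<cdot> g \<cdot> ?y') \<cdot> k \<in> ?Q'}"
      show "?M \<subseteq> carrier Gr" using lgroup_subset by blast
      fix a b assume a: "a \<in> ?M" and b: "b \<in> ?M"
      have kk: "k \<cdot> (inv\<^bsub>?G'\<^esub> k \<cdot> a) = a" for a
        using G'.r_inv[OF k] by (simp add: mulA_assoc[symmetric])
      have 1: "?y \<cdot> (a \<cdot> b) \<cdot> ?y' = (?y \<cdot> a \<cdot> ?y') \<cdot> (?y \<cdot> b \<cdot> ?y')"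
        by (simp add: mulA_assoc y'y)
      then have 2: "inv\<^bsub>?G'\<^esub> k \<cdot> (?y \<cdot> (a \<cdot> b) \<cdot> ?y') \<cdot> k =
        (inv\<^bsub>?G'\<^esub> k \<cdot> (?y \<cdot> a \<cdot> ?y') \<cdot> k) \<cdot> (inv\<^bsub>?G'\<^esub> k \<cdot> (?y \<cdot> b \<cdot> ?y') \<cdot> k)"
        by (simp add: mulA_assoc kk)
      have 3: "?y \<cdot> (a \<cdot> b) \<cdot> ?y' \<in> carrier ?G'"
        unfolding 1 using G'.m_closed[of "?y \<cdot> a \<cdot> ?y'" "?y \<cdot> b \<cdot> ?y'"] a b by simp
      show "a \<cdot> b \<in> ?M" unfolding mem_Collect_eq 2 using a b 3 Q(1) Q'(1) by blast
      show "?\<xi>' (inv\<^bsub>?G'\<^esub> k \<cdot> (?y \<cdot> (a \<cdot> b) \<cdot> ?y') \<cdot> k) * inverse (?\<xi> (a \<cdot> b)) =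
        ?\<xi>' (inv\<^bsub>?G'\<^esub> k \<cdot> (?y \<cdot> a \<cdot> ?y') \<cdot> k) * inverse (?\<xi> a) *
        (?\<xi>' (inv\<^bsub>?G'\<^esub> k \<cdot> (?y \<cdot> b \<cdot> ?y') \<cdot> k) * inverse (?\<xi> b))"
        unfolding 2 using a b by (simp add: Q(2) Q'(2) mult_ac)
    qed
    finally show ?thesis .
  qed
  have "(\<Sum>g\<in>?Q. SInd H' J' \<phi> g * inverse (?\<xi> g)) = SInd_factor H' J' * (\<Sum>p\<in>UNIV. \<Sum>g\<in>?Q.
    (case p of (t, u, v) \<Rightarrow> zext H' J' \<phi> (oneA + gel t u \<cdot> (g - oneA) \<cdot> gel (- t) v)) * inverse (?\<xi> g))"
    unfolding SInd_eq by (subst sum.swap) (simp add: sum_distrib_left sum_distrib_right mult.assoc)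
  also have "\<dots> \<in> nnrat"
  proof (rule nnrat_mult[OF _ nnrat_sum])
    show "SInd_factor H' J' \<in> nnrat"
      unfolding SInd_factor_def by (intro nnrat_divide nnrat_mult nnrat_of_nat)
    fix p :: "'h \<times> 'j \<times> 'j"
    show "(\<Sum>g\<in>?Q. (case p of (t, u, v) \<Rightarrow> zext H' J' \<phi> (oneA + gel t u \<cdot> (g - oneA) \<cdot> gel (- t) v)) *
      inverse (?\<xi> g)) \<in> nnrat"
      using inner by (cases p) simp
  qed
  finally show ?thesis unfolding sum_lgroup[OF SInd_superclass z \<eta> tw] .
qed

subsection \<open>Expansion of superclass functions in supercharacters\<close>

definition fix_group :: "('h, 'k) poly_mapping \<Rightarrow> ('h, 'k, 'j) alg monoid" where
  "fix_group z = \<lparr>carrier = fixing (range inH) (inK z), mult = (\<cdot>), one = oneA\<rparr>"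

lemma fix_group_sel [simp]:
  "carrier (fix_group z) = inH ` {h. Poly_Mapping.single h 1 * z = z}"
  "mult (fix_group z) = (\<cdot>)" "one (fix_group z) = oneA"
proof -
  have "inH h \<cdot> inK z = inK z \<longleftrightarrow> Poly_Mapping.single h 1 * z = z" for h
    by (simp add: inH_eq in_mult)
  then show "carrier (fix_group z) = inH ` {h. Poly_Mapping.single h 1 * z = z}"
    unfolding fix_group_def fixing_def by auto
qed (simp_all add: fix_group_def)

lemma group_characters_fix_group: "group_characters (fix_group z) = lin_chars z"
  unfolding group_characters_def linear_characters_def by (simp add: fix_group_def)

lemma comm_group_fix_group: "comm_group (fix_group z)"
proof (rule comm_groupI)
  have m: "Poly_Mapping.single (h + h') (1::'k) = Poly_Mapping.single h 1 * Poly_Mapping.single h' 1" for h h' :: 'h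
    by (simp add: mult_single)
  fix a assume "a \<in> carrier (fix_group z)"
  then obtain h where h: "a = inH h" "Poly_Mapping.single h 1 * z = z" by auto
  have "Poly_Mapping.single (- h) 1 * z = Poly_Mapping.single (- h) 1 * (Poly_Mapping.single h 1 * z)"
    by (simp add: h)
  also have "\<dots> = z" by (simp add: mult.assoc[symmetric] mult_single)
  finally have "inH (- h) \<in> carrier (fix_group z)" by simp
  then show "\<exists>b\<in>carrier (fix_group z). b \<otimes>\<^bsub>fix_group z\<^esub> a = \<one>\<^bsub>fix_group z\<^esub>"
    by (rule bexI[rotated]) (simp add: h in_mult oneA_eq(2))
  show "\<one>\<^bsub>fix_group z\<^esub> \<otimes>\<^bsub>fix_group z\<^esub> a = a" by simp
  fix b assume "b \<in> carrier (fix_group z)"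
  then obtain h' where h': "b = inH h'" "Poly_Mapping.single h' 1 * z = z" by auto
  show "a \<otimes>\<^bsub>fix_group z\<^esub> b = b \<otimes>\<^bsub>fix_group z\<^esub> a"
    by (simp add: h h' in_mult add.commute)
  show "a \<otimes>\<^bsub>fix_group z\<^esub> b \<in> carrier (fix_group z)"
    by (simp add: h h' in_mult(5)) (simp add: m mult.assoc h h')
qed (auto simp: mulA_assoc oneA_eq(2))

lemma finite_lin_chars: "finite (lin_chars z)"
  using comm_group.finite_group_characters[OF comm_group_fix_group finite_alg]
  by (simp add: group_characters_fix_group)

lemma card_lin_chars: "card (lin_chars z) > 0"
proof -
  have "(\<lambda>a\<in>carrier (fix_group z). 1) \<in> group_characters (fix_group z)"
    using comm_group_fix_group[of z] unfolding group_characters_def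
    by (simp add: comm_group_def monoid.m_closed comm_monoid.axioms del: fix_group_sel)
  then show ?thesis
    using finite_lin_chars unfolding group_characters_fix_group by (auto simp: card_gt_0_iff)
qed

lemma lin_chars_expansion:
  assumes "Poly_Mapping.single h (1::'k) * z = z"
  shows "(\<Sum>\<theta>\<in>lin_chars z. (\<Sum>h | Poly_Mapping.single h 1 * z = z. \<kappa> h * inverse (\<theta> (inH h))) * \<theta> (inH h)) =
    of_nat (card (lin_chars z)) * \<kappa> h"
proof -
  have inj: "inj_on inH A" for A by (simp add: inj_on_def)
  have "the_inv inH (inH h) = h" for h by (rule the_inv_f_f[OF inj])
  then show ?thesis
    using comm_group.character_expansion[OF comm_group_fix_group finite_alg, of "inH h" z "\<lambda>a. \<kappa> (the_inv inH a)"]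
      assms
    by (simp add: group_characters_fix_group sum.reindex[OF inj])
qed

lemma FT_diff: "FT (\<lambda>g. F g - F' g) h \<mu> = FT F h \<mu> - FT F' h \<mu>"
  by (simp add: FT_def left_diff_distrib sum_subtractf)

lemma FT_lincomb: "FT (\<lambda>g. \<Sum>p\<in>P. c p * \<Psi> p g) h \<mu> = (\<Sum>p\<in>P. c p * FT (\<Psi> p) h \<mu>)"
  unfolding FT_def sum_distrib_left sum_distrib_right
  by (subst sum.swap) (simp add: mult.assoc)

text \<open>
  A superclass function is determined by its Fourier transforms at one point of each orbit, and
  by minimality of the chosen points these are supported on \<open>H(e)\<close>.
\<close>

lemma superclass_function_expansion:
  assumes F: "superclass_function F"
    and nn: "\<And>z \<eta> \<theta>. minimal_pair z \<eta> \<Longrightarrow> \<theta> \<in> lin_chars z \<Longrightarrow>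
      (\<Sum>h | Poly_Mapping.single h 1 * z = z. FT F h \<eta> * inverse (\<theta> (inH h))) \<in> nnrat"
  shows "\<exists>(P :: (('j \<Rightarrow> 'k) set \<times> (('h, 'k, 'j) alg \<Rightarrow> complex)) set) c \<Psi>. finite P \<and>
    (\<forall>p\<in>P. \<Psi> p \<in> supercharacters_of \<epsilon> UNIV UNIV \<and> (0::rat) \<le> c p) \<and>
    (\<forall>h x. F (gel h x) = (\<Sum>p\<in>P. of_rat (c p) * \<Psi> p (gel h x)))"
proof -
  have "\<forall>\<Omega>\<in>orb ` Dual. \<exists>p. snd p \<in> \<Omega> \<and> minimal_pair (fst p) (snd p)"
    using minimal_pair_ex by fastforce
  then obtain f where f: "\<And>\<Omega>. \<Omega> \<in> orb ` Dual \<Longrightarrow> snd (f \<Omega>) \<in> \<Omega> \<and> minimal_pair (fst (f \<Omega>)) (snd (f \<Omega>))"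
    by metis
  define Z where "Z \<Omega> = fst (f \<Omega>)" for \<Omega>
  define E where "E \<Omega> = snd (f \<Omega>)" for \<Omega>
  have m: "minimal_pair (Z \<Omega>) (E \<Omega>)" and orbE: "orb (E \<Omega>) = \<Omega>" if "\<Omega> \<in> orb ` Dual" for \<Omega>
    using f[OF that] that orb_eq by (auto simp: Z_def E_def)
  have zi: "Z \<Omega> * Z \<Omega> = Z \<Omega>" and ED: "E \<Omega> \<in> Dual"
    and tw: "twist (E \<Omega>) (inK (Z \<Omega>)) (inK (Z \<Omega>)) = E \<Omega>" if "\<Omega> \<in> orb ` Dual" for \<Omega>
    using m[OF that] by (simp_all add: minimal_pair_def)
  have "\<forall>\<Omega>\<in>orb ` Dual. \<exists>q::rat. q > 0 \<and> (\<forall>\<theta> h. FT (chi (Z \<Omega>) \<theta> (E \<Omega>)) h (E \<Omega>) =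
    (if Poly_Mapping.single h 1 * Z \<Omega> = Z \<Omega> then of_rat q * \<theta> (inH h) else 0))"
    using FT_chi_self ED tw by blast
  then obtain q :: "_ \<Rightarrow> rat" where q: "\<And>\<Omega>. \<Omega> \<in> orb ` Dual \<Longrightarrow> q \<Omega> > 0"
    "\<And>\<Omega> \<theta> h. \<Omega> \<in> orb ` Dual \<Longrightarrow> FT (chi (Z \<Omega>) \<theta> (E \<Omega>)) h (E \<Omega>) =
      (if Poly_Mapping.single h 1 * Z \<Omega> = Z \<Omega> then of_rat (q \<Omega>) * \<theta> (inH h) else 0)"
    by metis
  define C where "C \<Omega> \<theta> = (\<Sum>h | Poly_Mapping.single h 1 * Z \<Omega> = Z \<Omega>. FT F h (E \<Omega>) * inverse (\<theta> (inH h)))" for \<Omega> \<theta>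
  define P where "P = Sigma (orb ` Dual) (\<lambda>\<Omega>. lin_chars (Z \<Omega>))"
  have finP: "finite P"
    unfolding P_def using finite_Dual finite_lin_chars by (intro finite_SigmaI) auto
  have "\<forall>p\<in>P. \<exists>r. 0 \<le> r \<and> C (fst p) (snd p) = of_rat r"
    using nn m unfolding P_def C_def nnrat_def by fastforce
  then obtain r :: "_ \<Rightarrow> rat" where r: "\<And>p. p \<in> P \<Longrightarrow> 0 \<le> r p"
    "\<And>p. p \<in> P \<Longrightarrow> C (fst p) (snd p) = of_rat (r p)" by metis
  define c where "c p = r p / (of_nat (card (lin_chars (Z (fst p)))) * q (fst p))" for p
  define \<Psi> where "\<Psi> p = chi (Z (fst p)) (snd p) (E (fst p))" for p
  have c0: "0 \<le> c p" if "p \<in> P" for p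
    using r(1)[OF that] q(1)[of "fst p"] that by (auto simp: c_def P_def less_imp_le)
  have c: "of_rat (c (\<Omega>, \<theta>)) * of_rat (q \<Omega>) = C \<Omega> \<theta> / of_nat (card (lin_chars (Z \<Omega>)))"
    if "\<Omega> \<in> orb ` Dual" "\<theta> \<in> lin_chars (Z \<Omega>)" for \<Omega> \<theta>
    using r(2)[of "(\<Omega>, \<theta>)"] q(1)[OF that(1)] that
    by (simp add: P_def c_def of_rat_divide of_rat_mult)
  define D where "D g = F g - (\<Sum>p\<in>P. of_rat (c p) * \<Psi> p g)" for g
  have "superclass_function (\<Psi> p)" if "p \<in> P" for p
    using that chi_superclass ED tw by (auto simp: \<Psi>_def P_def)
  then have D: "superclass_function D"
    using F unfolding superclass_function_def D_def by (simp cong: sum.cong)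
  have FTD: "FT D h (E \<Omega>) = 0" if \<Omega>: "\<Omega> \<in> orb ` Dual" for h \<Omega>
  proof -
    have "FT D h (E \<Omega>) = FT F h (E \<Omega>) - (\<Sum>p\<in>P. of_rat (c p) * FT (\<Psi> p) h (E \<Omega>))"
      unfolding D_def FT_diff FT_lincomb ..
    also have "(\<Sum>p\<in>P. of_rat (c p) * FT (\<Psi> p) h (E \<Omega>)) =
      (\<Sum>\<Omega>'\<in>orb ` Dual. \<Sum>\<theta>\<in>lin_chars (Z \<Omega>'). of_rat (c (\<Omega>', \<theta>)) * FT (\<Psi> (\<Omega>', \<theta>)) h (E \<Omega>))"
      unfolding P_def using finite_Dual finite_lin_chars by (subst sum.Sigma) (auto simp: case_prod_unfold)
    also have "\<dots> = (\<Sum>\<Omega>'\<in>orb ` Dual. if \<Omega>' = \<Omega> then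
      (\<Sum>\<theta>\<in>lin_chars (Z \<Omega>). of_rat (c (\<Omega>, \<theta>)) * FT (\<Psi> (\<Omega>, \<theta>)) h (E \<Omega>)) else 0)"
    proof (intro sum.cong refl)
      fix \<Omega>' assume \<Omega>': "\<Omega>' \<in> orb ` Dual"
      have "E \<Omega> \<notin> orb (E \<Omega>')" if "\<Omega>' \<noteq> \<Omega>"
        using that orb_eq[of "E \<Omega>" "E \<Omega>'"] orbE[OF \<Omega>] orbE[OF \<Omega>'] by auto
      then show "(\<Sum>\<theta>\<in>lin_chars (Z \<Omega>'). of_rat (c (\<Omega>', \<theta>)) * FT (\<Psi> (\<Omega>', \<theta>)) h (E \<Omega>)) =
        (if \<Omega>' = \<Omega> then (\<Sum>\<theta>\<in>lin_chars (Z \<Omega>). of_rat (c (\<Omega>, \<theta>)) * FT (\<Psi> (\<Omega>, \<theta>)) h (E \<Omega>)) else 0)"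
        using FT_chi_other[OF ED[OF \<Omega>'] ED[OF \<Omega>]] by (simp add: \<Psi>_def)
    qed
    also have "\<dots> = (\<Sum>\<theta>\<in>lin_chars (Z \<Omega>). of_rat (c (\<Omega>, \<theta>)) * FT (\<Psi> (\<Omega>, \<theta>)) h (E \<Omega>))"
      using finite_Dual \<Omega> by simp
    also have "\<dots> = FT F h (E \<Omega>)"
    proof (cases "Poly_Mapping.single h (1::'k) * Z \<Omega> = Z \<Omega>")
      case True
      have "(\<Sum>\<theta>\<in>lin_chars (Z \<Omega>). of_rat (c (\<Omega>, \<theta>)) * FT (\<Psi> (\<Omega>, \<theta>)) h (E \<Omega>)) =
        (\<Sum>\<theta>\<in>lin_chars (Z \<Omega>). C \<Omega> \<theta> * \<theta> (inH h)) / of_nat (card (lin_chars (Z \<Omega>)))"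
        unfolding sum_divide_distrib
      proof (intro sum.cong refl)
        fix \<theta> assume \<theta>: "\<theta> \<in> lin_chars (Z \<Omega>)"
        have "of_rat (c (\<Omega>, \<theta>)) * FT (\<Psi> (\<Omega>, \<theta>)) h (E \<Omega>) =
          (of_rat (c (\<Omega>, \<theta>)) * of_rat (q \<Omega>)) * \<theta> (inH h)"
          using True by (simp add: \<Psi>_def q(2)[OF \<Omega>])
        then show "of_rat (c (\<Omega>, \<theta>)) * FT (\<Psi> (\<Omega>, \<theta>)) h (E \<Omega>) =
          C \<Omega> \<theta> * \<theta> (inH h) / of_nat (card (lin_chars (Z \<Omega>)))"
          unfolding c[OF \<Omega> \<theta>] by simp
      qed
      also have "\<dots> = FT F h (E \<Omega>)"
        unfolding C_def lin_chars_expansion[OF True] using card_lin_chars[of "Z \<Omega>"] by simp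
      finally show ?thesis .
    next
      case False
      then show ?thesis using FT_eq_0[OF F m[OF \<Omega>]] by (auto simp: \<Psi>_def q(2)[OF \<Omega>])
    qed
    finally show ?thesis by simp
  qed
  have "FT D h \<mu> = 0" if \<mu>: "\<mu> \<in> Dual" for h \<mu>
  proof -
    have \<Omega>: "orb \<mu> \<in> orb ` Dual" using \<mu> by simp
    have "\<mu> \<in> orb (E (orb \<mu>))" using orb_refl orbE[OF \<Omega>] by blast
    then obtain t u v where "\<mu> = twist (E (orb \<mu>)) (gel t u) (gel (- t) v)" unfolding orb_def by blast
    then show ?thesis using FT_twist[OF D ED[OF \<Omega>]] FTD[OF \<Omega>] by (metis mult_zero_right)
  qed
  then have "D (gel h x) = 0" for h x by (rule FT_eq_0_imp)
  then have "F (gel h x) = (\<Sum>p\<in>P. of_rat (c p) * \<Psi> p (gel h x))" for h x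
    by (simp add: D_def)
  moreover have "\<Psi> p \<in> supercharacters_of \<epsilon> UNIV UNIV" if "p \<in> P" for p
    using that chi_supercharacter m by (auto simp: \<Psi>_def P_def)
  ultimately show ?thesis using finP c0 by blast
qed

lemma SInd_supercharacter:
  assumes sd: "subgroup_data H' J'" and \<phi>: "\<phi> \<in> supercharacters_of \<epsilon> H' J'"
  shows "\<exists>X (c :: (('h, 'k, 'j) alg \<Rightarrow> complex) \<Rightarrow> rat).
    finite X \<and> X \<subseteq> supercharacters_of \<epsilon> UNIV UNIV \<and> (\<forall>\<chi>\<in>X. 0 \<le> c \<chi>) \<and>
    (\<forall>g \<in> carrier (tri_subgroup UNIV UNIV). SInd H' J' \<phi> g = (\<Sum>\<chi>\<in>X. of_rat (c \<chi>) * \<chi> g))"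
proof -
  obtain f \<theta>' \<mu> where \<phi>': "f \<in> idempotents (inH ` H')"
    "\<theta>' \<in> linear_characters (fixing (inH ` H') f)" "\<mu> \<in> corner_dual oneA (inJ ` J') f"
    "\<phi> = supercharacter \<epsilon> oneA (inH ` H') (inJ ` J') f \<theta>' \<mu>"
    using \<phi> unfolding supercharacters_of_def supercharacters_def labels_def by blast
  have "(\<Sum>h | Poly_Mapping.single h 1 * z = z. FT (SInd H' J' \<phi>) h \<eta> * inverse (\<theta> (inH h))) \<in> nnrat"
    if "minimal_pair z \<eta>" "\<theta> \<in> lin_chars z" for z \<eta> \<theta>
    using SInd_coefficient[OF sd \<phi>'] that unfolding minimal_pair_def by blast
  from superclass_function_expansion[OF SInd_superclass this]
  obtain P c \<Psi> where P: "finite (P :: (('j \<Rightarrow> 'k) set \<times> (('h, 'k, 'j) alg \<Rightarrow> complex)) set)"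
    "\<And>p. p \<in> P \<Longrightarrow> \<Psi> p \<in> supercharacters_of \<epsilon> UNIV UNIV" "\<And>p. p \<in> P \<Longrightarrow> (0::rat) \<le> c p"
    "\<And>h x. SInd H' J' \<phi> (gel h x) = (\<Sum>p\<in>P. of_rat (c p) * \<Psi> p (gel h x))" by blast
  define c' where "c' \<chi> = (\<Sum>p | p \<in> P \<and> \<Psi> p = \<chi>. c p)" for \<chi>
  have "SInd H' J' \<phi> g = (\<Sum>\<chi>\<in>\<Psi> ` P. of_rat (c' \<chi>) * \<chi> g)" if g: "g \<in> carrier Gr" for g
  proof -
    obtain h x where "g = gel h x" using g carrier_Gr by blast
    then have "SInd H' J' \<phi> g = (\<Sum>p\<in>P. of_rat (c p) * \<Psi> p g)" by (simp add: P(4))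
    also have "\<dots> = (\<Sum>\<chi>\<in>\<Psi> ` P. \<Sum>p | p \<in> P \<and> \<Psi> p = \<chi>. of_rat (c p) * \<Psi> p g)"
      by (rule sum.image_gen[OF P(1)])
    also have "\<dots> = (\<Sum>\<chi>\<in>\<Psi> ` P. of_rat (c' \<chi>) * \<chi> g)"
      by (intro sum.cong refl) (simp add: c'_def of_rat_sum sum_distrib_right)
    finally show ?thesis .
  qed
  moreover have "0 \<le> c' \<chi>" for \<chi>
    unfolding c'_def using P(3) by (intro sum_nonneg) auto
  ultimately show ?thesis
    unfolding tri_subgroup_def using P(1,2) by (intro exI[of _ "\<Psi> ` P"] exI[of _ c']) auto
qed

end

theorem corollary5p2:
  fixes scale :: "'k::{field,finite} \<Rightarrow> 'j::ring \<Rightarrow> 'j"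
    and lact :: "'h::{ab_group_add,finite} \<Rightarrow> 'j \<Rightarrow> 'j"
    and ract :: "'j \<Rightarrow> 'h \<Rightarrow> 'j"
    and \<epsilon> :: "'k \<Rightarrow> complex"
    and H' :: "'h set" and J' :: "'j set"
    and \<phi> :: "('h, 'k, 'j) alg \<Rightarrow> complex"
  assumes "triangular_type scale lact ract"
    and "nontrivial_additive_character \<epsilon>"
    and "triangular_type.subgroup_data scale lact ract H' J'"
    and "\<phi> \<in> triangular_type.supercharacters_of scale lact ract \<epsilon> H' J'"
  shows "\<exists>X (c :: (('h, 'k, 'j) alg \<Rightarrow> complex) \<Rightarrow> rat).
           finite X \<and> X \<subseteq> triangular_type.supercharacters_of scale lact ract \<epsilon> UNIV UNIV \<and>
           (\<forall>\<chi>\<in>X. 0 \<le> c \<chi>) \<and>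
           (\<forall>g \<in> carrier (triangular_type.tri_subgroup scale lact ract UNIV UNIV).
              triangular_type.SInd scale lact ract H' J' \<phi> g = (\<Sum>\<chi>\<in>X. of_rat (c \<chi>) * \<chi> g))"
proof -
  interpret triangular_type_character scale lact ract \<epsilon>
    using assms(1,2) by (intro triangular_type_character.intro triangular_type_character_axioms.intro)
  show ?thesis using assms(3,4) by (rule SInd_supercharacter)
qed

end
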